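(* Let $G$ be a finite group, $p$ a prime, $N$ a normal subgroup of $G$ and $P$ a Sylow $p$-subgroup of $N$. Suppose that: (1) every subgroup of $P$ of order $p$ satisfies the $IC$-$\Pi$-property in $G$; (2) if $p=2$ and $P$ is non-abelian, then in addition every cyclic subgroup of $P$ of order $4$ satisfies the $IC$-$\Pi$-property in $G$. Then $N\le Z_{p\mathfrak{U}}(G)$.
   Context: All groups are finite and $p$ is a fixed prime. For a group $A$, $\pi(A)$ denotes the set of prime divisors of $|A|$; for a set $\pi$ of primes, a $\pi$-number is a positive integer all of whose prime divisors lie in $\pi$ (so $1$ is always a $\pi$-number). $\Pi$-property: a subgroup $H$ of $G$ satisfies the $\Pi$-property in $G$ if for every chief factor $L/K$ of $G$, the index $|G/K:N_{G/K}(HK/K\cap L/K)|$ is a $\pi(HK/K\cap L/K)$-number. $IC$-$\Pi$-property: a subgroup $H$ of $G$ satisfies the $IC$-$\Pi$-property in $G$ if the subgroup $H\cap[H,G]$ satisfies the $\Pi$-property in $G$, where $[H,G]$ is the commutator subgroup generated by all $[h,g]$, $h\in H$, $g\in G$. $p\mathfrak{U}$-hypercenter: $Z_{p\mathfrak{U}}(G)$ is the product of all normal subgroups $A$ of $G$ such that every $p$-chief factor of $G$ below $A$ (i.e. every chief factor $L/K$ of $G$ with $L\le A$ and $p$ dividing $|L/K|$) is cyclic. *)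

theory Defs
  imports
    "HOL-Computational_Algebra.Primes"
    "HOL-Algebra.Coset"
    "HOL-Algebra.Generated_Groups"
    "HOL-Algebra.Group_Action"
    "HOL-Algebra.Elementary_Groups"
begin

definition subquotient :: "('a, 'b) monoid_scheme \<Rightarrow> 'a set \<Rightarrow> 'a set \<Rightarrow> 'a set monoid"
  where "subquotient G L K = (G\<lparr>carrier := L\<rparr>) Mod K"

definition sylow_subgroup :: "nat \<Rightarrow> ('a, 'b) monoid_scheme \<Rightarrow> 'a set \<Rightarrow> bool"
  where "sylow_subgroup p G P \<longleftrightarrow>
    subgroup P G \<and> card P = p ^ multiplicity p (order G)"

definition subgroup_index :: "('a, 'b) monoid_scheme \<Rightarrow> 'a set \<Rightarrow> nat"
  where "subgroup_index G H = card (rcosets\<^bsub>G\<^esub> H)"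

definition pi_number :: "nat set \<Rightarrow> nat \<Rightarrow> bool"
  where "pi_number \<pi> n \<longleftrightarrow> n > 0 \<and> prime_factors n \<subseteq> \<pi>"

definition minimal_normal_subgroup :: "('a, 'b) monoid_scheme \<Rightarrow> 'a set \<Rightarrow> bool"
  where "minimal_normal_subgroup G M \<longleftrightarrow>
    M \<lhd> G \<and> M \<noteq> {\<one>\<^bsub>G\<^esub>} \<and> (\<forall>A. A \<lhd> G \<and> A \<subseteq> M \<longrightarrow> A = {\<one>\<^bsub>G\<^esub>} \<or> A = M)"

definition chief_factor :: "('a, 'b) monoid_scheme \<Rightarrow> 'a set \<Rightarrow> 'a set \<Rightarrow> bool"
  where "chief_factor G L K \<longleftrightarrow>
    K \<lhd> G \<and> L \<lhd> G \<and> K \<subseteq> L \<and>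
    minimal_normal_subgroup (G Mod K) (carrier (subquotient G L K))"

text \<open>Below, \<open>A\<close> is \<open>HK/K \<inter> L/K\<close>, a set of cosets of \<open>K\<close>, i.e. a subset of the carrier of
  \<^term>\<open>G Mod K\<close>.\<close>

definition Pi_property :: "('a, 'b) monoid_scheme \<Rightarrow> 'a set \<Rightarrow> bool"
  where "Pi_property G H \<longleftrightarrow>
    (\<forall>L K. chief_factor G L K \<longrightarrow>
      (let A = carrier (subquotient G (H <#>\<^bsub>G\<^esub> K) K) \<inter> carrier (subquotient G L K)
       in pi_number (prime_factors (card A))
            (subgroup_index (G Mod K) (normalizer (G Mod K) A))))"

text \<open>The convention \<open>[h, k] = h k h\<inverse> k\<inverse>\<close> is that of \<^const>\<open>derived\<close>. For subgroups \<open>H\<close> and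
  \<open>K\<close>, the convention \<open>h\<inverse> k\<inverse> h k\<close> gives the same set of commutators.\<close>

definition commutator_subgroup :: "('a, 'b) monoid_scheme \<Rightarrow> 'a set \<Rightarrow> 'a set \<Rightarrow> 'a set"
  where "commutator_subgroup G H K =
    generate G (\<Union>h\<in>H. \<Union>k\<in>K. {h \<otimes>\<^bsub>G\<^esub> k \<otimes>\<^bsub>G\<^esub> inv\<^bsub>G\<^esub> h \<otimes>\<^bsub>G\<^esub> inv\<^bsub>G\<^esub> k})"

definition IC_Pi_property :: "('a, 'b) monoid_scheme \<Rightarrow> 'a set \<Rightarrow> bool"
  where "IC_Pi_property G H \<longleftrightarrow>
    Pi_property G (H \<inter> commutator_subgroup G H (carrier G))"

definition pU_hypercentral :: "nat \<Rightarrow> ('a, 'b) monoid_scheme \<Rightarrow> 'a set \<Rightarrow> bool"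
  where "pU_hypercentral p G A \<longleftrightarrow>
    A \<lhd> G \<and>
    (\<forall>L K. chief_factor G L K \<and> L \<subseteq> A \<and> p dvd order (subquotient G L K)
      \<longrightarrow> cyclic_group (subquotient G L K))"

text \<open>The product of a family of normal subgroups is the subgroup generated by their union.\<close>

definition pU_hypercenter :: "nat \<Rightarrow> ('a, 'b) monoid_scheme \<Rightarrow> 'a set"
  where "pU_hypercenter p G = generate G (\<Union>{A. pU_hypercentral p G A})"

end

theory Submission
  imports Defs "HOL-Algebra.Sylow" "HOL-Algebra.Multiplicative_Group"
    "HOL-Number_Theory.Residue_Primitive_Roots"
begin

text \<open>By induction on \<open>|N|\<close> it suffices to show \<open>|N/K| = p\<close> for a chief factor \<open>N/K\<close> of order divisible
  by \<open>p\<close>, where \<open>K\<close> contains every proper \<open>G\<close>-normal subgroup of \<open>N\<close> and all \<open>p\<close>-chief factors below \<open>K\<close>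
  have order \<open>p\<close>. Let \<open>R\<close> be the common centralizer of these factors; \<open>G/R\<close> is abelian of exponent
  dividing \<open>p - 1\<close>, hence \<open>N \<le> R\<close>, and a \<open>p'\<close>-element of \<open>R\<close> normalizing a \<open>p\<close>-subgroup \<open>W\<close> of \<open>K\<close> centralizes \<open>W\<close>.
  Put \<open>q = 4\<close> if \<open>p = 2\<close> and \<open>P\<close> is non-abelian, and \<open>q = p\<close> otherwise.

  If \<open>x \<in> P - K\<close> and \<open>x\<^sup>q = 1\<close>, then the normal closure of \<open>\<langle>x\<rangle>\<close> is \<open>N\<close>, and the hypothesis forces the
  normalizer of \<open>\<langle>x\<rangle>K\<close> to have \<open>p\<close>-power index in \<open>G\<close>; hence \<open>N/K\<close> is a \<open>p\<close>-group, and \<open>|N/K| = p\<close> if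
  moreover \<open>xK\<close> is centralized by a Sylow \<open>p\<close>-subgroup of \<open>G\<close>. If there is no such \<open>x\<close>, then every
  \<open>p'\<close>-element of \<open>N\<close> normalizing a \<open>p\<close>-subgroup of \<open>N\<close> centralizes it, so \<open>P\<close> controls its own fusion and
  the transfer \<open>N \<rightarrow> P/\<Phi>(P)\<close> shows again that \<open>N/K\<close> is a \<open>p\<close>-group.

  So let \<open>N/K\<close> be a \<open>p\<close>-group. If the \<open>p'\<close>-elements of \<open>N\<^sub>G(P) \<inter> R\<close> act trivially on \<open>N/K\<close>, so does \<open>R\<close>, and
  \<open>G/R\<close> acts on the irreducible module \<open>N/K\<close> by scalars. Otherwise \<open>Q = C\<^sub>P(P \<inter> K)\<close> has class at most two and
  covers \<open>N/K\<close>, \<open>x \<mapsto> x\<^sup>q\<close> is a homomorphism on \<open>Q\<close>, and its kernel also covers \<open>N/K\<close>: so a coset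
  fixed by a Sylow \<open>p\<close>-subgroup of \<open>G\<close> has a representative \<open>x\<close> with \<open>x\<^sup>q = 1\<close>.\<close>

text \<open>The induction descends through normal subgroups of \<open>G\<close> inside
  \<open>N\<close> and never replaces \<open>G\<close> by a quotient: the hypothesis concerns
  elements with \<open>x [^] q = \<one>\<close>, and an element of small order in a quotient need
  not lift to one in \<open>G\<close>. So the work lies in finding such an element outside
  \<open>K\<close>, or in exploiting its absence. In its absence all elements of exponent
  \<open>q\<close> in \<open>P\<close> lie in \<open>K\<close>, where the \<open>p'\<close>-elements
  of \<open>N\<close>, being in \<open>R\<close>, act trivially on the \<open>p\<close>-subgroups
  that they normalize; triviality then spreads from the elements of exponent \<open>q\<close> to
  whole \<open>p\<close>-subgroups of \<open>N\<close>.\<close>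

locale fin_group = group G for G (structure) +
  assumes fin: "finite (carrier G)"

section \<open>Conjugation and powers in subgroups\<close>

context group
begin

definition conjug :: "'a \<Rightarrow> 'a \<Rightarrow> 'a" where
  "conjug g x = g \<otimes> x \<otimes> inv g"

lemma conjug_closed [simp, intro]:
  "g \<in> carrier G \<Longrightarrow> x \<in> carrier G \<Longrightarrow> conjug g x \<in> carrier G"
  by (simp add: conjug_def)

lemma conjug_mult:
  "g \<in> carrier G \<Longrightarrow> x \<in> carrier G \<Longrightarrow> y \<in> carrier G \<Longrightarrow>
   conjug g (x \<otimes> y) = conjug g x \<otimes> conjug g y"
  by (simp add: conjug_def m_assoc inv_solve_left)

lemma conjug_conjug:
  "g \<in> carrier G \<Longrightarrow> h \<in> carrier G \<Longrightarrow> x \<in> carrier G \<Longrightarrow>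
   conjug g (conjug h x) = conjug (g \<otimes> h) x"
  by (simp add: conjug_def m_assoc inv_mult_group)

lemma conjug_one [simp]: "x \<in> carrier G \<Longrightarrow> conjug \<one> x = x"
  by (simp add: conjug_def)

lemma conjug_of_one [simp]: "g \<in> carrier G \<Longrightarrow> conjug g \<one> = \<one>"
  by (simp add: conjug_def)

lemma conjug_inv_cancel [simp]:
  "g \<in> carrier G \<Longrightarrow> x \<in> carrier G \<Longrightarrow> conjug (inv g) (conjug g x) = x"
  "g \<in> carrier G \<Longrightarrow> x \<in> carrier G \<Longrightarrow> conjug g (conjug (inv g) x) = x"
  by (simp_all add: conjug_conjug)

lemma conjug_inv:
  "g \<in> carrier G \<Longrightarrow> x \<in> carrier G \<Longrightarrow> conjug g (inv x) = inv (conjug g x)"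
  by (simp add: conjug_def m_assoc inv_mult_group)

lemma conjug_pow:
  "g \<in> carrier G \<Longrightarrow> x \<in> carrier G \<Longrightarrow> conjug g (x [^] (n::nat)) = conjug g x [^] n"
  by (induction n) (simp_all add: conjug_mult)

lemma conjug_inject [simp]:
  "g \<in> carrier G \<Longrightarrow> x \<in> carrier G \<Longrightarrow> y \<in> carrier G \<Longrightarrow>
   conjug g x = conjug g y \<longleftrightarrow> x = y"
  by (metis conjug_inv_cancel(1))

lemma inj_on_conjug: "g \<in> carrier G \<Longrightarrow> U \<subseteq> carrier G \<Longrightarrow> inj_on (conjug g) U"
  by (auto simp: inj_on_def subset_iff)

lemma conjug_eq_iff_commute:
  "g \<in> carrier G \<Longrightarrow> x \<in> carrier G \<Longrightarrow> conjug g x = x \<longleftrightarrow> g \<otimes> x = x \<otimes> g"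
  by (simp add: conjug_def inv_solve_right')

lemma conjug_subgroup_mem:
  "subgroup H G \<Longrightarrow> g \<in> H \<Longrightarrow> x \<in> H \<Longrightarrow> conjug g x \<in> H"
  by (simp add: conjug_def subgroup.m_closed subgroup.m_inv_closed)

lemma normal_conjug: "H \<lhd> G \<Longrightarrow> g \<in> carrier G \<Longrightarrow> x \<in> H \<Longrightarrow> conjug g x \<in> H"
  by (simp add: conjug_def normal.inv_op_closed2)

lemma normalI_conjug:
  "subgroup H G \<Longrightarrow> (\<And>g x. g \<in> carrier G \<Longrightarrow> x \<in> H \<Longrightarrow> conjug g x \<in> H) \<Longrightarrow> H \<lhd> G"
  by (rule normal_invI) (auto simp: conjug_def)

lemma subgroup_conjug_image:
  assumes "subgroup H G" "g \<in> carrier G"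
  shows "subgroup (conjug g ` H) G"
proof -
  have H: "x \<in> H \<Longrightarrow> x \<in> carrier G" for x
    using assms(1) subgroup.mem_carrier by fast
  show ?thesis
  proof (rule subgroupI)
    show "conjug g ` H \<subseteq> carrier G" using H assms(2) by auto
    show "conjug g ` H \<noteq> {}" using subgroup.one_closed[OF assms(1)] by auto
    show "inv a \<in> conjug g ` H" if "a \<in> conjug g ` H" for a
      using that H assms subgroup.m_inv_closed[OF assms(1)] by (auto simp flip: conjug_inv)
    show "a \<otimes> b \<in> conjug g ` H" if "a \<in> conjug g ` H" "b \<in> conjug g ` H" for a b
      using that H assms subgroup.m_closed[OF assms(1)] by (auto simp flip: conjug_mult)
  qed
qed

lemma subgroup_pow: "subgroup H G \<Longrightarrow> x \<in> H \<Longrightarrow> x [^] (n::nat) \<in> H"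
  by (induction n) (auto intro: subgroup.one_closed subgroup.m_closed)

lemma pow_card_subgroup:
  assumes "subgroup H G" "finite H" "x \<in> H"
  shows "x [^] card H = \<one>"
proof -
  interpret H: group "G\<lparr>carrier := H\<rparr>" by (rule subgroup.subgroup_is_group[OF assms(1) is_group])
  have "x [^]\<^bsub>G\<lparr>carrier := H\<rparr>\<^esub> order (G\<lparr>carrier := H\<rparr>) = \<one>"
    using H.pow_order_eq_1[of x] assms by simp
  then show ?thesis by (simp add: order_def nat_pow_consistent[symmetric])
qed

text \<open>Bezout writes \<open>g\<close> as a product of integral powers of \<open>g [^] m\<close>
  and \<open>g [^] n\<close>. With a trivial \<open>C\<close> this says that coprime annihilating
  exponents force \<open>g = \<one>\<close>.\<close>

lemma mem_of_coprime_pow_mem: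
  assumes "subgroup C G" "g \<in> carrier G" "g [^] (m::nat) \<in> C" "g [^] (n::nat) \<in> C" "coprime m n"
  shows "g \<in> C"
proof -
  obtain a b where ab: "int m * a + int n * b = 1"
    using assms(5) by (metis bezout_int coprime_iff_gcd_eq_1 coprime_int_iff mult.commute)
  have "g = g [^] (int m * a + int n * b)"
    using ab assms(2) by simp
  also have "\<dots> = (g [^] m) [^] a \<otimes> (g [^] n) [^] b"
    using assms(2) by (simp add: int_pow_mult int_pow_pow[symmetric] int_pow_int)
  also have "\<dots> \<in> C"
    using assms by (simp add: subgroup.m_closed subgroup_int_pow_closed)
  finally show ?thesis .
qed

end

lemma prime_power_dvd_obtain:
  assumes "prime (p::nat)" "n dvd p ^ k"
  obtains j where "n = p ^ j" "j \<le> k"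
  using divides_primepow_nat[OF assms(1)] assms(2) by blast

section \<open>Lagrange's theorem inside \<open>G\<close> and fixed points of
  \<open>p\<close>-groups\<close>

context fin_group
begin

lemma fin_sub [simp]: "subgroup H G \<Longrightarrow> finite H"
  using fin subgroup.subset finite_subset by blast

lemma card_sub_pos [simp]: "subgroup H G \<Longrightarrow> 0 < card H"
  using subgroup.one_closed by (metis card_gt_0_iff empty_iff fin_sub)

lemma lagrange_sub:
  assumes "subgroup H G" "subgroup N G" "H \<subseteq> N"
  shows "card ((\<lambda>g. H #> g) ` N) * card H = card N"
proof -
  interpret N: group "G\<lparr>carrier := N\<rparr>" by (rule subgroup.subgroup_is_group[OF assms(2) is_group])
  have "subgroup H (G\<lparr>carrier := N\<rparr>)"
    using assms subgroup_incl by blast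
  moreover have "rcosets\<^bsub>G\<lparr>carrier := N\<rparr>\<^esub> H = (\<lambda>g. H #> g) ` N"
    by (auto simp: RCOSETS_def)
  ultimately show ?thesis
    using N.lagrange[of H] by (simp add: order_def)
qed

lemma card_dvd_sub:
  "subgroup H G \<Longrightarrow> subgroup N G \<Longrightarrow> H \<subseteq> N \<Longrightarrow> card H dvd card N"
  using lagrange_sub by (metis dvd_triv_right)

text \<open>An orbit that is not a fixed point has size a positive power of \<open>p\<close>. The
  action is a plain function \<open>f\<close> whose laws are required on \<open>S\<close> and
  \<open>X\<close> only, so that conjugation and coset translation can be inserted as they
  are.\<close>

lemma card_fixed_points:
  assumes S: "subgroup S G" and p: "prime p" "card S = p ^ k" and X: "finite X"
    and cl: "\<And>s x. s \<in> S \<Longrightarrow> x \<in> X \<Longrightarrow> f s x \<in> X"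
    and one: "\<And>x. x \<in> X \<Longrightarrow> f \<one> x = x"
    and mult: "\<And>s t x. s \<in> S \<Longrightarrow> t \<in> S \<Longrightarrow> x \<in> X \<Longrightarrow> f (s \<otimes> t) x = f s (f t x)"
  shows "card X mod p = card {x \<in> X. \<forall>s\<in>S. f s x = x} mod p"
proof -
  let ?S = "G\<lparr>carrier := S\<rparr>"
  \<comment> \<open>\<open>Bij X\<close> consists of extensional maps, hence the
    restriction.\<close>
  define \<phi> where "\<phi> s = restrict (f s) X" for s
  interpret S: group ?S by (rule subgroup.subgroup_is_group[OF S is_group])
  have inv_cancel: "f s (f (inv s) x) = x" "f (inv s) (f s x) = x" if "s \<in> S" "x \<in> X" for s x
    using that mult[of s "inv s" x] mult[of "inv s" s x] one S
    by (simp_all add: subgroup.m_inv_closed subgroup.mem_carrier)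
  have bij: "\<phi> s \<in> Bij X" if "s \<in> S" for s
  proof -
    have "bij_betw (f s) X X"
      by (rule bij_betw_byWitness[where f' = "f (inv s)"])
        (use that inv_cancel cl S in \<open>auto simp: subgroup.m_inv_closed\<close>)
    then show ?thesis
      by (auto simp: \<phi>_def Bij_def bij_betw_restrict_eq)
  qed
  interpret A: group_action ?S X \<phi>
  proof (intro group_action.intro group_hom.intro group_hom_axioms.intro S.is_group group_BijGroup)
    show "\<phi> \<in> hom ?S (BijGroup X)"
    proof (rule homI)
      fix s t assume st: "s \<in> carrier ?S" "t \<in> carrier ?S"
      have "\<phi> (s \<otimes> t) = compose X (\<phi> s) (\<phi> t)"
        using st cl mult by (auto simp: \<phi>_def compose_def fun_eq_iff restrict_def)
      then show "\<phi> (s \<otimes>\<^bsub>?S\<^esub> t) = \<phi> s \<otimes>\<^bsub>BijGroup X\<^esub> \<phi> t"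
        using st bij by (simp add: BijGroup_def)
    qed (auto simp: BijGroup_def bij)
  qed
  let ?F = "{x \<in> X. \<forall>s\<in>S. f s x = x}"
  have orb: "orbit ?S \<phi> x = (\<lambda>s. f s x) ` S" if "x \<in> X" for x
    using that by (auto simp: orbit_def \<phi>_def)
  have orbF: "orbit ?S \<phi> x = {x}" if "x \<in> ?F" for x
    using that orb[of x] subgroup.one_closed[OF S] by auto
  have card_orb: "p dvd card Y" if Y: "Y \<in> orbits ?S X \<phi>" "Y \<notin> (\<lambda>x. {x}) ` ?F" for Y
  proof -
    obtain x where x: "x \<in> X" "Y = orbit ?S \<phi> x" using Y by (auto simp: orbits_def)
    have "card Y * card (stabilizer ?S \<phi> x) = p ^ k"
      using A.orbit_stabilizer_theorem[OF x(1)] x p by (simp add: order_def)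
    then obtain j where j: "card Y = p ^ j"
      by (metis dvd_triv_left p(1) prime_power_dvd_obtain)
    have "j \<noteq> 0"
    proof
      assume "j = 0"
      then obtain z where z: "Y = {z}" using j card_1_singletonE by auto
      have "x \<in> Y" using x A.orbit_refl by simp
      then have "Y = {x}" using z by simp
      then have "x \<in> ?F" using orb[OF x(1)] x by auto
      then show False using Y \<open>Y = {x}\<close> by blast
    qed
    then show ?thesis using j by (simp add: dvd_power)
  qed
  let ?O = "orbits ?S X \<phi>"
  have "?O \<subseteq> Pow X" using A.orbits_coverture by blast
  then have finO: "finite ?O" using X finite_subset by blast
  have sub: "(\<lambda>x. {x}) ` ?F \<subseteq> ?O"
  proof
    fix Y assume "Y \<in> (\<lambda>x. {x}) ` ?F"
    then obtain x where x: "x \<in> ?F" "Y = {x}" by auto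
    then have "Y = orbit ?S \<phi> x" using orbF by simp
    then show "Y \<in> ?O" unfolding orbits_def using x(1) by blast
  qed
  have "card X = (\<Sum>Y\<in>?O. \<Sum>x\<in>Y. 1)"
    unfolding card_eq_sum by (rule A.disjoint_sum[OF X, symmetric])
  also have "\<dots> = (\<Sum>Y\<in>?O. card Y)" by simp
  also have "\<dots> = (\<Sum>Y\<in>?O - (\<lambda>x. {x}) ` ?F. card Y) + (\<Sum>Y\<in>(\<lambda>x. {x}) ` ?F. card Y)"
    using sum.subset_diff[OF sub finO] by simp
  also have "(\<Sum>Y\<in>(\<lambda>x. {x}) ` ?F. card Y) = card ?F"
    by (subst sum.reindex) (auto simp: inj_on_def)
  finally have "card X = (\<Sum>Y\<in>?O - (\<lambda>x. {x}) ` ?F. card Y) + card ?F" .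
  moreover have "p dvd (\<Sum>Y\<in>?O - (\<lambda>x. {x}) ` ?F. card Y)"
    by (rule dvd_sum) (use card_orb in auto)
  ultimately show ?thesis by (auto elim!: dvdE)
qed

lemma coset_eq_iff:
  assumes "subgroup H G" "x \<in> carrier G" "y \<in> carrier G"
  shows "H #> x = H #> y \<longleftrightarrow> x \<otimes> inv y \<in> H"
  by (metis assms is_group rcos_self repr_independence subgroup.rcos_module)

lemma fixed_coset:
  assumes "subgroup H G" "g \<in> carrier G" "u \<in> carrier G"
  shows "H #> g #> inv u = H #> g \<longleftrightarrow> conjug g u \<in> H"
proof -
  have "H #> g #> inv u = H #> (g \<otimes> inv u)"
    using assms by (simp add: coset_mult_assoc subgroup.subset)
  also have "\<dots> = H #> g \<longleftrightarrow> conjug g (inv u) \<in> H"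
    using assms coset_eq_iff by (simp add: conjug_def)
  finally show ?thesis
    using assms by (metis conjug_closed conjug_inv inv_inv subgroup.m_inv_closed)
qed

text \<open>Translation by \<open>inv u\<close> on the right makes the right cosets a left
  \<open>U\<close>-set. By \<open>fixed_coset\<close>, a coset \<open>H #> g\<close> is fixed
  exactly if \<open>g\<close> conjugates \<open>U\<close> into \<open>H\<close>; so this one
  congruence yields both Sylow conjugacy and the growth of normalizers.\<close>

lemma card_fixed_cosets:
  assumes H: "subgroup H G" and N: "subgroup N G" "H \<subseteq> N"
    and U: "subgroup U G" "U \<subseteq> N" and p: "prime p" "card U = p ^ k"
  shows "card ((\<lambda>g. H #> g) ` N) mod p =
         card {C \<in> (\<lambda>g. H #> g) ` N. \<forall>u\<in>U. C #> inv u = C} mod p"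
proof (rule card_fixed_points[OF U(1) p])
  have NG: "x \<in> N \<Longrightarrow> x \<in> carrier G" for x using N(1) subgroup.mem_carrier by fast
  have HG: "H \<subseteq> carrier G" using H subgroup.subset by blast
  show "finite ((\<lambda>g. H #> g) ` N)" using N by simp
  fix s C assume s: "s \<in> U" and C: "C \<in> (\<lambda>g. H #> g) ` N"
  obtain g where g: "g \<in> N" "C = H #> g" using C by auto
  have sN: "s \<in> N" using s U by auto
  show "C #> inv s \<in> (\<lambda>g. H #> g) ` N"
    using g sN N NG HG by (auto simp: coset_mult_assoc subgroup.m_closed subgroup.m_inv_closed)
  fix t assume t: "t \<in> U"
  have tN: "t \<in> N" using t U by auto
  show "C #> inv (s \<otimes> t) = C #> inv t #> inv s"
    using g sN tN NG HG by (simp add: coset_mult_assoc inv_mult_group m_assoc)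
next
  fix C assume "C \<in> (\<lambda>g. H #> g) ` N"
  then show "C #> inv \<one> = C"
    using H N by (auto simp: coset_mult_assoc subgroup.subset dest: subgroup.mem_carrier)
qed

end

section \<open>Powers of products whose commutator is central\<close>

context group
begin

lemma commute_pow:
  fixes n :: nat
  assumes "a \<in> carrier G" "b \<in> carrier G" "a \<otimes> b = b \<otimes> a"
  shows "a \<otimes> b [^] n = b [^] n \<otimes> a"
proof (induction n)
  case (Suc n)
  have "a \<otimes> b [^] Suc n = (a \<otimes> b [^] n) \<otimes> b" using assms by (simp add: m_assoc)
  also have "\<dots> = b [^] n \<otimes> (a \<otimes> b)" using assms by (simp add: Suc m_assoc)
  also have "\<dots> = b [^] Suc n \<otimes> a" using assms by (simp add: m_assoc)
  finally show ?case .
qed (use assms in simp)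

text \<open>Each exchange of an \<open>a\<close> with a \<open>b\<close> costs one factor
  \<open>c\<close>, which commutes with both. Sorting \<open>(a \<otimes> b) [^] n\<close> takes
  \<open>n * (n - 1) div 2\<close> exchanges, moving one letter past an \<open>n\<close>-th power
  takes \<open>n\<close>.\<close>

lemma class2_pow_mult:
  fixes n :: nat
  assumes ab: "a \<in> carrier G" "b \<in> carrier G" and c: "c = a \<otimes> b \<otimes> inv a \<otimes> inv b"
    and ca: "c \<otimes> a = a \<otimes> c" and cb: "c \<otimes> b = b \<otimes> c"
  shows "a [^] n \<otimes> b [^] n = c [^] (n * (n - 1) div 2) \<otimes> (a \<otimes> b) [^] n"
    and "a \<otimes> b [^] n = c [^] n \<otimes> b [^] n \<otimes> a"
    and "a [^] n \<otimes> b = c [^] n \<otimes> b \<otimes> a [^] n"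
proof -
  have cG: "c \<in> carrier G" using ab c by simp
  have abc: "a \<otimes> b = c \<otimes> b \<otimes> a"
    using ab by (simp add: c m_assoc)
  show 1: "a \<otimes> b [^] n = c [^] n \<otimes> b [^] n \<otimes> a" for n :: nat
  proof (induction n)
    case (Suc n)
    have "a \<otimes> b [^] Suc n = (a \<otimes> b [^] n) \<otimes> b" using ab by (simp add: m_assoc)
    also have "\<dots> = c [^] n \<otimes> b [^] n \<otimes> (a \<otimes> b)" using ab cG by (simp add: Suc m_assoc)
    also have "\<dots> = c [^] n \<otimes> (b [^] n \<otimes> c) \<otimes> b \<otimes> a" using ab cG by (simp add: abc m_assoc)
    also have "b [^] n \<otimes> c = c \<otimes> b [^] n" using commute_pow[OF cG ab(2) cb] by simp
    also have "c [^] n \<otimes> (c \<otimes> b [^] n) \<otimes> b \<otimes> a = c [^] Suc n \<otimes> b [^] Suc n \<otimes> a"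
      using ab cG by (simp add: m_assoc)
    finally show ?case .
  qed (use ab in simp)
  show "a [^] n \<otimes> b = c [^] n \<otimes> b \<otimes> a [^] n"
  proof (induction n)
    case (Suc n)
    have "a [^] Suc n \<otimes> b = a [^] n \<otimes> (a \<otimes> b)" using ab by (simp add: m_assoc)
    also have "\<dots> = (a [^] n \<otimes> c) \<otimes> b \<otimes> a" using ab cG by (simp add: abc m_assoc)
    also have "a [^] n \<otimes> c = c \<otimes> a [^] n" using commute_pow[OF cG ab(1) ca] by simp
    also have "c \<otimes> a [^] n \<otimes> b \<otimes> a = c \<otimes> (a [^] n \<otimes> b) \<otimes> a" using ab cG by (simp add: m_assoc)
    also have "\<dots> = (c \<otimes> c [^] n) \<otimes> b \<otimes> (a [^] n \<otimes> a)" using ab cG by (simp add: Suc m_assoc)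
    also have "\<dots> = c [^] Suc n \<otimes> b \<otimes> a [^] Suc n"
      using cG ab commute_pow[OF cG cG] by simp
    finally show ?case .
  qed (use ab in simp)
  show "a [^] n \<otimes> b [^] n = c [^] (n * (n - 1) div 2) \<otimes> (a \<otimes> b) [^] n"
  proof (induction n)
    case (Suc n)
    have e: "n + n * (n - 1) div 2 = Suc n * (Suc n - 1) div 2"
      by (cases n) (auto simp: algebra_simps)
    have can: "a [^] n \<otimes> c [^] n = c [^] n \<otimes> a [^] n"
      using commute_pow[of "a [^] n" c n] commute_pow[OF cG ab(1) ca, of n] ab cG by simp
    have "a [^] Suc n \<otimes> b [^] Suc n = a [^] n \<otimes> (a \<otimes> b [^] n) \<otimes> b" using ab by (simp add: m_assoc)
    also have "\<dots> = (a [^] n \<otimes> c [^] n) \<otimes> b [^] n \<otimes> a \<otimes> b" using ab cG by (simp add: 1 m_assoc)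
    also have "\<dots> = c [^] n \<otimes> (a [^] n \<otimes> b [^] n) \<otimes> (a \<otimes> b)" using ab cG by (simp add: can m_assoc)
    also have "\<dots> = (c [^] n \<otimes> c [^] (n * (n - 1) div 2)) \<otimes> ((a \<otimes> b) [^] n \<otimes> (a \<otimes> b))"
      using ab cG by (simp add: Suc m_assoc)
    also have "\<dots> = c [^] (Suc n * (Suc n - 1) div 2) \<otimes> (a \<otimes> b) [^] Suc n"
      unfolding e[symmetric] using cG by (simp add: nat_pow_mult)
    finally show ?case .
  qed (use ab in simp)
qed

text \<open>Since \<open>a [^] p\<close> commutes with \<open>b\<close>, bilinearity of the
  commutator gives \<open>c [^] p = \<one>\<close>, and the correcting factor of
  \<open>class2_pow_mult\<close> vanishes.\<close>

lemma class2_pow_hom: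
  fixes p q :: nat
  assumes ab: "a \<in> carrier G" "b \<in> carrier G" and c: "c = a \<otimes> b \<otimes> inv a \<otimes> inv b"
    and ca: "c \<otimes> a = a \<otimes> c" and cb: "c \<otimes> b = b \<otimes> c"
    and ap: "a [^] p \<otimes> b = b \<otimes> a [^] p" and q: "p dvd q * (q - 1) div 2"
  shows "(a \<otimes> b) [^] q = a [^] q \<otimes> b [^] q"
proof -
  note C = class2_pow_mult[OF ab c ca cb]
  have cG: "c \<in> carrier G" using ab c by simp
  have "c [^] p \<otimes> (b \<otimes> a [^] p) = \<one> \<otimes> (b \<otimes> a [^] p)"
    using C(3)[of p] ap ab cG by (simp add: m_assoc)
  then have "c [^] p = \<one>" using ab cG by (metis m_closed nat_pow_closed one_closed right_cancel)
  then have "c [^] (q * (q - 1) div 2) = \<one>"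
    using q cG by (auto simp: nat_pow_pow[symmetric] elim!: dvdE)
  then show ?thesis using C(1)[of q] ab by simp
qed

end

context fin_group
begin

subsection \<open>Sylow subgroups\<close>

text \<open>Kept inside the ambient group, so that Sylow subgroups of various subgroups of
  \<open>G\<close> can be compared and conjugated without changing the group. An index prime to
  \<open>p\<close> replaces the exact power of \<open>p\<close> in
  \<open>sylow_subgroup\<close>.\<close>

definition sylow_in :: "nat \<Rightarrow> 'a set \<Rightarrow> 'a set \<Rightarrow> bool" where
  "sylow_in p N P \<longleftrightarrow>
    subgroup P G \<and> P \<subseteq> N \<and> (\<exists>k. card P = p ^ k) \<and> \<not> p dvd card N div card P"

text \<open>The \<open>p'\<close>-elements, given by an annihilating exponent instead of the order,
  in the form that \<open>mem_of_coprime_pow_mem\<close> consumes.\<close>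

definition p_reg :: "nat \<Rightarrow> 'a \<Rightarrow> bool" where
  "p_reg p y \<longleftrightarrow> (\<exists>m. coprime m p \<and> y [^] (m::nat) = \<one>)"

lemma card_coset_image:
  assumes "subgroup H G" "subgroup N G" "H \<subseteq> N"
  shows "card ((\<lambda>g. H #> g) ` N) = card N div card H"
  using lagrange_sub[OF assms] card_sub_pos[OF assms(1)]
  by (metis div_mult_self_is_m)

text \<open>The number of cosets of \<open>P\<close> in \<open>N\<close> is prime to
  \<open>p\<close>, so the \<open>p\<close>-group \<open>U\<close> fixes one of them, and its
  representative conjugates \<open>U\<close> into \<open>P\<close>.\<close>

lemma p_sub_conj_sylow:
  assumes N: "subgroup N G" and P: "sylow_in p N P" and p: "prime p"
    and U: "subgroup U G" "U \<subseteq> N" "card U = p ^ k"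
  obtains g where "g \<in> N" "\<forall>u\<in>U. conjug g u \<in> P"
proof -
  have P': "subgroup P G" "P \<subseteq> N" "\<not> p dvd card N div card P" using P by (auto simp: sylow_in_def)
  let ?X = "{C \<in> (\<lambda>g. P #> g) ` N. \<forall>u\<in>U. C #> inv u = C}"
  have "card ((\<lambda>g. P #> g) ` N) mod p \<noteq> 0"
    using P' card_coset_image[OF P'(1) N P'(2)] by (simp add: dvd_eq_mod_eq_0)
  then have "card ?X \<noteq> 0"
    using card_fixed_cosets[OF P'(1) N P'(2) U(1,2) p U(3)] by (metis mod_0)
  then have "?X \<noteq> {}" by (metis card.empty)
  then obtain g where g: "g \<in> N" "\<forall>u\<in>U. P #> g #> inv u = P #> g"
    by auto
  have NG: "x \<in> carrier G" if "x \<in> N" for x using N subgroup.mem_carrier that by fast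
  show ?thesis
    using that[OF g(1)] g U fixed_coset[OF P'(1) NG[OF g(1)]] NG by blast
qed

text \<open>\<open>U\<close> acts on its own cosets in \<open>P\<close>. Their number is divisible
  by \<open>p\<close> and \<open>U\<close> itself is fixed, so a second coset \<open>U #> g\<close>
  is fixed; then \<open>g\<close> normalizes \<open>U\<close>.\<close>

lemma normalizer_grows:
  assumes P: "subgroup P G" "card P = p ^ k" "prime p" and U: "subgroup U G" "U \<subset> P"
  obtains g where "g \<in> P" "g \<notin> U" "\<forall>u\<in>U. conjug g u \<in> U"
proof -
  have UP: "U \<subseteq> P" using U by auto
  obtain j where j: "card U = p ^ j" 
    using card_dvd_sub[OF U(1) P(1) UP] P prime_power_dvd_obtain by metis
  let ?Y = "(\<lambda>g. U #> g) ` P"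
  let ?X = "{C \<in> ?Y. \<forall>u\<in>U. C #> inv u = C}"
  have PG: "x \<in> carrier G" if "x \<in> P" for x using P(1) subgroup.mem_carrier that by fast
  have "card ?Y * card U = p ^ k" using lagrange_sub[OF U(1) P(1) UP] P by simp
  then obtain i where i: "card ?Y = p ^ i" using prime_power_dvd_obtain[OF P(3)] by (metis dvd_triv_left)
  have "card U < card P" using U psubset_card_mono[OF fin_sub[OF P(1)]] by blast
  then have "i \<noteq> 0" using lagrange_sub[OF U(1) P(1) UP] i by (cases "i = 0") auto
  then have "card ?Y mod p = 0" using i by simp
  then have "card ?X mod p = 0"
    using card_fixed_cosets[OF U(1) P(1) UP U(1) UP P(3) j] by simp
  moreover have UX: "U \<in> ?X"
  proof -
    have "U = U #> \<one>" using U by (simp add: subgroup.subset)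
    then have "U \<in> ?Y" using subgroup.one_closed[OF P(1)] by (rule image_eqI)
    moreover have "U #> inv u = U" if "u \<in> U" for u
      using that U(1) by (simp add: coset_join2 subgroup.m_inv_closed subgroup.mem_carrier[OF U(1)])
    ultimately show ?thesis by auto
  qed
  ultimately have "?X \<noteq> {U}"
    using prime_gt_1_nat[OF P(3)] by auto
  then obtain C where C: "C \<in> ?X" "C \<noteq> U" using UX by blast
  then obtain g where g: "g \<in> P" "C = U #> g" "\<forall>u\<in>U. U #> g #> inv u = U #> g" by auto
  have "g \<notin> U" using C g U(1) by (auto simp: coset_join2 PG)
  then show ?thesis
    using that[OF g(1)] g(3) UP fixed_coset[OF U(1) PG[OF g(1)]] PG by blast
qed

lemma p_group_fixes:
  assumes S: "subgroup S G" "card S = p ^ k" "prime p"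
    and V: "subgroup V G" "card V = p ^ j" "V \<noteq> {\<one>}"
    and n: "\<And>s v. s \<in> S \<Longrightarrow> v \<in> V \<Longrightarrow> conjug s v \<in> V"
  obtains v where "v \<in> V" "v \<noteq> \<one>" "\<forall>s\<in>S. conjug s v = v"
proof -
  let ?F = "{v \<in> V. \<forall>s\<in>S. conjug s v = v}"
  have SG: "x \<in> carrier G" if "x \<in> S" for x using S(1) subgroup.mem_carrier that by fast
  have VG: "x \<in> carrier G" if "x \<in> V" for x using V(1) subgroup.mem_carrier that by fast
  have "card V mod p = card ?F mod p"
    by (rule card_fixed_points[OF S(1,3,2)]) (use V n SG VG in \<open>auto simp: conjug_conjug\<close>)
  moreover have "j \<noteq> 0"
    using V subgroup.one_closed[OF V(1)] by (metis card_1_singletonE power_0 singletonD)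
  then have "card V mod p = 0" using V by simp
  moreover have 1: "\<one> \<in> ?F" using subgroup.one_closed[OF V(1)] SG by auto
  ultimately have "?F \<noteq> {\<one>}"
    using prime_gt_1_nat[OF S(3)] by auto
  then obtain v where "v \<in> ?F" "v \<noteq> \<one>" using 1 by blast
  then show ?thesis using that by auto
qed

lemma sylow_ex:
  assumes N: "subgroup N G" and p: "prime p"
  obtains P where "sylow_in p N P"
proof -
  interpret N: group "G\<lparr>carrier := N\<rparr>" by (rule subgroup.subgroup_is_group[OF N is_group])
  define a where "a = multiplicity p (card N)"
  have cN: "card N \<noteq> 0" using card_sub_pos[OF N] by simp
  then obtain m where m: "card N = p ^ a * m" "\<not> p dvd m"
    using multiplicity_decompose'[of "card N" p] p unfolding a_def
    by (metis not_prime_unit)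
  have "\<exists>H. subgroup H (G\<lparr>carrier := N\<rparr>) \<and> card H = p ^ a"
    by (rule sylow_thm[where m = m]) (use p m N N.is_group in \<open>auto simp: order_def\<close>)
  then obtain P where P: "subgroup P (G\<lparr>carrier := N\<rparr>)" "card P = p ^ a" by auto
  have "subgroup P G" "P \<subseteq> N"
    using P(1) N incl_subgroup subgroup.subset by fastforce+
  then have "sylow_in p N P"
    using P(2) m p by (auto simp: sylow_in_def)
  then show ?thesis by (rule that)
qed

lemma sylow_conj:
  assumes P: "sylow_in p N P" and g: "g \<in> N" and N: "subgroup N G"
  shows "sylow_in p N (conjug g ` P)"
proof -
  have NG: "N \<subseteq> carrier G" using N subgroup.subset by blast
  have "inj_on (conjug g) P" using P g NG by (intro inj_on_conjug) (auto simp: sylow_in_def)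
  then have "card (conjug g ` P) = card P" by (rule card_image)
  moreover have "subgroup (conjug g ` P) G"
    using P g NG by (intro subgroup_conjug_image) (auto simp: sylow_in_def)
  moreover have "conjug g ` P \<subseteq> N" using P g conjug_subgroup_mem[OF N] by (auto simp: sylow_in_def)
  ultimately show ?thesis using P by (auto simp: sylow_in_def)
qed

lemma sylow_card:
  assumes N: "subgroup N G" and "prime p" "sylow_in p N P" "sylow_in p N Q"
  shows "card P = card Q"
proof -
  have *: "card P dvd card Q" if PQ: "sylow_in p N P" "sylow_in p N Q" for P Q
  proof -
    obtain k where k: "card P = p ^ k" "P \<subseteq> N" "subgroup P G" using PQ by (auto simp: sylow_in_def)
    obtain j where j: "card Q = p ^ j" "Q \<subseteq> N" "subgroup Q G" using PQ by (auto simp: sylow_in_def)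
    have "card P dvd card N" using card_dvd_sub k N by blast
    also have "card N = card Q * (card N div card Q)" using card_dvd_sub[OF j(3) N j(2)] by simp
    finally have "card P dvd card Q * (card N div card Q)" .
    moreover have "coprime (card P) (card N div card Q)"
      using PQ assms(2) k by (auto simp: sylow_in_def prime_imp_coprime)
    ultimately show ?thesis using coprime_dvd_mult_left_iff by blast
  qed
  show ?thesis using *[OF assms(3,4)] *[OF assms(4,3)] by (rule dvd_antisym)
qed

lemma p_sub_subset_sylow:
  assumes N: "subgroup N G" and p: "prime p" and U: "subgroup U G" "U \<subseteq> N" "card U = p ^ k"
  obtains R where "sylow_in p N R" "U \<subseteq> R"
proof -
  obtain P where P: "sylow_in p N P" using sylow_ex[OF N p] .
  obtain g where g: "g \<in> N" "\<forall>u\<in>U. conjug g u \<in> P" using p_sub_conj_sylow[OF N P p U] .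
  have gG: "g \<in> carrier G" using g N subgroup.mem_carrier by fast
  have UG: "U \<subseteq> carrier G" using U subgroup.subset by blast
  have "sylow_in p N (conjug (inv g) ` P)"
    by (rule sylow_conj[OF P _ N]) (use g N in \<open>auto simp: subgroup.m_inv_closed\<close>)
  moreover have "U \<subseteq> conjug (inv g) ` P"
  proof
    fix u assume "u \<in> U"
    then have "u = conjug (inv g) (conjug g u)" "conjug g u \<in> P" using g(2) gG UG by auto
    then show "u \<in> conjug (inv g) ` P" by (rule image_eqI)
  qed
  ultimately show ?thesis by (rule that)
qed

lemma sylow_conj_ex:
  assumes N: "subgroup N G" and p: "prime p" and PQ: "sylow_in p N P" "sylow_in p N Q"
  obtains g where "g \<in> N" "conjug g ` Q = P"
proof -
  obtain k where k: "card Q = p ^ k" "Q \<subseteq> N" "subgroup Q G" using PQ by (auto simp: sylow_in_def)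
  obtain g where g: "g \<in> N" "\<forall>u\<in>Q. conjug g u \<in> P"
    using p_sub_conj_sylow[OF N PQ(1) p k(3,2,1)] .
  have "g \<in> carrier G" using g N subgroup.mem_carrier by fast
  then have "card (conjug g ` Q) = card P"
    using sylow_card[OF N p PQ] k by (simp add: card_image inj_on_conjug subgroup.subset)
  moreover have "conjug g ` Q \<subseteq> P" using g by auto
  moreover have "finite P" using PQ by (auto simp: sylow_in_def)
  ultimately have "conjug g ` Q = P" using card_subset_eq by blast
  then show ?thesis using that g by blast
qed

text \<open>An index that is a power of \<open>p\<close> is absorbed by a Sylow subgroup:
  \<open>p ^ a * card (A \<inter> P)\<close> divides \<open>card N\<close> and hence
  \<open>card P\<close>, so \<open>P\<close> already meets all \<open>p ^ a\<close> cosets of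
  \<open>A\<close>.\<close>

lemma sylow_factor:
  assumes N: "subgroup N G" and p: "prime p" and P: "sylow_in p N P"
    and A: "subgroup A G" "A \<subseteq> N" "card N = p ^ a * card A" and g: "g \<in> N"
  obtains x y where "x \<in> A" "y \<in> P" "g = x \<otimes> y"
proof -
  have P': "subgroup P G" "P \<subseteq> N" "\<not> p dvd card N div card P" using P by (auto simp: sylow_in_def)
  obtain k where k: "card P = p ^ k" using P by (auto simp: sylow_in_def)
  have I: "subgroup (A \<inter> P) G" using A P' by (simp add: subgroups_Inter_pair)
  have NG: "N \<subseteq> carrier G" using N subgroup.subset by blast
  obtain c where c: "card (A \<inter> P) = p ^ c"
    using card_dvd_sub[OF I P'(1)] k prime_power_dvd_obtain[OF p] by (metis inf_le2)
  have "p ^ c dvd card A" using card_dvd_sub[OF I A(1)] c by simp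
  then have "p ^ a * p ^ c dvd card P * (card N div card P)"
    using A(3) card_dvd_sub[OF P'(1) N P'(2)] by (simp add: mult_dvd_mono)
  moreover have "coprime (p ^ a * p ^ c) (card N div card P)"
    using P' p by (simp add: prime_imp_coprime)
  ultimately have "p ^ a * p ^ c dvd card P" using coprime_dvd_mult_left_iff by blast
  then have le: "p ^ a * card (A \<inter> P) \<le> card P" using c card_sub_pos[OF P'(1)] dvd_imp_le by simp
  let ?X = "(\<lambda>g. A #> g) ` P" and ?Y = "(\<lambda>g. A #> g) ` N"
  have "card ?Y * card A = p ^ a * card A" using lagrange_sub[OF A(1) N A(2)] A(3) by simp
  then have cY: "card ?Y = p ^ a" using card_sub_pos[OF A(1)] by simp
  have "card ((\<lambda>g. (A \<inter> P) #> g) ` P) * card (A \<inter> P) = card P" using lagrange_sub[OF I P'(1)] by simp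
  moreover have "card ((\<lambda>g. (A \<inter> P) #> g) ` P) \<le> card ?X"
  proof (rule surj_card_le[of _ _ "\<lambda>C. C \<inter> P"])
    show "(\<lambda>g. (A \<inter> P) #> g) ` P \<subseteq> (\<lambda>C. C \<inter> P) ` ?X"
    proof -
      have "(A \<inter> P) #> g = (A #> g) \<inter> P" if "g \<in> P" for g
      proof -
        have gG: "g \<in> carrier G" using that P' NG by auto
        have "h \<in> P" if "h \<in> A" "h \<otimes> g \<in> P" for h
        proof -
          have "h \<in> carrier G" using that A NG by auto
          then have "h = (h \<otimes> g) \<otimes> inv g" using gG by (simp add: m_assoc)
          then show ?thesis using that \<open>g \<in> P\<close> P'(1) by (metis subgroup.m_closed subgroup.m_inv_closed)
        qed
        then show ?thesis using that P'(1) by (auto simp: r_coset_def subgroup.m_closed)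
      qed
      then show ?thesis by auto
    qed
  qed (use P' in simp)
  moreover have "p ^ a \<le> card ((\<lambda>g. (A \<inter> P) #> g) ` P)"
    using le card_sub_pos[OF I] lagrange_sub[OF I P'(1)] by (metis Int_lower2 mult_le_cancel2)
  ultimately have "p ^ a \<le> card ?X" by linarith
  then have "?X = ?Y"
    using P' N cY by (intro card_seteq) auto
  then obtain y where y: "y \<in> P" "A #> g = A #> y" using g by blast
  have yG: "y \<in> carrier G" "g \<in> carrier G" using y P' g NG by auto
  have "g \<otimes> inv y \<in> A" using y yG A coset_eq_iff by simp
  moreover have "g = (g \<otimes> inv y) \<otimes> y" using yG by (simp add: m_assoc)
  ultimately show ?thesis using that y by blast
qed

text \<open>For a prime \<open>r\<close> other than \<open>p\<close>, each element of a Sylow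
  \<open>r\<close>-subgroup has an \<open>r\<close>-power and a \<open>p\<close>-power exponent
  leading into \<open>C\<close>, hence lies in \<open>C\<close>; so \<open>r\<close> does not divide
  the index.\<close>

lemma index_p_power:
  assumes N: "subgroup N G" and p: "prime p" and C: "subgroup C G" "C \<subseteq> N"
    and el: "\<And>g. g \<in> N \<Longrightarrow> \<exists>a. g [^] (p ^ a) \<in> C"
  shows "\<exists>a. card N = p ^ a * card C"
proof -
  define n where "n = card N div card C"
  have n: "card N = n * card C" using card_dvd_sub[OF C(1) N C(2)] by (simp add: n_def)
  have n0: "n \<noteq> 0" using n card_sub_pos[OF N] by auto
  have "r = p" if r: "prime r" "r dvd n" for r
  proof (rule ccontr)
    assume rp: "r \<noteq> p"
    obtain R where R: "sylow_in r N R" using sylow_ex[OF N r(1)] .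
    have R': "subgroup R G" "R \<subseteq> N" "\<not> r dvd card N div card R" using R by (auto simp: sylow_in_def)
    obtain k where k: "card R = r ^ k" using R by (auto simp: sylow_in_def)
    have "R \<subseteq> C"
    proof
      fix g assume g: "g \<in> R"
      have gG: "g \<in> carrier G" using g R' subgroup.mem_carrier by fast
      obtain a where a: "g [^] (p ^ a) \<in> C" using el g R' by blast
      have "g [^] (r ^ k) = \<one>" using pow_card_subgroup[OF R'(1)] R'(1) g k by simp
      then have "g [^] (r ^ k) \<in> C" using C(1) by (simp add: subgroup.one_closed)
      moreover have "coprime (p ^ a) (r ^ k)" using p r rp by (simp add: primes_coprime)
      ultimately show "g \<in> C" using mem_of_coprime_pow_mem[OF C(1) gG a] by blast
    qed
    then have "card R dvd card C" using card_dvd_sub R' C by blast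
    then obtain e where e: "card C = card R * e" by auto
    then have "card N div card R = n * e" using n card_sub_pos[OF R'(1)] by simp
    then show False using r R' by simp
  qed
  moreover obtain m where m: "n = p ^ multiplicity p n * m" "\<not> p dvd m"
    using multiplicity_decompose'[of n p] n0 p by (metis not_prime_unit)
  ultimately have "m = 1" by (metis dvd_mult prime_factor_nat)
  then show ?thesis using n m by (metis mult.right_neutral)
qed

end

context group
begin

subsection \<open>Coprime action on \<open>p\<close>-groups\<close>

text \<open>Put \<open>c = conjug y x \<otimes> inv x\<close>. If \<open>y\<close> fixes
  \<open>c\<close>, each further conjugation by \<open>y\<close> multiplies \<open>x\<close> by
  another \<open>c\<close>, so \<open>y [^] m = \<one>\<close> gives
  \<open>c [^] m = \<one>\<close>. In commutator notation, \<open>[y,[y,x]] = 1\<close> forces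
  \<open>[y,x] = 1\<close> for coprime exponents.\<close>

lemma coprime_fix:
  fixes m l :: nat
  assumes y: "y \<in> carrier G" "y [^] m = \<one>" and x: "x \<in> carrier G"
    and c: "conjug y (conjug y x \<otimes> inv x) = conjug y x \<otimes> inv x"
    and l: "(conjug y x \<otimes> inv x) [^] l = \<one>" "coprime m l"
  shows "conjug y x = x"
proof -
  define c where "c = conjug y x \<otimes> inv x"
  have cG: "c \<in> carrier G" using x y by (simp add: c_def)
  have yc: "conjug y c = c" using c by (simp only: c_def)
  have yx: "conjug y x = c \<otimes> x" using x y by (simp add: c_def m_assoc)
  have "conjug (y [^] n) x = c [^] n \<otimes> x" for n :: nat
  proof (induction n)
    case (Suc n)
    have "y [^] Suc n = y \<otimes> y [^] n" using nat_pow_Suc2[OF y(1)] .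
    then have "conjug (y [^] Suc n) x = conjug y (c [^] n \<otimes> x)"
      using x y Suc by (simp flip: conjug_conjug)
    also have "\<dots> = c [^] n \<otimes> (c \<otimes> x)"
      using x y cG c by (simp add: conjug_mult conjug_pow yx yc)
    finally show ?case using x cG by (simp add: m_assoc)
  qed (use x in simp)
  from this[of m] have "c [^] m = \<one>" using x y cG by (simp add: r_cancel_one')
  then have "c \<in> {\<one>}"
    using mem_of_coprime_pow_mem[OF triv_subgroup cG _ _ l(2)] l(1) by (simp add: c_def)
  then show ?thesis using x yx by simp
qed

lemma generate_conjug:
  assumes "g \<in> carrier G" "S \<subseteq> carrier G" "\<And>s. s \<in> S \<Longrightarrow> conjug g s \<in> generate G S"
    and "x \<in> generate G S"
  shows "conjug g x \<in> generate G S"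
  using assms(4)
proof (induction)
  case one then show ?case using assms by (simp add: generate.one)
next
  case (incl h) then show ?case using assms by simp
next
  case (inv h)
  then show ?case using assms generate_m_inv_closed[OF assms(2)] conjug_inv
    by (metis subset_iff)
next
  case (eng h1 h2)
  then have "h1 \<in> carrier G" "h2 \<in> carrier G" using generate_in_carrier[OF assms(2)] by auto
  then show ?case using eng assms by (simp add: conjug_mult generate.eng)
qed

text \<open>For a \<open>p\<close>-group \<open>U\<close> this is the Frattini subgroup. In terms of
  generators, invariance under conjugation and lower bounds are checked on commutators and
  \<open>p\<close>-th powers.\<close>

definition frat :: "nat \<Rightarrow> 'a set \<Rightarrow> 'a set" where
  "frat p U = generate G
     ((\<Union>a\<in>U. \<Union>b\<in>U. {a \<otimes> b \<otimes> inv a \<otimes> inv b}) \<union> (\<lambda>a. a [^] p) ` U)"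

lemma frat_gens:
  fixes p :: nat
  assumes "subgroup U G"
  shows "(\<Union>a\<in>U. \<Union>b\<in>U. {a \<otimes> b \<otimes> inv a \<otimes> inv b}) \<union> (\<lambda>a. a [^] p) ` U \<subseteq> U"
  using assms by (auto simp: subgroup.m_closed subgroup.m_inv_closed subgroup_pow)

lemma frat_subgroup: "subgroup U G \<Longrightarrow> subgroup (frat p U) G"
  unfolding frat_def using frat_gens[of U p] subgroup.subset[of U G] by (intro generate_is_subgroup) blast

lemma frat_subset: "subgroup U G \<Longrightarrow> frat p U \<subseteq> U"
  unfolding frat_def using frat_gens[of U p] by (intro generate_subgroup_incl)

lemma frat_least:
  assumes "subgroup W G" "\<And>a b. a \<in> U \<Longrightarrow> b \<in> U \<Longrightarrow> a \<otimes> b \<otimes> inv a \<otimes> inv b \<in> W"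
    "\<And>a. a \<in> U \<Longrightarrow> a [^] p \<in> W"
  shows "frat p U \<subseteq> W"
  unfolding frat_def using assms by (intro generate_subgroup_incl) auto

lemma commutator_in_frat:
  "a \<in> U \<Longrightarrow> b \<in> U \<Longrightarrow> a \<otimes> b \<otimes> inv a \<otimes> inv b \<in> frat p U"
  unfolding frat_def by (rule generate.incl) auto

lemma pow_in_frat: "a \<in> U \<Longrightarrow> a [^] p \<in> frat p U"
  unfolding frat_def by (rule generate.incl) auto

lemma conjug_commutator:
  "g \<in> carrier G \<Longrightarrow> a \<in> carrier G \<Longrightarrow> b \<in> carrier G \<Longrightarrow>
   conjug g (a \<otimes> b \<otimes> inv a \<otimes> inv b) =
   conjug g a \<otimes> conjug g b \<otimes> inv (conjug g a) \<otimes> inv (conjug g b)"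
  by (simp add: conjug_mult conjug_inv)

lemma frat_conjug:
  assumes "subgroup U G" "g \<in> carrier G" "\<And>u. u \<in> U \<Longrightarrow> conjug g u \<in> U" "x \<in> frat p U"
  shows "conjug g x \<in> frat p U"
proof -
  have UG: "u \<in> carrier G" if "u \<in> U" for u using that assms(1) subgroup.mem_carrier by fast
  let ?S = "(\<Union>a\<in>U. \<Union>b\<in>U. {a \<otimes> b \<otimes> inv a \<otimes> inv b}) \<union> (\<lambda>a. a [^] p) ` U"
  have gen: "conjug g s \<in> generate G ?S" if "s \<in> ?S" for s
    using that
  proof
    assume "s \<in> (\<Union>a\<in>U. \<Union>b\<in>U. {a \<otimes> b \<otimes> inv a \<otimes> inv b})"
    then obtain a b where ab: "a \<in> U" "b \<in> U" "s = a \<otimes> b \<otimes> inv a \<otimes> inv b" by auto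
    have "conjug g s = conjug g a \<otimes> conjug g b \<otimes> inv (conjug g a) \<otimes> inv (conjug g b)"
      unfolding ab(3) using conjug_commutator assms(2) UG ab by simp
    then show ?thesis
      using commutator_in_frat[OF assms(3)[OF ab(1)] assms(3)[OF ab(2)], of p] unfolding frat_def by simp
  next
    assume "s \<in> (\<lambda>a. a [^] p) ` U"
    then obtain a where a: "a \<in> U" "s = a [^] p" by auto
    have "conjug g s = conjug g a [^] p" unfolding a(2) using conjug_pow assms(2) UG a by simp
    then show ?thesis
      using pow_in_frat[OF assms(3)[OF a(1)], of p] unfolding frat_def by simp
  qed
  have SG: "?S \<subseteq> carrier G" using frat_gens[OF assms(1), of p] UG by blast
  show ?thesis
    unfolding frat_def by (rule generate_conjug[OF assms(2) SG gen assms(4)[unfolded frat_def]])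
qed

end

context fin_group
begin

lemma p_reg_conv: "prime p \<Longrightarrow> p_reg p y \<Longrightarrow> \<exists>m. y [^] (m::nat) = \<one> \<and> (\<forall>k. coprime m (p ^ k))"
  by (auto simp: p_reg_def)

lemma p_reg_power_ex:
  assumes "prime p"
  obtains a where "\<forall>g\<in>carrier G. p_reg p (g [^] (p ^ a))"
proof -
  have "order G \<noteq> 0" using fin order_gt_0_iff_finite by auto
  then obtain m where m: "order G = p ^ multiplicity p (order G) * m" "\<not> p dvd m"
    using multiplicity_decompose'[of "order G" p] assms by (metis not_prime_unit)
  have "p_reg p (g [^] (p ^ multiplicity p (order G)))" if "g \<in> carrier G" for g
  proof -
    have "(g [^] (p ^ multiplicity p (order G))) [^] m = \<one>"
      using that m pow_order_eq_1[OF that] by (simp add: nat_pow_pow)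
    moreover have "coprime m p" using m(2) assms prime_imp_coprime[of p m] by (simp add: coprime_commute)
    ultimately show ?thesis by (auto simp: p_reg_def)
  qed
  then show ?thesis using that by blast
qed

text \<open>A maximal subgroup \<open>W\<close> of a nontrivial \<open>p\<close>-group is normal
  because normalizers grow, and \<open>U/W\<close> is generated by an element \<open>g\<close> with
  \<open>g [^] p\<close> in \<open>W\<close>. A cyclic quotient of exponent \<open>p\<close> kills
  commutators and \<open>p\<close>-th powers.\<close>

lemma frat_proper:
  assumes p: "prime p" and U: "subgroup U G" "card U = p ^ k" "U \<noteq> {\<one>}"
  shows "frat p U \<noteq> U"
proof -
  define A where "A = {W. subgroup W G \<and> W \<subset> U}"
  have UG: "u \<in> carrier G" if "u \<in> U" for u using that U(1) subgroup.mem_carrier by fast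
  have "A \<subseteq> Pow U" by (auto simp: A_def)
  then have "finite A" using finite_subset[of A "Pow U"] U by simp
  moreover have "{\<one>} \<in> A" using triv_subgroup U subgroup.one_closed by (fastforce simp: A_def)
  ultimately obtain W where W: "W \<in> A" "\<forall>X\<in>A. W \<subseteq> X \<longrightarrow> W = X"
    using finite_has_maximal[of A] by blast
  have W': "subgroup W G" "W \<subset> U" using W by (auto simp: A_def)
  have WG: "u \<in> carrier G" if "u \<in> W" for u using that W' UG by auto
  let ?N = "{g \<in> U. \<forall>w\<in>W. conjug g w \<in> W}"
  have maxi: "X = U" if "subgroup X G" "X \<subseteq> U" "W \<subseteq> X" "g \<in> X" "g \<notin> W" for X g
    using W(2) that by (auto simp: A_def)
  have N: "subgroup ?N G"
  proof (rule subgroupI)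
    show "inv g \<in> ?N" if "g \<in> ?N" for g
    proof -
      have gG: "g \<in> carrier G" using that UG by auto
      have "conjug g ` W = W"
        using that gG W' subgroup.subset[OF W'(1)]
        by (intro card_subset_eq) (auto simp: card_image inj_on_conjug)
      have "conjug (inv g) w \<in> W" if w: "w \<in> W" for w
      proof -
        obtain v where "v \<in> W" "w = conjug g v" using w \<open>conjug g ` W = W\<close> by blast
        then show ?thesis using gG WG by simp
      qed
      moreover have "inv g \<in> U" using that subgroup.m_inv_closed[OF U(1)] by simp
      ultimately show ?thesis by simp
    qed
  next
    have "\<one> \<in> ?N" using U WG by (auto simp: subgroup.one_closed)
    then show "?N \<noteq> {}" by blast
  next
    show "g \<otimes> h \<in> ?N" if "g \<in> ?N" "h \<in> ?N" for g h
      using that U UG WG by (auto simp: subgroup.m_closed simp flip: conjug_conjug)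
  qed (use UG in auto)
  obtain h0 where h0: "h0 \<in> U" "h0 \<notin> W" "\<forall>u\<in>W. conjug h0 u \<in> W"
    using normalizer_grows[OF U(1,2) p W'] .
  have "?N = U"
    by (rule maxi[OF N _ _ _ h0(2)]) (use h0 W' conjug_subgroup_mem[OF W'(1)] in auto)
  then have Wn: "conjug g w \<in> W" if "g \<in> U" "w \<in> W" for g w using that by blast
  have "h0 [^] (p ^ k) = \<one>" using pow_card_subgroup[OF U(1)] U h0 by simp
  then have ex: "h0 [^] (p ^ k) \<in> W" using W' by (simp add: subgroup.one_closed)
  \<comment> \<open>The iterated \<open>p\<close>-th power of \<open>h0\<close> just before the
    first one in \<open>W\<close> is an element of order \<open>p\<close> modulo
    \<open>W\<close>.\<close>
  define i where "i = (LEAST i. h0 [^] (p ^ i) \<in> W)"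
  have i: "h0 [^] (p ^ i) \<in> W" unfolding i_def by (rule LeastI[of _ k]) (rule ex)
  have "i \<noteq> 0" using i h0 UG by (cases "i = 0") auto
  then have i1: "h0 [^] (p ^ (i - 1)) \<notin> W" unfolding i_def by (intro not_less_Least) (simp add: i_def[symmetric])
  define g where "g = h0 [^] (p ^ (i - 1))"
  have g: "g \<in> U" "g \<notin> W" using i1 subgroup_pow[OF U(1) h0(1)] by (auto simp: g_def)
  have "g [^] p = h0 [^] (p ^ (i - 1) * p)" using h0 UG by (simp add: g_def nat_pow_pow)
  also have "p ^ (i - 1) * p = p ^ i" using \<open>i \<noteq> 0\<close> by (cases i) auto
  finally have gp: "g [^] p \<in> W" using i by simp
  let ?U = "G\<lparr>carrier := U\<rparr>"
  interpret UU: group ?U by (rule subgroup.subgroup_is_group[OF U(1) is_group])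
  have UUinv: "inv\<^bsub>?U\<^esub> x = inv x" if "x \<in> U" for x using U(1) that by (simp add: m_inv_consistent)
  have WU: "W \<lhd> ?U"
  proof (rule UU.normal_invI)
    show "subgroup W ?U" using W' U by (simp add: subgroup_incl)
    show "x \<otimes>\<^bsub>?U\<^esub> h \<otimes>\<^bsub>?U\<^esub> inv\<^bsub>?U\<^esub> x \<in> W" if "x \<in> carrier ?U" "h \<in> W" for x h
      using that Wn[of x h] by (simp add: UUinv conjug_def)
  qed
  let ?Q = "?U Mod W"
  interpret Q: group ?Q using WU by (rule normal.factorgroup_is_group)
  define \<pi> where "\<pi> = (\<lambda>a. W #> a)"
  interpret H: group_hom ?U ?Q \<pi>
    using normal.r_coset_hom_Mod[OF WU] by unfold_locales (simp add: \<pi>_def)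
  have pi1: "\<pi> x = \<one>\<^bsub>?Q\<^esub> \<longleftrightarrow> x \<in> W" if "x \<in> U" for x
    using that W' UG coset_join1[of W x] coset_join2[of x W] by (auto simp: \<pi>_def)
  have pim: "\<pi> (x \<otimes> y) = \<pi> x \<otimes>\<^bsub>?Q\<^esub> \<pi> y" if "x \<in> U" "y \<in> U" for x y
    using H.hom_mult[of x y] that by simp
  have pic [simp]: "\<pi> x \<in> carrier ?Q" if "x \<in> U" for x using H.hom_closed[of x] that by simp
  have pii: "\<pi> (inv x) = inv\<^bsub>?Q\<^esub> \<pi> x" if "x \<in> U" for x
    using H.hom_inv[of x] that UUinv by simp
  have pip: "\<pi> (x [^] (n::nat)) = \<pi> x [^]\<^bsub>?Q\<^esub> n" if "x \<in> U" for x n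
    using H.hom_nat_pow[of x n] that by (simp add: nat_pow_consistent[symmetric])
  let ?X = "{u \<in> U. \<exists>n::int. \<pi> u = \<pi> g [^]\<^bsub>?Q\<^esub> n}"
  have pg: "\<pi> g \<in> carrier ?Q" using g by simp
  have X: "subgroup ?X G"
  proof (rule subgroupI)
    have "\<pi> \<one> = \<pi> g [^]\<^bsub>?Q\<^esub> (0::int)" using pi1 subgroup.one_closed[OF U(1)] subgroup.one_closed[OF W'(1)] by simp
    then show "?X \<noteq> {}" using subgroup.one_closed[OF U(1)] by blast
  next
    fix a assume "a \<in> ?X"
    then obtain n where n: "a \<in> U" "\<pi> a = \<pi> g [^]\<^bsub>?Q\<^esub> (n::int)" by auto
    then have "\<pi> (inv a) = \<pi> g [^]\<^bsub>?Q\<^esub> (- n)" using pg by (simp add: pii Q.int_pow_neg)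
    then show "inv a \<in> ?X" using n U by (auto simp: subgroup.m_inv_closed)
    fix b assume "b \<in> ?X"
    then obtain k where k: "b \<in> U" "\<pi> b = \<pi> g [^]\<^bsub>?Q\<^esub> (k::int)" by auto
    have "\<pi> (a \<otimes> b) = \<pi> g [^]\<^bsub>?Q\<^esub> (n + k)" using pg n k by (simp add: pim Q.int_pow_mult)
    then show "a \<otimes> b \<in> ?X" using n k U by (auto simp: subgroup.m_closed)
  qed (use UG in auto)
  have "?X = U"
  proof (rule maxi[OF X _ _ _ g(2)])
    have "\<pi> w = \<pi> g [^]\<^bsub>?Q\<^esub> (0::int)" if "w \<in> W" for w using pi1[of w] that W' by auto
    then show "W \<subseteq> ?X" using W' by blast
    have "\<pi> g = \<pi> g [^]\<^bsub>?Q\<^esub> (1::int)" using pg by simp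
    then show "g \<in> ?X" using g by blast
  qed auto
  then have all: "\<exists>n::int. \<pi> u = \<pi> g [^]\<^bsub>?Q\<^esub> n" if "u \<in> U" for u using that by blast
  have "frat p U \<subseteq> W"
  proof (rule frat_least[OF W'(1)])
    fix a b assume a: "a \<in> U" and b: "b \<in> U"
    obtain n where n: "\<pi> a = \<pi> g [^]\<^bsub>?Q\<^esub> (n::int)" using all[OF a] ..
    obtain k where k: "\<pi> b = \<pi> g [^]\<^bsub>?Q\<^esub> (k::int)" using all[OF b] ..
    have "\<pi> a \<otimes>\<^bsub>?Q\<^esub> \<pi> b = \<pi> b \<otimes>\<^bsub>?Q\<^esub> \<pi> a"
      unfolding n k using Q.int_pow_mult[OF pg, of n k] Q.int_pow_mult[OF pg, of k n]
      by (simp only: add.commute)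
    then have "\<pi> (a \<otimes> b) = \<pi> (b \<otimes> a)" using a b by (simp add: pim)
    then have "W #> (a \<otimes> b) = W #> (b \<otimes> a)" by (simp add: \<pi>_def)
    then have "(a \<otimes> b) \<otimes> inv (b \<otimes> a) \<in> W" using coset_eq_iff W' a b UG by simp
    then show "a \<otimes> b \<otimes> inv a \<otimes> inv b \<in> W" using a b UG by (simp add: inv_mult_group m_assoc)
  next
    fix a assume a: "a \<in> U"
    obtain n where n: "\<pi> a = \<pi> g [^]\<^bsub>?Q\<^esub> (n::int)" using all[OF a] ..
    have "\<pi> (a [^] p) = (\<pi> g [^]\<^bsub>?Q\<^esub> n) [^]\<^bsub>?Q\<^esub> int p"
      using a by (simp add: pip n int_pow_int)
    also have "\<dots> = (\<pi> g [^]\<^bsub>?Q\<^esub> int p) [^]\<^bsub>?Q\<^esub> n"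
      using pg by (simp only: Q.int_pow_pow mult.commute)
    also have "\<dots> = (\<pi> g [^]\<^bsub>?Q\<^esub> p) [^]\<^bsub>?Q\<^esub> n" by (simp add: int_pow_int)
    also have "\<pi> g [^]\<^bsub>?Q\<^esub> p = \<one>\<^bsub>?Q\<^esub>" using pip[of g p] g gp pi1[of "g [^] p"] subgroup_pow[OF U(1)] by simp
    also have "\<one>\<^bsub>?Q\<^esub> [^]\<^bsub>?Q\<^esub> n = \<one>\<^bsub>?Q\<^esub>" by (rule Q.int_pow_one)
    finally have "\<pi> (a [^] p) = \<one>\<^bsub>?Q\<^esub>" .
    then show "a [^] p \<in> W" using pi1 a subgroup_pow[OF U(1)] by blast
  qed
  then show ?thesis using W' by blast
qed

end

context group
begin

lemma inv_mult_assoc_cancel [simp]: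
  "x \<in> carrier G \<Longrightarrow> y \<in> carrier G \<Longrightarrow> inv x \<otimes> (x \<otimes> y) = y"
  "x \<in> carrier G \<Longrightarrow> y \<in> carrier G \<Longrightarrow> x \<otimes> (inv x \<otimes> y) = y"
  by (simp_all flip: m_assoc)

lemma conjug_distrib:
  "g \<in> carrier G \<Longrightarrow> a \<in> carrier G \<Longrightarrow> b \<in> carrier G \<Longrightarrow>
   conjug (conjug g a) (conjug g b) = conjug g (conjug a b)"
  by (simp add: conjug_def m_assoc inv_mult_group)

text \<open>\<open>y\<close> acts trivially on \<open>F\<close>, so \<open>conjug y u\<close> acts
  on \<open>F\<close> as \<open>u\<close> does, and the quotient of the two acts trivially. This
  case of the three subgroups lemma pushes commutators with a \<open>p'\<close>-element into a
  centralizer.\<close>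

lemma commutator_centralizes:
  assumes y: "y \<in> carrier G" and u: "u \<in> carrier G" and F: "F \<subseteq> carrier G"
    and yF: "\<And>f. f \<in> F \<Longrightarrow> conjug y f = f" and uF: "\<And>f. f \<in> F \<Longrightarrow> conjug (inv u) f \<in> F" and f: "f \<in> F"
  shows "conjug (conjug y u \<otimes> inv u) f = f"
proof -
  have fG: "f \<in> carrier G" using f F by auto
  define e where "e = conjug (inv u) f"
  have e: "e \<in> F" "e \<in> carrier G" using uF[OF f] F by (auto simp: e_def)
  have "conjug (conjug y u \<otimes> inv u) f = conjug (conjug y u) e"
    using u y fG by (simp add: e_def conjug_conjug)
  also have "\<dots> = conjug (conjug y u) (conjug y e)" using yF[OF e(1)] by simp
  also have "\<dots> = conjug y (conjug u e)" using u y e by (simp add: conjug_distrib)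
  also have "conjug u e = f" using u fG by (simp add: e_def)
  finally show ?thesis using yF[OF f] by simp
qed

text \<open>On a subgroup of class two whose derived subgroup has exponent \<open>p\<close>, the map \<open>x \<mapsto> x\<^sup>p\<close> is a
  homomorphism for odd \<open>p\<close>, while \<open>p = 2\<close> needs \<open>x \<mapsto> x\<^sup>4\<close>.\<close>

definition good_exp :: "nat \<Rightarrow> nat \<Rightarrow> 'a set \<Rightarrow> bool" where
  "good_exp p q U \<longleftrightarrow>
    q = p \<and> (odd p \<or> (\<forall>a\<in>U. \<forall>b\<in>U. a \<otimes> b = b \<otimes> a)) \<or> p = 2 \<and> q = 4"

lemma good_exp_dvd: "good_exp p q U \<Longrightarrow> p dvd q"
  by (auto simp: good_exp_def)

lemma good_exp_pow_mult:
  assumes "good_exp p q U" "subgroup U G" "a \<in> U" "b \<in> U"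
    and ca: "(a \<otimes> b \<otimes> inv a \<otimes> inv b) \<otimes> a = a \<otimes> (a \<otimes> b \<otimes> inv a \<otimes> inv b)"
    and cb: "(a \<otimes> b \<otimes> inv a \<otimes> inv b) \<otimes> b = b \<otimes> (a \<otimes> b \<otimes> inv a \<otimes> inv b)"
    and ap: "a [^] p \<otimes> b = b \<otimes> a [^] p"
  shows "(a \<otimes> b) [^] q = a [^] q \<otimes> b [^] q"
proof (cases "a \<otimes> b = b \<otimes> a")
  case True
  then show ?thesis using assms(2-4) pow_mult_distrib subgroup.mem_carrier by metis
next
  case False
  have ab: "a \<in> carrier G" "b \<in> carrier G" using assms(2-4) subgroup.mem_carrier by fast+
  \<comment> \<open>For \<open>q = 2\<close> the correcting factor is the commutator itself, so
    squaring is multiplicative only on commuting elements, a case already settled. For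
    \<open>q = 4\<close> the binomial coefficient is \<open>6\<close>, for odd \<open>q = p\<close>
    it is \<open>p * ((p - 1) div 2)\<close>.\<close>
  have "p dvd q * (q - 1) div 2"
  proof (cases "p = 2 \<and> q = 4")
    case False
    then have "q = p" "odd p" using assms(1,3,4) \<open>a \<otimes> b \<noteq> b \<otimes> a\<close> by (auto simp: good_exp_def)
    moreover from this have "p * (p - 1) div 2 = p * ((p - 1) div 2)"
      by (simp add: div_mult_swap)
    ultimately show ?thesis by simp
  qed auto
  then show ?thesis by (rule class2_pow_hom[OF ab refl ca cb ap])
qed

end

context fin_group
begin

lemma centralizer_subgroup:
  assumes "subgroup N G" "U \<subseteq> carrier G"
  shows "subgroup {g \<in> N. \<forall>u\<in>U. conjug g u = u} G"
proof (rule subgroupI)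
  have NG: "x \<in> carrier G" if "x \<in> N" for x using that assms(1) subgroup.mem_carrier by fast
  show "{g \<in> N. \<forall>u\<in>U. conjug g u = u} \<subseteq> carrier G" using NG by auto
  have "\<one> \<in> {g \<in> N. \<forall>u\<in>U. conjug g u = u}" using assms by (auto simp: subgroup.one_closed)
  then show "{g \<in> N. \<forall>u\<in>U. conjug g u = u} \<noteq> {}" by blast
  fix a assume a: "a \<in> {g \<in> N. \<forall>u\<in>U. conjug g u = u}"
  then have aG: "a \<in> carrier G" using NG by auto
  have "conjug (inv a) u = u" if "u \<in> U" for u
    using conjug_inv_cancel(1)[OF aG, of u] that a assms(2) by auto
  then show "inv a \<in> {g \<in> N. \<forall>u\<in>U. conjug g u = u}"
    using a assms(1) by (simp add: subgroup.m_inv_closed)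
  fix b assume b: "b \<in> {g \<in> N. \<forall>u\<in>U. conjug g u = u}"
  have "conjug (a \<otimes> b) u = u" if "u \<in> U" for u
    using conjug_conjug[OF aG, of b u] that a b assms(2) NG by auto
  then show "a \<otimes> b \<in> {g \<in> N. \<forall>u\<in>U. conjug g u = u}"
    using a b assms(1) by (simp add: subgroup.m_closed)
qed

lemma conjug_image_eq:
  assumes "g \<in> carrier G" "subgroup U G" "\<And>u. u \<in> U \<Longrightarrow> conjug g u \<in> U"
  shows "conjug g ` U = U"
proof (rule card_subset_eq)
  show "card (conjug g ` U) = card U"
    using assms subgroup.subset by (intro card_image inj_on_conjug) auto
qed (use assms in auto)

lemma normalizer_subgroup:
  assumes "subgroup N G" "subgroup U G"
  shows "subgroup {g \<in> N. \<forall>u\<in>U. conjug g u \<in> U} G"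
proof (rule subgroupI)
  have NG: "x \<in> carrier G" if "x \<in> N" for x using that assms(1) subgroup.mem_carrier by fast
  have UG: "x \<in> carrier G" if "x \<in> U" for x using that assms(2) subgroup.mem_carrier by fast
  show "{g \<in> N. \<forall>u\<in>U. conjug g u \<in> U} \<subseteq> carrier G" using NG by auto
  have "\<one> \<in> {g \<in> N. \<forall>u\<in>U. conjug g u \<in> U}" using assms UG by (auto simp: subgroup.one_closed)
  then show "{g \<in> N. \<forall>u\<in>U. conjug g u \<in> U} \<noteq> {}" by blast
  fix a assume a: "a \<in> {g \<in> N. \<forall>u\<in>U. conjug g u \<in> U}"
  then have aG: "a \<in> carrier G" using NG by auto
  have "conjug (inv a) u \<in> U" if u: "u \<in> U" for u
  proof -
    obtain v where "v \<in> U" "u = conjug a v"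
      using conjug_image_eq[OF aG assms(2)] a u by blast
    then show ?thesis using aG UG by simp
  qed
  then show "inv a \<in> {g \<in> N. \<forall>u\<in>U. conjug g u \<in> U}"
    using a assms(1) by (simp add: subgroup.m_inv_closed)
  fix b assume b: "b \<in> {g \<in> N. \<forall>u\<in>U. conjug g u \<in> U}"
  have "conjug (a \<otimes> b) u \<in> U" if "u \<in> U" for u
    using conjug_conjug[OF aG, of b u, symmetric] that a b UG NG by auto
  then show "a \<otimes> b \<in> {g \<in> N. \<forall>u\<in>U. conjug g u \<in> U}"
    using a b assms(1) by (simp add: subgroup.m_closed)
qed

text \<open>Huppert, Endliche Gruppen I, IV.5.12.\<close>
lemma centralizes_of_small_exponent:
  assumes p: "prime p" and y: "y \<in> carrier G" "p_reg p y"
    and "subgroup U G" "card U = p ^ k" "\<forall>u\<in>U. conjug y u \<in> U" "good_exp p q U"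
    and "\<forall>u\<in>U. u [^] q = \<one> \<longrightarrow> conjug y u = u"
  shows "\<forall>u\<in>U. conjug y u = u"
  using assms(4-)
proof (induction "card U" arbitrary: U k rule: less_induct)
  case less
  note U = less.prems
  have UG: "u \<in> carrier G" if "u \<in> U" for u using that U(1) subgroup.mem_carrier by fast
  obtain m where m: "y [^] (m::nat) = \<one>" "\<And>k. coprime m (p ^ k)"
    using p_reg_conv[OF p y(2)] by blast
  have fix1: "conjug y u = u" if "u \<in> U" "conjug y (conjug y u \<otimes> inv u) = conjug y u \<otimes> inv u" for u
  proof (rule coprime_fix[OF y(1) m(1) UG[OF that(1)] that(2)])
    have "conjug y u \<otimes> inv u \<in> U" using U that by (simp add: subgroup.m_closed subgroup.m_inv_closed)
    then show "(conjug y u \<otimes> inv u) [^] (p ^ k) = \<one>" using pow_card_subgroup[OF U(1)] U by simp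
  qed (rule m(2))
  have sub: "\<forall>u\<in>W. conjug y u = u"
    if W: "subgroup W G" "W \<subseteq> U" "W \<noteq> U" "\<forall>u\<in>W. conjug y u \<in> W" for W
  proof -
    have "card W < card U" using W U by (metis fin_sub psubsetI psubset_card_mono)
    moreover obtain j where "card W = p ^ j"
      using card_dvd_sub[OF W(1) U(1) W(2)] U(2) prime_power_dvd_obtain[OF p] by metis
    moreover have "good_exp p q W" using U W unfolding good_exp_def by blast
    ultimately show ?thesis using less.hyps[of W j] W U by blast
  qed
  show ?case
  proof (cases "U = {\<one>}")
    case False
    let ?F = "frat p U"
    have F: "subgroup ?F G" "?F \<subseteq> U" "?F \<noteq> U"
      using frat_subgroup frat_subset frat_proper p U False by auto
    have Fy: "conjug y f = f" if "f \<in> ?F" for f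
      using sub[OF F] frat_conjug[OF U(1) y(1)] U(3) that by blast
    \<comment> \<open>\<open>y\<close> is trivial on \<open>?F\<close> by induction, so all
      commutators with \<open>y\<close> lie in \<open>?C\<close>. If \<open>?C\<close> is proper,
      induction makes \<open>y\<close> fix them; if \<open>?C = U\<close>, then \<open>U\<close> has
      class at most two and central \<open>p\<close>-th powers.\<close>
    let ?C = "{u \<in> U. \<forall>f\<in>?F. conjug u f = f}"
    have FG: "f \<in> carrier G" if "f \<in> ?F" for f using that F UG by auto
    have C: "subgroup ?C G" using centralizer_subgroup[OF U(1)] FG by blast
    have comC: "conjug y u \<otimes> inv u \<in> ?C" if u: "u \<in> U" for u
    proof -
      have uG: "u \<in> carrier G" using u UG by simp
      have "conjug (conjug y u \<otimes> inv u) f = f" if f: "f \<in> ?F" for f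
      proof (rule commutator_centralizes[OF y(1) uG _ Fy _ f])
        show "conjug (inv u) e \<in> ?F" if "e \<in> ?F" for e
          by (rule frat_conjug[OF U(1) _ _ that])
            (use u U uG conjug_subgroup_mem[OF U(1)] subgroup.m_inv_closed[OF U(1)] in auto)
      qed (use FG in auto)
      then show ?thesis using u U by (simp add: subgroup.m_closed subgroup.m_inv_closed)
    qed
    show ?thesis
    proof (cases "?C = U")
      case False
      have "\<forall>u\<in>?C. conjug y u \<in> ?C"
      proof
        fix u assume u: "u \<in> ?C"
        have "conjug y u = (conjug y u \<otimes> inv u) \<otimes> u" using u y UG by (simp add: m_assoc)
        moreover have "(conjug y u \<otimes> inv u) \<otimes> u \<in> ?C" using subgroup.m_closed[OF C comC u] u by blast
        ultimately show "conjug y u \<in> ?C" by simp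
      qed
      then have "\<forall>u\<in>?C. conjug y u = u" using sub[OF C] False by blast
      then show ?thesis using fix1 comC by blast
    next
      case True
      have central: "f \<otimes> u = u \<otimes> f" if "f \<in> ?F" "u \<in> U" for f u
      proof -
        have "conjug u f = f" using that True by blast
        then show ?thesis using that UG FG conjug_eq_iff_commute by metis
      qed
      \<comment> \<open>The \<open>q\<close>-th power is multiplicative here and
        \<open>u [^] q\<close> lies in \<open>?F\<close>, which \<open>y\<close> fixes. So the
        hypothesis on elements of exponent \<open>q\<close> applies to the commutator.\<close>
      have "(conjug y u \<otimes> inv u) [^] q = \<one>" if u: "u \<in> U" for u
      proof -
        have uG: "u \<in> carrier G" using u UG by simp
        have iu: "inv u \<in> U" "conjug y u \<in> U" using u U by (auto simp: subgroup.m_inv_closed)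
        have "(conjug y u \<otimes> inv u) [^] q = conjug y u [^] q \<otimes> inv u [^] q"
          by (rule good_exp_pow_mult[OF U(4,1) iu(2,1)])
            (use central iu commutator_in_frat pow_in_frat in metis)+
        also have "\<dots> = conjug y (u [^] q) \<otimes> inv (u [^] q)"
          using uG y by (simp add: conjug_pow nat_pow_inv)
        also have "conjug y (u [^] q) = u [^] q"
        proof -
          obtain r where "q = p * r" using good_exp_dvd[OF U(4)] by auto
          then have "u [^] q = (u [^] p) [^] r" using uG by (simp add: nat_pow_pow)
          then show ?thesis using Fy subgroup_pow[OF F(1) pow_in_frat[OF u]] by simp
        qed
        finally show ?thesis using uG by simp
      qed
      then show ?thesis using U(5) fix1 comC by blast
    qed
  qed (use y in auto)
qed

subsection \<open>Fusion and transfer\<close>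

text \<open>The local condition of Frobenius' theorem on normal \<open>p\<close>-complements,
  phrased for \<open>p'\<close>-elements: on each \<open>p\<close>-subgroup \<open>U\<close> of
  \<open>N\<close>, the normalizer of \<open>U\<close> in \<open>N\<close> induces a
  \<open>p\<close>-group.\<close>

definition reg_centralizes :: "nat \<Rightarrow> 'a set \<Rightarrow> bool" where
  "reg_centralizes p N \<longleftrightarrow>
    (\<forall>U y k. subgroup U G \<longrightarrow> U \<subseteq> N \<longrightarrow> card U = p ^ k \<longrightarrow> y \<in> N \<longrightarrow> p_reg p y \<longrightarrow>
       (\<forall>u\<in>U. conjug y u \<in> U) \<longrightarrow> (\<forall>u\<in>U. conjug y u = u))"

lemma normalizer_mod_centralizer:
  assumes p: "prime p" and N: "subgroup N G" and R: "reg_centralizes p N"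
    and U: "subgroup U G" "U \<subseteq> N" "card U = p ^ k"
  shows "\<exists>a. card {g \<in> N. \<forall>u\<in>U. conjug g u \<in> U} = p ^ a * card {g \<in> N. \<forall>u\<in>U. conjug g u = u}"
proof (rule index_p_power[OF normalizer_subgroup[OF N U(1)] p])
  have UG: "U \<subseteq> carrier G" using U subgroup.subset by blast
  have NG: "N \<subseteq> carrier G" using N subgroup.subset by blast
  show "subgroup {g \<in> N. \<forall>u\<in>U. conjug g u = u} G" by (rule centralizer_subgroup[OF N UG])
  obtain a where a: "\<forall>g\<in>carrier G. p_reg p (g [^] (p ^ a))" using p_reg_power_ex[OF p] .
  fix g assume g: "g \<in> {g \<in> N. \<forall>u\<in>U. conjug g u \<in> U}"
  then have "p_reg p (g [^] (p ^ a))" using a NG by auto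
  moreover have "g [^] (p ^ a) \<in> {g \<in> N. \<forall>u\<in>U. conjug g u \<in> U}"
    by (rule subgroup_pow[OF normalizer_subgroup[OF N U(1)] g])
  ultimately have "g [^] (p ^ a) \<in> {g \<in> N. \<forall>u\<in>U. conjug g u = u}"
    using R U unfolding reg_centralizes_def by blast
  then show "\<exists>a. g [^] (p ^ a) \<in> {g \<in> N. \<forall>u\<in>U. conjug g u = u}" by blast
qed auto

text \<open>Isaacs, Finite Group Theory, 5.26: the centralizer of \<open>P \<inter> S\<close> acts transitively on the
  Sylow subgroups through it.\<close>
lemma sylow_conj_centralizing:
  assumes p: "prime p" and N: "subgroup N G" and R: "reg_centralizes p N"
    and "sylow_in p N P" "sylow_in p N S"
  shows "\<exists>c\<in>N. (\<forall>u\<in>P \<inter> S. conjug c u = u) \<and> conjug c ` S = P"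
  using assms(4,5)
proof (induction "card P - card (P \<inter> S)" arbitrary: P S rule: less_induct)
  case less
  note P = less.prems(1) and S = less.prems(2)
  have P': "subgroup P G" "P \<subseteq> N" and S': "subgroup S G" "S \<subseteq> N"
    using P S by (auto simp: sylow_in_def)
  obtain k where k: "card P = p ^ k" using P by (auto simp: sylow_in_def)
  have cSP: "card S = card P" using sylow_card[OF N p S P] .
  have NG: "x \<in> carrier G" if "x \<in> N" for x using that N subgroup.mem_carrier by fast
  let ?U = "P \<inter> S"
  have U: "subgroup ?U G" using P' S' subgroups_Inter_pair by blast
  have UN: "?U \<subseteq> N" using P' by auto
  show ?case
  proof (cases "?U = P")
    case True
    then have "P = S" using card_subset_eq[of S P] cSP S' by auto
    then show ?thesis
      using NG P' subgroup.one_closed[OF N] by (intro bexI[of _ \<one>]) (auto simp: image_iff subset_iff)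
  next
    case False
    then have UP: "?U \<subset> P" by auto
    have US: "?U \<subset> S" using False cSP card_subset_eq[of P S] P' by auto
    obtain j where j: "card ?U = p ^ j"
      using card_dvd_sub[OF U P'(1)] k prime_power_dvd_obtain[OF p] by (metis inf_le1)
    let ?NN = "{g \<in> N. \<forall>u\<in>?U. conjug g u \<in> ?U}" and ?C = "{g \<in> N. \<forall>u\<in>?U. conjug g u = u}"
    have NN: "subgroup ?NN G" by (rule normalizer_subgroup[OF N U])
    have C: "subgroup ?C G" using centralizer_subgroup[OF N] U subgroup.subset by blast
    obtain a where a: "card ?NN = p ^ a * card ?C"
      using normalizer_mod_centralizer[OF p N R U UN j] by blast
    have psub: "\<exists>T. sylow_in p ?NN T \<and> X \<inter> ?NN \<subseteq> T"
      if X: "subgroup X G" "card X = card P" for X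
    proof -
      have I: "subgroup (X \<inter> ?NN) G" using X NN subgroups_Inter_pair by blast
      have "card (X \<inter> ?NN) dvd p ^ k" using card_dvd_sub[OF I X(1)] k X(2) by simp
      then obtain i where i: "card (X \<inter> ?NN) = p ^ i" by (rule prime_power_dvd_obtain[OF p])
      obtain T where "sylow_in p ?NN T" "X \<inter> ?NN \<subseteq> T"
        using p_sub_subset_sylow[OF NN p I Int_lower2 i] .
      then show ?thesis by (intro exI conjI)
    qed
    \<comment> \<open>\<open>T1\<close> and \<open>T2\<close> are Sylow subgroups of the normalizer
      of \<open>?U\<close>, above the normalizers of \<open>?U\<close> in \<open>P\<close> and in
      \<open>S\<close>. The latter two exceed \<open>?U\<close>.\<close>
    obtain T1 where T1: "sylow_in p ?NN T1" "P \<inter> ?NN \<subseteq> T1" using psub[OF P'(1)] by auto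
    obtain T2 where T2: "sylow_in p ?NN T2" "S \<inter> ?NN \<subseteq> T2" using psub[OF S'(1)] cSP by auto
    have T1': "subgroup T1 G" "T1 \<subseteq> ?NN" using T1 by (auto simp: sylow_in_def)
    have T2': "subgroup T2 G" "T2 \<subseteq> ?NN" using T2 by (auto simp: sylow_in_def)
    obtain g where g: "g \<in> ?NN" "conjug g ` T2 = T1" using sylow_conj_ex[OF NN p T1(1) T2(1)] .
    have ig: "inv g \<in> ?NN" using g(1) NN by (rule subgroup.m_inv_closed[rotated])
    have CN: "?C \<subseteq> ?NN" by auto
    \<comment> \<open>The conjugating element is corrected to one that centralizes
      \<open>?U\<close>: as \<open>y\<close> normalizes \<open>T1\<close>, the element
      \<open>c = inv x = y \<otimes> g\<close> still takes \<open>T2\<close> to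
      \<open>T1\<close>.\<close>
    obtain x y where xy: "x \<in> ?C" "y \<in> T1" "inv g = x \<otimes> y"
      using sylow_factor[OF NN p T1(1) C CN a ig] .
    define c where "c = inv x"
    have cC: "c \<in> ?C" unfolding c_def using xy(1) C by (rule subgroup.m_inv_closed[rotated])
    have xyG: "x \<in> carrier G" "y \<in> carrier G" "c \<in> carrier G" "g \<in> carrier G"
      using xy cC NG T1' g by auto
    have cg: "c = y \<otimes> g"
      using xyG by (metis c_def inv_closed inv_inv inv_mult_group inv_solve_left' xy(3) m_closed)
    have cT2: "conjug c t \<in> T1" if "t \<in> T2" for t
    proof -
      have "t \<in> carrier G" using that T2'(1) subgroup.mem_carrier by fast
      then have "conjug c t = conjug y (conjug g t)" using xyG by (simp add: cg conjug_conjug)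
      moreover have "conjug g t \<in> T1" using g(2) that by blast
      ultimately show ?thesis using conjug_subgroup_mem[OF T1'(1) xy(2)] by simp
    qed
    \<comment> \<open>A Sylow subgroup \<open>Q\<close> of \<open>N\<close> above \<open>T1\<close>
      is the bridge. Its intersections with \<open>P\<close> and with the conjugate
      \<open>S2\<close> of \<open>S\<close> by \<open>c\<close> are both larger than
      \<open>?U\<close>, so the induction hypothesis serves both pairs, and \<open>c\<close>,
      \<open>y1\<close>, \<open>x1\<close> compose.\<close>
    obtain i where "card T1 = p ^ i" using T1 by (auto simp: sylow_in_def)
    then obtain Q where Q: "sylow_in p N Q" "T1 \<subseteq> Q"
      using p_sub_subset_sylow[OF N p T1'(1)] T1' by blast
    define S2 where "S2 = conjug c ` S"
    have S2: "sylow_in p N S2" unfolding S2_def using S cC N by (intro sylow_conj) auto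
    have UNN: "?U \<subseteq> ?NN" using UN conjug_subgroup_mem[OF U] by blast
    have grow: "card ?U < card (X \<inter> ?NN)"
      if X: "subgroup X G" "X \<subseteq> N" "card X = card P" "?U \<subset> X" for X
    proof -
      obtain h where "h \<in> X" "h \<notin> ?U" "\<forall>u\<in>?U. conjug h u \<in> ?U"
        using normalizer_grows[OF X(1) _ p U X(4)] X(3) k by metis
      then have "h \<in> X \<inter> ?NN" "h \<notin> ?U" using X by auto
      then have "?U \<subset> X \<inter> ?NN" using UNN X(4) by blast
      then show ?thesis using X by (simp add: psubset_card_mono)
    qed
    have Q': "subgroup Q G" using Q by (simp add: sylow_in_def)
    have cQ: "card Q = card P" using sylow_card[OF N p Q(1) P] .
    have UG: "u \<in> carrier G" if "u \<in> ?U" for u using that UN NG by blast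
    have uS2: "u \<in> Q \<inter> S2" if u: "u \<in> ?U" for u
    proof -
      have "conjug c u = u" using cC u by blast
      then have "u \<in> S2" unfolding S2_def using u by (metis IntD2 image_eqI)
      moreover have "u \<in> Q" using u UNN T1(2) Q(2) by blast
      ultimately show ?thesis by simp
    qed
    have le: "card ?U \<le> card P" using P' by (simp add: card_mono)
    have "card (P \<inter> ?NN) \<le> card (P \<inter> Q)" using T1(2) Q(2) P' by (intro card_mono) auto
    then have "card ?U < card (P \<inter> Q)" using grow[OF P' refl UP] by simp
    moreover have "card (P \<inter> Q) \<le> card P" using P' by (simp add: card_mono)
    ultimately have "card P - card (P \<inter> Q) < card P - card ?U" by linarith
    then obtain x1 where x1: "x1 \<in> N" "\<forall>u\<in>P \<inter> Q. conjug x1 u = u" "conjug x1 ` Q = P"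
      using less.hyps[OF _ P Q(1)] by blast
    have "conjug c ` (S \<inter> ?NN) \<subseteq> Q \<inter> S2" using T2(2) cT2 Q(2) by (auto simp: S2_def)
    moreover have "card (conjug c ` (S \<inter> ?NN)) = card (S \<inter> ?NN)"
      by (rule card_image[OF inj_on_conjug[OF xyG(3)]]) (use NG in auto)
    moreover have "finite (Q \<inter> S2)" using Q' by simp
    ultimately have "card (S \<inter> ?NN) \<le> card (Q \<inter> S2)"
      using card_mono[of "Q \<inter> S2" "conjug c ` (S \<inter> ?NN)"] by simp
    then have "card ?U < card (Q \<inter> S2)" using grow[OF S' cSP US] by simp
    moreover have "card (Q \<inter> S2) \<le> card Q" using Q' by (simp add: card_mono)
    ultimately have "card Q - card (Q \<inter> S2) < card P - card ?U" using cQ by linarith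
    then obtain y1 where y1: "y1 \<in> N" "\<forall>u\<in>Q \<inter> S2. conjug y1 u = u" "conjug y1 ` S2 = Q"
      using less.hyps[OF _ Q(1) S2] by blast
    have G1: "x1 \<in> carrier G" "y1 \<in> carrier G" using x1 y1 NG by auto
    have cN: "c \<in> N" using cC by simp
    have comp: "conjug (x1 \<otimes> (y1 \<otimes> c)) u = conjug x1 (conjug y1 (conjug c u))" if "u \<in> carrier G" for u
      using that G1 xyG by (simp add: conjug_conjug m_assoc)
    show ?thesis
    proof (intro bexI conjI ballI)
      show "x1 \<otimes> (y1 \<otimes> c) \<in> N" using x1 y1 cN N by (simp add: subgroup.m_closed)
      show "conjug (x1 \<otimes> (y1 \<otimes> c)) u = u" if u: "u \<in> ?U" for u
      proof -
        have "conjug c u = u" using cC u by blast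
        moreover have "conjug y1 u = u" using uS2[OF u] y1(2) by blast
        moreover have "conjug x1 u = u" using uS2[OF u] u x1(2) by blast
        ultimately show ?thesis using comp[OF UG[OF u]] by simp
      qed
      have "conjug (x1 \<otimes> (y1 \<otimes> c)) ` S = conjug x1 ` conjug y1 ` conjug c ` S"
        unfolding image_image by (intro image_cong refl comp) (use S' NG in auto)
      then show "conjug (x1 \<otimes> (y1 \<otimes> c)) ` S = P" by (simp only: S2_def[symmetric] x1(3) y1(3))
    qed
  qed
qed

text \<open>With \<open>S\<close> the conjugate of \<open>P\<close> by \<open>inv g\<close>, the
  element \<open>x\<close> lies in \<open>P \<inter> S\<close>. Some \<open>c\<close> that
  centralizes \<open>x\<close> takes \<open>S\<close> to \<open>P\<close>, so
  \<open>c \<otimes> inv g\<close> normalizes \<open>P\<close> and factors as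
  \<open>z \<otimes> b\<close> with \<open>z\<close> centralizing \<open>P\<close> and
  \<open>b\<close> in \<open>P\<close>. Hence \<open>inv b\<close> induces the same fusion as
  \<open>g\<close>.\<close>

lemma fusion_control:
  assumes p: "prime p" and N: "subgroup N G" and R: "reg_centralizes p N"
    and P: "sylow_in p N P" and x: "x \<in> P" and g: "g \<in> N" "conjug g x \<in> P"
  obtains u where "u \<in> P" "conjug g x = conjug u x"
proof -
  have P': "subgroup P G" "P \<subseteq> N" using P by (auto simp: sylow_in_def)
  obtain k where k: "card P = p ^ k" using P by (auto simp: sylow_in_def)
  have NG: "x \<in> carrier G" if "x \<in> N" for x using that N subgroup.mem_carrier by fast
  have PG: "x \<in> carrier G" if "x \<in> P" for x using that P' NG by auto
  have G1: "x \<in> carrier G" "g \<in> carrier G" using x g PG NG by auto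
  define S where "S = conjug (inv g) ` P"
  have S: "sylow_in p N S"
    unfolding S_def by (rule sylow_conj[OF P _ N]) (use g N in \<open>simp add: subgroup.m_inv_closed\<close>)
  have "x = conjug (inv g) (conjug g x)" using G1 by simp
  then have "x \<in> S" unfolding S_def using g by blast
  obtain c where c: "c \<in> N" "\<forall>u\<in>P \<inter> S. conjug c u = u" "conjug c ` S = P"
    using sylow_conj_centralizing[OF p N R P S] by blast
  have cx: "conjug c x = x" using c x \<open>x \<in> S\<close> by blast
  have cG: "c \<in> carrier G" using c NG by simp
  let ?NN = "{g \<in> N. \<forall>u\<in>P. conjug g u \<in> P}" and ?C = "{g \<in> N. \<forall>u\<in>P. conjug g u = u}"
  have NN: "subgroup ?NN G" by (rule normalizer_subgroup[OF N P'(1)])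
  have C: "subgroup ?C G" using centralizer_subgroup[OF N] PG by blast
  obtain a where a: "card ?NN = p ^ a * card ?C"
    using normalizer_mod_centralizer[OF p N R P' k] by blast
  have "conjug (c \<otimes> inv g) u \<in> P" if "u \<in> P" for u
    using that c(3) cG G1 PG by (auto simp: S_def simp flip: conjug_conjug)
  then have n: "c \<otimes> inv g \<in> ?NN"
    using c g N by (simp add: subgroup.m_closed subgroup.m_inv_closed)
  have CN: "?C \<subseteq> ?NN" by auto
  have Pn: "sylow_in p ?NN P"
  proof -
    have PN: "P \<subseteq> ?NN" using P' conjug_subgroup_mem[OF P'(1)] by blast
    have NNN: "card ?NN dvd card N" using card_dvd_sub[OF NN N] by blast
    have "card P dvd card ?NN" using card_dvd_sub[OF P'(1) NN PN] .
    then have "card ?NN div card P dvd card N div card P"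
      using NNN by (meson div_dvd_div dvd_trans)
    then show ?thesis using P PN by (auto simp: sylow_in_def dest: dvd_trans)
  qed
  obtain z b where zb: "z \<in> ?C" "b \<in> P" "c \<otimes> inv g = z \<otimes> b"
    using sylow_factor[OF NN p Pn C CN a n] .
  have zbG: "z \<in> carrier G" "b \<in> carrier G" using zb NG PG by auto
  have "x = conjug (c \<otimes> inv g) (conjug g x)"
    using G1 cG cx by (simp add: conjug_conjug m_assoc)
  also have "\<dots> = conjug z (conjug b (conjug g x))"
    using zbG G1 by (simp add: zb(3) conjug_conjug m_assoc)
  also have "\<dots> = conjug b (conjug g x)"
    using zb(1) conjug_subgroup_mem[OF P'(1) zb(2) g(2)] by blast
  finally have "conjug (inv b) x = conjug g x" using zbG G1 by (metis conjug_closed conjug_inv_cancel(1))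
  then show ?thesis using that[of "inv b"] zb(2) P' by (simp add: subgroup.m_inv_closed)
qed

text \<open>For two sections \<open>s\<close>, \<open>t\<close> of the coset space \<open>X\<close> let \<open>d s t\<close> be the product of the \<open>\<phi> (s C (t C)\<inverse>)\<close>. As \<open>d\<close> is
  invariant under the action of \<open>N\<close> on sections, \<open>\<tau> g = d (g s) s\<close> does not depend on \<open>s\<close>. For \<open>x \<in> P\<close> it is
  evaluated on a section adapted to the orbits of \<open>x\<close>, where the factors agree with \<open>\<phi> x\<close> up to the
  coboundary of \<open>\<chi>\<close>.\<close>
lemma transfer_exists:
  fixes A :: "('c, 'd) monoid_scheme"
  assumes N: "subgroup N G" and P: "subgroup P G" "P \<subseteq> N" and A: "comm_group A"
    and cl: "\<And>x. x \<in> P \<Longrightarrow> \<phi> x \<in> carrier A"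
    and hom: "\<And>x y. x \<in> P \<Longrightarrow> y \<in> P \<Longrightarrow> \<phi> (x \<otimes> y) = \<phi> x \<otimes>\<^bsub>A\<^esub> \<phi> y"
    and stable: "\<And>x g. x \<in> P \<Longrightarrow> g \<in> N \<Longrightarrow> conjug g x \<in> P \<Longrightarrow> \<phi> (conjug g x) = \<phi> x"
  obtains \<tau> where "\<forall>g\<in>N. \<tau> g \<in> carrier A"
    "\<forall>g\<in>N. \<forall>h\<in>N. \<tau> (g \<otimes> h) = \<tau> g \<otimes>\<^bsub>A\<^esub> \<tau> h"
    "\<forall>x\<in>P. \<tau> x = \<phi> x [^]\<^bsub>A\<^esub> (card N div card P)"
proof -
  interpret A: comm_group A by (rule A)
  have NG: "x \<in> carrier G" if "x \<in> N" for x using that N subgroup.mem_carrier by fast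
  have PG: "P \<subseteq> carrier G" using P subgroup.subset by blast
  define X where "X = (\<lambda>g. P #> g) ` N"
  have finX: "finite X" using N by (simp add: X_def)
  have cX: "card X = card N div card P" unfolding X_def by (rule card_coset_image[OF P(1) N P(2)])
  have XG: "C \<subseteq> carrier G" if "C \<in> X" for C
    using that r_coset_subset_G[OF PG] NG unfolding X_def by blast
  have Xmul: "C #> g \<in> X" if "C \<in> X" "g \<in> N" for C g
    using that NG PG N by (auto simp: X_def coset_mult_assoc subgroup.m_closed)
  have Xinv: "C #> inv g \<in> X" if "C \<in> X" "g \<in> N" for C g
    using Xmul that N by (simp add: subgroup.m_inv_closed)
  have shift: "finprod A (\<lambda>C. f (C #> inv g)) X = finprod A f X"
    if f: "\<And>C. C \<in> X \<Longrightarrow> f C \<in> carrier A" and g: "g \<in> N" for f and g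
  proof -
    have inj: "inj_on (\<lambda>C. C #> inv g) X"
    proof (rule inj_on_inverseI[where g = "\<lambda>C. C #> g"])
      show "C #> inv g #> g = C" if "C \<in> X" for C
        using XG[OF that] NG[OF g] by (simp add: coset_mult_assoc)
    qed
    have "(\<lambda>C. C #> inv g) ` X = X"
      using Xinv g by (intro card_subset_eq finX card_image inj) auto
    then show ?thesis using A.finprod_reindex[of f "\<lambda>C. C #> inv g" X] inj f by auto
  qed
  define sec where "sec s \<longleftrightarrow> (\<forall>C\<in>X. s C \<in> N \<and> P #> s C = C)" for s
  define act where "act g s = (\<lambda>C. s (C #> inv g) \<otimes> g)" for g and s :: "'a set \<Rightarrow> 'a"
  define d where "d s t = finprod A (\<lambda>C. \<phi> (s C \<otimes> inv t C)) X" for s t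
  have secN: "s C \<in> N" "s C \<in> carrier G" if "sec s" "C \<in> X" for s C using that NG by (auto simp: sec_def)
  have secP: "s C \<otimes> inv t C \<in> P" if "sec s" "sec t" "C \<in> X" for s t C
    using coset_eq_iff[OF P(1) secN(2)[OF that(1,3)] secN(2)[OF that(2,3)]] that by (simp add: sec_def)
  have dcl: "d s t \<in> carrier A" if "sec s" "sec t" for s t
    unfolding d_def using secP[OF that] cl by (intro A.finprod_closed) auto
  have dmul: "d s t \<otimes>\<^bsub>A\<^esub> d t u = d s u" if "sec s" "sec t" "sec u" for s t u
  proof -
    have "d s t \<otimes>\<^bsub>A\<^esub> d t u =
        finprod A (\<lambda>C. \<phi> (s C \<otimes> inv t C) \<otimes>\<^bsub>A\<^esub> \<phi> (t C \<otimes> inv u C)) X"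
      unfolding d_def using secP cl that by (intro A.finprod_multf[symmetric]) auto
    also have "\<dots> = d s u"
      unfolding d_def
    proof (rule A.finprod_cong')
      fix C assume C: "C \<in> X"
      have "(s C \<otimes> inv t C) \<otimes> (t C \<otimes> inv u C) = s C \<otimes> inv u C"
        using secN(2)[OF _ C] that by (simp add: m_assoc)
      then show "\<phi> (s C \<otimes> inv t C) \<otimes>\<^bsub>A\<^esub> \<phi> (t C \<otimes> inv u C) = \<phi> (s C \<otimes> inv u C)"
        using hom[OF secP[OF that(1,2) C] secP[OF that(2,3) C]] by simp
    qed (use secP cl that in auto)
    finally show ?thesis .
  qed
  have secact: "sec (act g s)" if "sec s" "g \<in> N" for g s
    unfolding sec_def
  proof (intro ballI conjI)
    fix C assume C: "C \<in> X"
    note C' = Xinv[OF C that(2)]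
    show "act g s C \<in> N" using secN(1)[OF that(1) C'] that(2) N by (simp add: act_def subgroup.m_closed)
    have "P #> act g s C = P #> s (C #> inv g) #> g"
      using secN(2)[OF that(1) C'] NG[OF that(2)] PG by (simp add: act_def coset_mult_assoc)
    also have "\<dots> = C" using that C' XG[OF C] NG[OF that(2)] by (simp add: sec_def coset_mult_assoc)
    finally show "P #> act g s C = C" .
  qed
  have dact: "d (act g s) (act g t) = d s t" if s: "sec s" and t: "sec t" and g: "g \<in> N" for g s t
  proof -
    have "d (act g s) (act g t) =
        finprod A (\<lambda>C. (\<lambda>D. \<phi> (s D \<otimes> inv t D)) (C #> inv g)) X"
      unfolding d_def
    proof (rule A.finprod_cong')
      fix C assume C: "C \<in> X"
      note C' = Xinv[OF C g]
      have "act g s C \<otimes> inv act g t C = s (C #> inv g) \<otimes> inv t (C #> inv g)"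
        using secN(2)[OF s C'] secN(2)[OF t C'] NG[OF g] by (simp add: act_def m_assoc inv_mult_group)
      then show "\<phi> (act g s C \<otimes> inv act g t C) =
          \<phi> (s (C #> inv g) \<otimes> inv t (C #> inv g))" by simp
    qed (use secP[OF s t] cl Xinv[OF _ g] in auto)
    also have "\<dots> = d s t" unfolding d_def using secP[OF s t] cl g by (intro shift) auto
    finally show ?thesis .
  qed
  define s0 where "s0 C = (SOME g. g \<in> N \<and> P #> g = C)" for C
  have s0: "sec s0"
    unfolding sec_def
  proof
    fix C assume "C \<in> X"
    then have "\<exists>g. g \<in> N \<and> P #> g = C" by (auto simp: X_def)
    then show "s0 C \<in> N \<and> P #> s0 C = C" unfolding s0_def by (rule someI_ex)
  qed
  have d1: "d s t \<otimes>\<^bsub>A\<^esub> d t s = \<one>\<^bsub>A\<^esub>" if "sec s" "sec t" for s t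
  proof -
    have "d s s \<otimes>\<^bsub>A\<^esub> d s s = d s s" using dmul that by simp
    then have "d s s = \<one>\<^bsub>A\<^esub>" using dcl[OF that(1) that(1)] by (metis A.r_cancel_one')
    then show ?thesis using dmul[OF that that(1)] by simp
  qed
  define \<tau> where "\<tau> g = d (act g s0) s0" for g
  have indep: "\<tau> g = d (act g s) s" if s: "sec s" and g: "g \<in> N" for g s
  proof -
    note c = dcl[OF s0 s] dcl[OF s s0] dcl[OF secact[OF s g] s] dcl[OF secact[OF s0 g] s0]
    have "\<tau> g = d (act g s0) (act g s) \<otimes>\<^bsub>A\<^esub> d (act g s) s \<otimes>\<^bsub>A\<^esub> d s s0"
      unfolding \<tau>_def using dmul secact s s0 g by simp
    also have "\<dots> = d s0 s \<otimes>\<^bsub>A\<^esub> d s s0 \<otimes>\<^bsub>A\<^esub> d (act g s) s"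
      using c by (simp add: dact[OF s0 s g] A.m_ac)
    finally show ?thesis using d1[OF s0 s] c by simp
  qed
  have "\<tau> g \<in> carrier A" if "g \<in> N" for g unfolding \<tau>_def by (rule dcl[OF secact[OF s0 that] s0])
  moreover have "\<tau> (g \<otimes> h) = \<tau> g \<otimes>\<^bsub>A\<^esub> \<tau> h" if g: "g \<in> N" and h: "h \<in> N" for g h
  proof -
    have "\<tau> (g \<otimes> h) = d (act h (act g s0)) s0"
      unfolding \<tau>_def d_def
    proof (rule A.finprod_cong')
      fix C assume C: "C \<in> X"
      have "act (g \<otimes> h) s0 C = act h (act g s0) C"
        using secN(2)[OF s0] Xinv[OF Xinv[OF C h] g] XG[OF C] NG g h
        by (simp add: act_def coset_mult_assoc inv_mult_group m_assoc)
      then show "\<phi> (act (g \<otimes> h) s0 C \<otimes> inv s0 C) =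
          \<phi> (act h (act g s0) C \<otimes> inv s0 C)" by simp
    qed (use secP secact s0 g h cl in auto)
    also have "\<dots> = d (act h (act g s0)) (act h s0) \<otimes>\<^bsub>A\<^esub> d (act h s0) s0"
      using dmul secact s0 g h by simp
    also have "\<dots> = \<tau> g \<otimes>\<^bsub>A\<^esub> \<tau> h" by (simp add: \<tau>_def dact secact s0 g h)
    finally show ?thesis .
  qed
  moreover have "\<tau> x = \<phi> x [^]\<^bsub>A\<^esub> (card N div card P)" if x: "x \<in> P" for x
  proof -
    have xN: "x \<in> N" and xG: "x \<in> carrier G" using x P PG by auto
    have pw: "\<phi> (x [^] (n::nat)) = \<phi> x [^]\<^bsub>A\<^esub> n" for n
    proof (induction n)
      case 0
      have "\<phi> \<one> \<otimes>\<^bsub>A\<^esub> \<phi> \<one> = \<phi> \<one>"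
        using hom[of "\<one>" "\<one>"] subgroup.one_closed[OF P(1)] by simp
      then show ?case using cl[OF subgroup.one_closed[OF P(1)]] by (simp add: A.r_cancel_one')
    next
      case (Suc n)
      then show ?case using hom subgroup_pow[OF P(1) x] x by simp
    qed
    define o' where "o' = card P"
    have o': "x [^] o' = \<one>" "0 < o'"
      using pow_card_subgroup[OF P(1) _ x] P by (auto simp: o'_def)
    have mulx: "C #> x [^] (n::nat) #> x [^] (k::nat) = C #> x [^] (n + k)"
      if "C \<in> X" for C n k using XG[OF that] xG by (simp add: coset_mult_assoc nat_pow_mult)
    have invx: "inv x = x [^] (o' - 1)"
    proof -
      have "x [^] (o' - 1) \<otimes> x = \<one>" using o' by (cases o') auto
      then show ?thesis using xG by (simp add: inv_equality)
    qed
    define orb where "orb C = {D \<in> X. \<exists>n::nat. D = C #> x [^] n}" for C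
    have Xpow: "C #> x [^] (n::nat) \<in> X" if "C \<in> X" for C n
      using Xmul[OF that] subgroup_pow[OF N xN] by simp
    have orb_inv: "orb (C #> inv x) = orb C" if C: "C \<in> X" for C
    proof (intro equalityI subsetI)
      fix D assume "D \<in> orb (C #> inv x)"
      then obtain n where "D \<in> X" "D = C #> inv x #> x [^] (n::nat)" by (auto simp: orb_def)
      then show "D \<in> orb C" using mulx[OF C] by (auto simp: orb_def invx)
    next
      fix D assume "D \<in> orb C"
      then obtain n where n: "D \<in> X" "D = C #> x [^] (n::nat)" by (auto simp: orb_def)
      have "C #> inv x #> x [^] Suc n = C #> x [^] n"
      proof -
        have "inv x \<otimes> x [^] Suc n = x [^] n" unfolding nat_pow_Suc2[OF xG] using xG by simp
        then show ?thesis using XG[OF C] xG coset_mult_assoc[of C "inv x" "x [^] Suc n"] by simp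
      qed
      then show "D \<in> orb (C #> inv x)" using n unfolding orb_def by (metis (mono_tags, lifting) mem_Collect_eq)
    qed
    \<comment> \<open>The choice depends on the set \<open>orb C\<close> alone, so it is constant
      along an orbit of \<open>x\<close>.\<close>
    define rep where "rep C = (SOME D. D \<in> orb C)" for C
    have rep: "rep C \<in> orb C" if C: "C \<in> X" for C
    proof -
      have "C = C #> x [^] (0::nat)" using XG[OF C] by simp
      then have "C \<in> orb C" unfolding orb_def using C by blast
      then show ?thesis unfolding rep_def by (rule someI)
    qed
    have repX: "rep C \<in> X" if "C \<in> X" for C using rep[OF that] by (simp add: orb_def)
    have rep_inv: "rep (C #> inv x) = rep C" if "C \<in> X" for C
      using orb_inv[OF that] by (simp add: rep_def)
    define idx where "idx C = (LEAST i::nat. rep C #> x [^] i = C)" for C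
    have idx: "rep C #> x [^] idx C = C" if C: "C \<in> X" for C
    proof -
      obtain n where n: "rep C = C #> x [^] (n::nat)" using rep[OF C] by (auto simp: orb_def)
      have "n + n * (o' - 1) = o' * n" using o'(2) by (cases o') auto
      moreover have "x [^] (o' * n) = \<one>" using o'(1) xG by (simp flip: nat_pow_pow)
      ultimately have "rep C #> x [^] (n * (o' - 1)) = C"
        using mulx[OF C, of n "n * (o' - 1)"] n XG[OF C] by simp
      then show ?thesis unfolding idx_def by (rule LeastI)
    qed
    define sx where "sx C = s0 (rep C) \<otimes> x [^] idx C" for C
    have sx: "sec sx"
      unfolding sec_def
    proof (intro ballI conjI)
      fix C assume C: "C \<in> X"
      show "sx C \<in> N" using secN(1)[OF s0 repX[OF C]] subgroup_pow[OF N xN] N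
        by (simp add: sx_def subgroup.m_closed)
      have "P #> sx C = P #> s0 (rep C) #> x [^] idx C"
        using secN(2)[OF s0 repX[OF C]] xG PG by (simp add: sx_def coset_mult_assoc)
      then show "P #> sx C = C" using s0 repX[OF C] idx[OF C] by (simp add: sec_def)
    qed
    define \<chi> where "\<chi> C = \<phi> x [^]\<^bsub>A\<^esub> idx C" for C
    have chi: "\<chi> C \<in> carrier A" for C using cl[OF x] by (simp add: \<chi>_def)
    \<comment> \<open>From \<open>C #> inv x\<close> to \<open>C\<close> the index rises by one and
      the factor is trivial, except at a representative: there the index returns to
      \<open>0\<close>, the factor is a conjugate of \<open>x [^] Suc (idx (C #> inv x))\<close>,
      and \<open>stable\<close> evaluates it. Both cases balance to one \<open>\<phi> x\<close> per
      coset.\<close>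
    have key: "\<phi> (act x sx C \<otimes> inv sx C) \<otimes>\<^bsub>A\<^esub> \<chi> C = \<phi> x \<otimes>\<^bsub>A\<^esub> \<chi> (C #> inv x)"
      if C: "C \<in> X" for C
    proof -
      let ?C = "C #> inv x"
      let ?D = "rep C"
      have C': "?C \<in> X" using Xinv[OF C xN] .
      have tG: "s0 ?D \<in> carrier G" "s0 ?D \<in> N" using secN[OF s0 repX[OF C]] by auto
      have actx: "act x sx C = s0 ?D \<otimes> x [^] Suc (idx ?C)"
        using tG xG by (simp add: act_def sx_def rep_inv[OF C] m_assoc)
      show ?thesis
      proof (cases "idx C")
        case 0
        then have CD: "sx C = s0 ?D" using tG by (simp add: sx_def)
        have "act x sx C \<otimes> inv sx C = conjug (s0 ?D) (x [^] Suc (idx ?C))"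
          unfolding actx CD by (simp add: conjug_def)
        moreover have "act x sx C \<otimes> inv sx C \<in> P" by (rule secP[OF secact[OF sx xN] sx C])
        ultimately have "\<phi> (act x sx C \<otimes> inv sx C) = \<phi> (x [^] Suc (idx ?C))"
          using stable[OF subgroup_pow[OF P(1) x] tG(2), of "Suc (idx ?C)"] by (simp del: nat_pow_Suc)
        then show ?thesis using cl[OF x] unfolding pw \<chi>_def 0 by (simp add: A.m_comm)
      next
        case (Suc j)
        have shift_back: "?D #> x [^] Suc l = C \<longleftrightarrow> ?D #> x [^] l = ?C" for l :: nat
        proof -
          have e: "?D #> x [^] Suc l = ?D #> x [^] l #> x"
            using XG[OF repX[OF C]] xG by (simp add: coset_mult_assoc)
          have f: "?D #> x [^] l #> x #> inv x = ?D #> x [^] l"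
            using XG[OF repX[OF C]] xG by (simp add: coset_mult_assoc m_assoc)
          have h: "?C #> x = C" using XG[OF C] xG by (simp add: coset_mult_assoc)
          show ?thesis using e f h by metis
        qed
        have "idx ?C = j"
          unfolding idx_def rep_inv[OF C]
        proof (rule Least_equality)
          show "?D #> x [^] j = ?C" using idx[OF C] shift_back[of j] Suc by simp
          fix l :: nat assume "?D #> x [^] l = ?C"
          then have "?D #> x [^] Suc l = C" using shift_back by simp
          then have "idx C \<le> Suc l" unfolding idx_def by (rule Least_le)
          then show "j \<le> l" using Suc by simp
        qed
        then have "act x sx C = sx C" unfolding actx sx_def Suc by simp
        then have "act x sx C \<otimes> inv sx C = x [^] (0::nat)" using secN(2)[OF sx C] by simp
        then show ?thesis using cl[OF x] \<open>idx ?C = j\<close> unfolding \<chi>_def Suc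
          by (simp only: pw) (simp add: A.m_comm)
      qed
    qed
    have "d (act x sx) sx \<otimes>\<^bsub>A\<^esub> finprod A \<chi> X =
        finprod A (\<lambda>C. \<phi> (act x sx C \<otimes> inv sx C) \<otimes>\<^bsub>A\<^esub> \<chi> C) X"
      unfolding d_def using secP[OF secact[OF sx xN] sx] cl chi by (intro A.finprod_multf[symmetric]) auto
    also have "\<dots> = finprod A (\<lambda>C. \<phi> x \<otimes>\<^bsub>A\<^esub> \<chi> (C #> inv x)) X"
      using key chi cl[OF x] by (intro A.finprod_cong') auto
    also have "\<dots> = finprod A (\<lambda>C. \<phi> x) X \<otimes>\<^bsub>A\<^esub> finprod A (\<lambda>C. \<chi> (C #> inv x)) X"
      using chi cl[OF x] by (intro A.finprod_multf) auto
    also have "finprod A (\<lambda>C. \<chi> (C #> inv x)) X = finprod A \<chi> X"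
      using chi xN by (intro shift) auto
    also have "finprod A (\<lambda>C. \<phi> x) X = \<phi> x [^]\<^bsub>A\<^esub> card X" using cl[OF x] by (rule A.finprod_const)
    finally have "d (act x sx) sx = \<phi> x [^]\<^bsub>A\<^esub> card X"
      using dcl[OF secact[OF sx xN] sx] A.finprod_closed[of \<chi> X] chi cl[OF x]
      by (subst (asm) A.right_cancel) auto
    then show ?thesis using indep[OF sx xN] cX by simp
  qed
  ultimately show ?thesis using that by blast
qed

text \<open>On \<open>P\<close> the transfer into \<open>P\<close> modulo \<open>frat p P\<close> is
  a power with exponent prime to \<open>p\<close>. As the target has exponent \<open>p\<close>, the
  transfer is nontrivial and kills all \<open>p'\<close>-elements; \<open>M\<close> is its
  kernel.\<close>

lemma regular_elements_proper:
  assumes p: "prime p" and N: "subgroup N G" and R: "reg_centralizes p N"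
    and S: "sylow_in p N P" "P \<noteq> {\<one>}"
  obtains M where "subgroup M G" "M \<subset> N" "\<forall>y\<in>N. p_reg p y \<longrightarrow> y \<in> M"
proof -
  have P: "subgroup P G" "P \<subseteq> N" and idx: "\<not> p dvd card N div card P" using S by (auto simp: sylow_in_def)
  obtain k where k: "card P = p ^ k" using S by (auto simp: sylow_in_def)
  have NG: "x \<in> carrier G" if "x \<in> N" for x using that N subgroup.mem_carrier by fast
  have PG: "x \<in> carrier G" if "x \<in> P" for x using that P NG by auto
  let ?F = "frat p P" and ?P = "G\<lparr>carrier := P\<rparr>"
  have F: "subgroup ?F G" "?F \<subseteq> P" "?F \<noteq> P"
    using frat_subgroup frat_subset frat_proper[OF p P(1) k S(2)] P by auto
  interpret PP: group ?P by (rule subgroup.subgroup_is_group[OF P(1) is_group])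
  have FP: "?F \<lhd> ?P"
  proof (rule PP.normal_invI)
    show "subgroup ?F ?P" using F P by (simp add: subgroup_incl)
    show "x \<otimes>\<^bsub>?P\<^esub> h \<otimes>\<^bsub>?P\<^esub> inv\<^bsub>?P\<^esub> x \<in> ?F" if "x \<in> carrier ?P" "h \<in> ?F" for x h
      using frat_conjug[OF P(1), of x h p] that P PG conjug_subgroup_mem[OF P(1)]
      by (simp add: m_inv_consistent conjug_def)
  qed
  let ?A = "?P Mod ?F"
  define \<phi> where "\<phi> = (\<lambda>a. ?F #> a)"
  interpret A: group ?A using FP by (rule normal.factorgroup_is_group)
  have carr: "carrier ?A = \<phi> ` P" by (simp add: carrier_FactGroup \<phi>_def)
  have cl: "\<phi> x \<in> carrier ?A" if "x \<in> P" for x using that carr by simp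
  have hom: "\<phi> (x \<otimes> y) = \<phi> x \<otimes>\<^bsub>?A\<^esub> \<phi> y" if "x \<in> P" "y \<in> P" for x y
    using hom_mult[OF normal.r_coset_hom_Mod[OF FP], of x y] that by (simp add: \<phi>_def)
  have eq: "\<phi> x = \<phi> y \<longleftrightarrow> x \<otimes> inv y \<in> ?F" if "x \<in> P" "y \<in> P" for x y
    using coset_eq_iff[OF F(1)] that PG by (simp add: \<phi>_def)
  have ker: "\<phi> x = \<one>\<^bsub>?A\<^esub> \<longleftrightarrow> x \<in> ?F" if "x \<in> P" for x
    using that F PG coset_join1[of ?F x] coset_join2[of x ?F] by (auto simp: \<phi>_def)
  have commA: "comm_group ?A"
  proof (rule A.group_comm_groupI)
    fix a b assume "a \<in> carrier ?A" "b \<in> carrier ?A"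
    then obtain x y where xy: "x \<in> P" "y \<in> P" "a = \<phi> x" "b = \<phi> y" by (auto simp: carr)
    have "(x \<otimes> y) \<otimes> inv (y \<otimes> x) = x \<otimes> y \<otimes> inv x \<otimes> inv y"
      using xy PG by (simp add: inv_mult_group m_assoc)
    then have "\<phi> (x \<otimes> y) = \<phi> (y \<otimes> x)"
      using eq[of "x \<otimes> y" "y \<otimes> x"] commutator_in_frat[of x P y p] xy P by (simp add: subgroup.m_closed)
    then show "a \<otimes>\<^bsub>?A\<^esub> b = b \<otimes>\<^bsub>?A\<^esub> a" using hom xy by metis
  qed
  interpret A: comm_group ?A by (rule commA)
  \<comment> \<open>Fusion in \<open>N\<close> is already fusion in \<open>P\<close>, so it changes
    \<open>x\<close> by a commutator of \<open>P\<close>, which is trivial in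
    \<open>?A\<close>.\<close>
  have stable: "\<phi> (conjug g x) = \<phi> x" if x: "x \<in> P" and g: "g \<in> N" "conjug g x \<in> P" for x g
  proof -
    obtain u where u: "u \<in> P" "conjug g x = conjug u x" using fusion_control[OF p N R S(1) x g] .
    have "conjug u x \<otimes> inv x \<in> ?F" using commutator_in_frat[OF u(1) x] by (simp add: conjug_def)
    then show ?thesis using eq[OF g(2) x] u by simp
  qed
  obtain \<tau> where tau: "\<forall>g\<in>N. \<tau> g \<in> carrier ?A"
    "\<forall>g\<in>N. \<forall>h\<in>N. \<tau> (g \<otimes> h) = \<tau> g \<otimes>\<^bsub>?A\<^esub> \<tau> h"
    "\<forall>x\<in>P. \<tau> x = \<phi> x [^]\<^bsub>?A\<^esub> (card N div card P)"
    using transfer_exists[OF N P commA cl hom stable] .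
  have pw: "\<phi> (x [^] (n::nat)) = \<phi> x [^]\<^bsub>?A\<^esub> n" if x: "x \<in> P" for x n
  proof (induction n)
    case 0
    have "\<phi> \<one> = \<one>\<^bsub>?A\<^esub>" using ker subgroup.one_closed[OF P(1)] subgroup.one_closed[OF F(1)] by simp
    then show ?case by (simp del: one_FactGroup)
  next
    case (Suc n)
    then show ?case using hom[OF subgroup_pow[OF P(1) x] x] by simp
  qed
  have expA: "a [^]\<^bsub>?A\<^esub> p = \<one>\<^bsub>?A\<^esub>" if a: "a \<in> carrier ?A" for a
  proof -
    obtain x where x: "x \<in> P" "a = \<phi> x" using a by (auto simp: carr)
    have "\<phi> (x [^] p) = \<one>\<^bsub>?A\<^esub>" using ker[OF subgroup_pow[OF P(1) x(1)]] pow_in_frat[OF x(1)] by blast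
    then show ?thesis using pw x by simp
  qed
  let ?M = "{g \<in> N. \<tau> g = \<one>\<^bsub>?A\<^esub>}"
  have tau1: "\<tau> \<one> = \<one>\<^bsub>?A\<^esub>"
  proof -
    have 1: "\<one> \<in> N" using N by (rule subgroup.one_closed)
    then have "\<tau> \<one> \<otimes>\<^bsub>?A\<^esub> \<tau> \<one> = \<tau> \<one>" using tau(2) by force
    then show ?thesis using tau(1) 1 A.r_cancel_one' by metis
  qed
  have M: "subgroup ?M G"
  proof (rule subgroupI)
    show "?M \<subseteq> carrier G" using NG by auto
    show "?M \<noteq> {}" using tau1 subgroup.one_closed[OF N] by blast
    fix a assume a: "a \<in> ?M"
    then have "a \<in> N" "inv a \<in> N" using N by (auto simp: subgroup.m_inv_closed)
    moreover from this have "\<tau> (inv a \<otimes> a) = \<tau> (inv a) \<otimes>\<^bsub>?A\<^esub> \<tau> a" using tau(2) by blast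
    ultimately have "\<tau> (inv a) = \<one>\<^bsub>?A\<^esub>" using a tau1 tau(1) NG A.r_one by force
    then show "inv a \<in> ?M" using \<open>inv a \<in> N\<close> by simp
    fix b assume "b \<in> ?M"
    moreover from this have "\<tau> (a \<otimes> b) = \<tau> a \<otimes>\<^bsub>?A\<^esub> \<tau> b" using tau(2) a by blast
    ultimately have "a \<otimes> b \<in> N" "\<tau> (a \<otimes> b) = \<one>\<^bsub>?A\<^esub>"
      using a N A.l_one[OF A.one_closed] by (auto simp: subgroup.m_closed simp del: one_FactGroup)
    then show "a \<otimes> b \<in> ?M" by simp
  qed
  obtain x where x: "x \<in> P" "x \<notin> ?F" using F by auto
  have "\<tau> x \<noteq> \<one>\<^bsub>?A\<^esub>"
  proof
    assume "\<tau> x = \<one>\<^bsub>?A\<^esub>"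
    then have "\<phi> x [^]\<^bsub>?A\<^esub> (card N div card P) \<in> {\<one>\<^bsub>?A\<^esub>}" using tau(3) x by simp
    moreover have "\<phi> x [^]\<^bsub>?A\<^esub> p \<in> {\<one>\<^bsub>?A\<^esub>}" using expA cl x by simp
    moreover have "coprime (card N div card P) p"
      using prime_imp_coprime[OF p idx] by (simp add: coprime_commute)
    ultimately have "\<phi> x \<in> {\<one>\<^bsub>?A\<^esub>}"
      using A.mem_of_coprime_pow_mem[OF A.triv_subgroup cl[OF x(1)]] by blast
    then show False using ker x by simp
  qed
  then have "?M \<subset> N" using x P by blast
  moreover have "y \<in> ?M" if y: "y \<in> N" "p_reg p y" for y
  proof -
    obtain m where m: "y [^] (m::nat) = \<one>" "coprime m p" using y by (auto simp: p_reg_def)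
    have tp: "\<tau> (y [^] (n::nat)) = \<tau> y [^]\<^bsub>?A\<^esub> n" for n
    proof (induction n)
      case 0 then show ?case using tau1 by (simp del: one_FactGroup)
    next
      case (Suc n) then show ?case using tau(2) subgroup_pow[OF N y(1)] y by simp
    qed
    have "\<tau> y [^]\<^bsub>?A\<^esub> m \<in> {\<one>\<^bsub>?A\<^esub>}" using tp[of m] m tau1 by simp
    moreover have "\<tau> y [^]\<^bsub>?A\<^esub> p \<in> {\<one>\<^bsub>?A\<^esub>}" using expA tau(1) y by simp
    ultimately have "\<tau> y \<in> {\<one>\<^bsub>?A\<^esub>}"
      using A.mem_of_coprime_pow_mem[OF A.triv_subgroup] tau(1) y m(2) by blast
    then show ?thesis using y by simp
  qed
  ultimately show ?thesis using that[OF M] by blast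
qed

end

section \<open>Power sums modulo \<open>p\<close> and eigenvectors\<close>

text \<open>\<open>x ^ k = 1\<close> has at most \<open>k < p - 1\<close> roots modulo
  \<open>p\<close>, so some \<open>a\<close> prime to \<open>p\<close> is not a root. Multiplication
  by \<open>a\<close> permutes the residues and multiplies the sum by \<open>a ^ k\<close>, so the
  sum vanishes modulo \<open>p\<close>.\<close>

lemma power_sum_dvd:
  fixes p k :: nat
  assumes p: "prime p" and k: "0 < k" "k < p - 1"
  shows "p dvd (\<Sum>i\<in>{..<p}. i ^ k)"
proof -
  have "card {x\<in>{..<p}. [x ^ k = 1] (mod p)} \<le> k"
    using roots_mod_prime_bound[OF p k(1), of 1] .
  also have "k < card {1..<p}" using k by simp
  finally have "\<not> {1..<p} \<subseteq> {x\<in>{..<p}. [x ^ k = 1] (mod p)}"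
    using card_mono[of "{x\<in>{..<p}. [x ^ k = 1] (mod p)}" "{1..<p}"] by auto
  then obtain a where a: "0 < a" "a < p" "\<not> [a ^ k = 1] (mod p)" by force
  have "\<not> p dvd a" using a nat_dvd_not_less by auto
  then have cop: "coprime a p" using prime_imp_coprime[OF p] coprime_commute by blast
  have inj: "inj_on (\<lambda>i. a * i mod p) {..<p}"
  proof (rule inj_onI)
    fix i j assume ij: "i \<in> {..<p}" "j \<in> {..<p}" "a * i mod p = a * j mod p"
    then have "[i = j] (mod p)" using cop by (simp add: cong_def[symmetric] cong_mult_lcancel_nat)
    then show "i = j" using ij by (simp add: cong_def)
  qed
  have "(\<lambda>i. a * i mod p) ` {..<p} = {..<p}"
    by (intro card_subset_eq card_image inj) (use a in auto)
  then have "(\<Sum>i\<in>{..<p}. i ^ k) = (\<Sum>i\<in>{..<p}. (a * i mod p) ^ k)"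
    using sum.reindex[OF inj, of "\<lambda>i. i ^ k"] by (simp add: o_def)
  moreover have "[(\<Sum>i\<in>{..<p}. (a * i mod p) ^ k) = (\<Sum>i\<in>{..<p}. (a * i) ^ k)] (mod p)"
    by (intro cong_sum cong_pow) (simp add: cong_def)
  moreover have "(\<Sum>i\<in>{..<p}. (a * i) ^ k) = a ^ k * (\<Sum>i\<in>{..<p}. i ^ k)"
    by (simp add: power_mult_distrib sum_distrib_left)
  ultimately have "[1 * (\<Sum>i\<in>{..<p}. i ^ k) = a ^ k * (\<Sum>i\<in>{..<p}. i ^ k)] (mod p)" by simp
  then have "\<not> coprime (\<Sum>i\<in>{..<p}. i ^ k) p"
    using a(3) cong_mult_rcancel_nat cong_sym by blast
  then show ?thesis using p by (metis coprime_commute prime_imp_coprime)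
qed

lemma power_sum_last:
  fixes p :: nat
  assumes p: "prime p"
  shows "[(\<Sum>i\<in>{..<p}. i ^ (p - 1)) = p - 1] (mod p)"
proof -
  have p1: "1 < p" using prime_gt_1_nat[OF p] .
  have "[(\<Sum>i\<in>{1..<p}. i ^ (p - 1)) = (\<Sum>i\<in>{1..<p}. 1)] (mod p)"
  proof (rule cong_sum)
    fix i assume "i \<in> {1..<p}"
    then have "\<not> p dvd i" by (auto dest: dvd_imp_le)
    then show "[i ^ (p - 1) = 1] (mod p)" using fermat_theorem p by blast
  qed
  moreover have "{..<p} = insert 0 {1..<p}" using p1 by auto
  ultimately show ?thesis using p1 by (simp add: power_0_left)
qed

context group
begin

lemma pow_cong:
  fixes m n p :: nat
  assumes "x \<in> carrier G" "x [^] p = \<one>" "[m = n] (mod p)"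
  shows "x [^] m = x [^] n"
proof -
  have "x [^] m = x [^] (m mod p)" for m :: nat
  proof -
    have "x [^] m = x [^] (p * (m div p) + m mod p)" by simp
    also have "\<dots> = (x [^] p) [^] (m div p) \<otimes> x [^] (m mod p)"
      using assms(1) by (simp only: nat_pow_mult nat_pow_pow nat_pow_closed)
    finally show ?thesis using assms by simp
  qed
  from this[of m] this[of n] show ?thesis using assms(3) by (simp add: cong_def)
qed

end

context fin_group
begin

text \<open>Written additively, for \<open>0 < i < p\<close> the vector \<open>e i\<close> is, up to sign, the projection of \<open>v\<close> to the eigenspace of \<open>i\<close>; by the
  power sums modulo \<open>p\<close> these vectors add up to \<open>- v\<close>.\<close>
lemma eigenvector_exists:
  fixes p :: nat
  assumes p: "prime p" and V: "subgroup V G" "V \<noteq> {\<one>}"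
    and com: "\<And>a b. a \<in> V \<Longrightarrow> b \<in> V \<Longrightarrow> a \<otimes> b = b \<otimes> a"
    and ex: "\<And>a. a \<in> V \<Longrightarrow> a [^] p = \<one>"
    and g: "g \<in> carrier G" "\<And>v. v \<in> V \<Longrightarrow> conjug g v \<in> V"
    and gp: "\<And>v. v \<in> V \<Longrightarrow> conjug (g [^] (p - 1)) v = v"
  obtains v i where "v \<in> V" "v \<noteq> \<one>" "conjug g v = v [^] (i::nat)"
proof -
  have VG: "x \<in> carrier G" if "x \<in> V" for x using that V subgroup.mem_carrier by fast
  let ?V = "G\<lparr>carrier := V\<rparr>"
  interpret VV: group ?V by (rule subgroup.subgroup_is_group[OF V(1) is_group])
  interpret VV: comm_group ?V by (rule VV.group_comm_groupI) (simp add: com)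
  have pw [simp]: "x [^]\<^bsub>?V\<^esub> (n::nat) = x [^] n" for x n by (simp add: nat_pow_consistent[symmetric])
  have p1: "1 < p" using prime_gt_1_nat[OF p] .
  obtain v where v: "v \<in> V" "v \<noteq> \<one>" using V subgroup.one_closed[OF V(1)] by blast
  define T where "T j = conjug (g [^] (j::nat)) v" for j
  have TS: "T (Suc j) = conjug g (T j)" for j
    unfolding T_def nat_pow_Suc2[OF g(1)] using g(1) VG[OF v(1)] by (simp add: conjug_conjug)
  have TV: "T j \<in> V" for j
    by (induction j) (use v VG TS g in \<open>auto simp: T_def\<close>)
  have TVp: "T j [^] (n::nat) \<in> V" for j n by (rule subgroup_pow[OF V(1) TV])
  \<comment> \<open>All exponents \<open>p - 1 - j\<close> are positive, so
    \<open>e 0 = \<one>\<close> and the product over all \<open>i < p\<close> is that over the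
    nonzero residues.\<close>
  define e where "e i = finprod ?V (\<lambda>j. T j [^] (i ^ (p - 1 - j))) {..<p - 1}" for i :: nat
  have eV: "e i \<in> V" for i
    unfolding e_def using VV.finprod_closed[of "\<lambda>j. T j [^] (i ^ (p - 1 - j))" "{..<p - 1}"] TVp by auto
  have conj_prod: "conjug g (finprod ?V f A) = finprod ?V (\<lambda>j. conjug g (f j)) A"
    if "finite A" "\<And>j. j \<in> A \<Longrightarrow> f j \<in> V" for f and A :: "nat set"
    using that
  proof (induction A rule: finite_induct)
    case empty then show ?case using g by simp
  next
    case (insert a A)
    have "finprod ?V f A \<in> V" using VV.finprod_closed[of f A] insert by auto
    then show ?case using insert g VG by (simp add: VV.finprod_insert Pi_def conjug_mult)
  qed
  have eig: "conjug g (e i) = e i [^] i" for i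
  proof -
    \<comment> \<open>A common form for both sides: conjugation by \<open>g\<close> turns the factor
      at \<open>j\<close> into \<open>F (Suc j)\<close>, the \<open>i\<close>-th power turns it into
      \<open>F j\<close>. The products agree because \<open>F 0 = F (p - 1)\<close>, by Fermat and
      \<open>gp\<close>.\<close>
    define F where "F j = T j [^] (i ^ (p - j))" for j
    have FV: "F j \<in> V" for j unfolding F_def by (rule TVp)
    have "conjug g (e i) = finprod ?V (\<lambda>j. F (Suc j)) {..<p - 1}"
      unfolding e_def using TVp
      by (subst conj_prod) (auto intro!: VV.finprod_cong' simp: F_def TS g(1) VG[OF TV] conjug_pow FV[unfolded F_def])
    also have "\<dots> = finprod ?V F {..<p - 1}"
    proof -
      have tele: "F 0 \<otimes> finprod ?V (\<lambda>j. F (Suc j)) {..<n} = F n \<otimes> finprod ?V F {..<n}" for n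
      proof (induction n)
        case 0 then show ?case by simp
      next
        case (Suc n)
        have c: "finprod ?V (\<lambda>j. F (Suc j)) {..<n} \<in> V" "finprod ?V F {..<n} \<in> V"
          using VV.finprod_closed[of "\<lambda>j. F (Suc j)" "{..<n}"] VV.finprod_closed[of F "{..<n}"] FV by auto
        have "finprod ?V (\<lambda>j. F (Suc j)) {..<Suc n} = F (Suc n) \<otimes> finprod ?V (\<lambda>j. F (Suc j)) {..<n}"
          using FV by (simp add: lessThan_Suc VV.finprod_insert Pi_def)
        moreover have "finprod ?V F {..<Suc n} = F n \<otimes> finprod ?V F {..<n}"
          using FV by (simp add: lessThan_Suc VV.finprod_insert Pi_def)
        ultimately show ?case using Suc c FV VV.m_lcomm[of "F 0" "F (Suc n)"] by simp
      qed
      have "F (p - 1) = v [^] i" using p1 gp[OF v(1)] by (simp add: F_def T_def)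
      moreover have "F 0 = v [^] i"
      proof -
        have "[i ^ p = i] (mod p)"
        proof (cases "p dvd i")
          case True then show ?thesis using p1 by (simp add: cong_def dvd_power_iff_le mod_eq_0_iff_dvd dvd_trans[OF _ dvd_power])
        next
          case False
          then have "[i ^ (p - 1) * i = 1 * i] (mod p)" using fermat_theorem[OF p] by (intro cong_mult) auto
          then show ?thesis using p1 by (metis One_nat_def Suc_pred mult_1 not_less0 not_gr_zero power_Suc2)
        qed
        then have "v [^] (i ^ p) = v [^] i" using pow_cong[OF VG[OF v(1)] ex[OF v(1)]] by blast
        then show ?thesis using VG[OF v(1)] by (simp add: F_def T_def)
      qed
      moreover have "finprod ?V (\<lambda>j. F (Suc j)) {..<p - 1} \<in> V" "finprod ?V F {..<p - 1} \<in> V"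
        using VV.finprod_closed[of "\<lambda>j. F (Suc j)" "{..<p - 1}"] VV.finprod_closed[of F "{..<p - 1}"] FV by auto
      ultimately show ?thesis using tele[of "p - 1"] VG v by simp
    qed
    also have "\<dots> = e i [^] i"
    proof -
      have fp: "finprod ?V f A [^] i = finprod ?V (\<lambda>j. f j [^] i) A"
        if "finite A" "\<And>j. j \<in> A \<Longrightarrow> f j \<in> V" for f and A :: "nat set"
        using that
      proof (induction A rule: finite_induct)
        case empty then show ?case by simp
      next
        case (insert a A)
        have "finprod ?V f A \<in> V" using VV.finprod_closed[of f A] insert by auto
        then show ?case using insert VG com subgroup_pow[OF V(1)]
          by (simp add: VV.finprod_insert Pi_def pow_mult_distrib)
      qed
      have "e i [^] i = finprod ?V (\<lambda>j. (T j [^] (i ^ (p - 1 - j))) [^] i) {..<p - 1}"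
        unfolding e_def by (rule fp) (use TVp in auto)
      also have "\<dots> = finprod ?V F {..<p - 1}"
      proof (rule VV.finprod_cong')
        fix j assume "j \<in> {..<p - 1}"
        then have "p - j = Suc (p - 1 - j)" by auto
        then have "i ^ (p - 1 - j) * i = i ^ (p - j)" by simp
        then show "(T j [^] (i ^ (p - 1 - j))) [^] i = F j" using VG[OF TV] by (simp add: F_def nat_pow_pow)
      qed (use FV in auto)
      finally show ?thesis by simp
    qed
    finally show ?thesis .
  qed
  have "\<exists>i<p. e i \<noteq> \<one>"
  proof (rule ccontr)
    assume "\<not> (\<exists>i<p. e i \<noteq> \<one>)"
    then have e1: "e i = \<one>" if "i < p" for i using that by blast
    have sums: "finprod ?V (\<lambda>j. T j [^] (\<Sum>i\<in>{..<n}. i ^ (p - 1 - j))) {..<p - 1} = \<one>" if "n \<le> p" for n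
      using that
    proof (induction n)
      case 0 then show ?case using VV.finprod_one_eqI[of "{..<p - 1}"] by simp
    next
      case (Suc n)
      have "finprod ?V (\<lambda>j. T j [^] (\<Sum>i\<in>{..<Suc n}. i ^ (p - 1 - j))) {..<p - 1} =
         finprod ?V (\<lambda>j. T j [^] (\<Sum>i\<in>{..<n}. i ^ (p - 1 - j)) \<otimes>\<^bsub>?V\<^esub> T j [^] (n ^ (p - 1 - j))) {..<p - 1}"
        using VG[OF TV] TVp by (intro VV.finprod_cong') (auto simp: nat_pow_mult subgroup.m_closed[OF V(1)])
      also have "\<dots> = finprod ?V (\<lambda>j. T j [^] (\<Sum>i\<in>{..<n}. i ^ (p - 1 - j))) {..<p - 1} \<otimes>\<^bsub>?V\<^esub> e n"
        unfolding e_def using TVp by (intro VV.finprod_multf) auto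
      also have "\<dots> = \<one>" using Suc e1[of n] by simp
      finally show ?case .
    qed
    have "finprod ?V (\<lambda>j. T j [^] (\<Sum>i\<in>{..<p}. i ^ (p - 1 - j))) {..<p - 1} =
        finprod ?V (\<lambda>j. if 0 = j then v [^] (p - 1) else \<one>) {..<p - 1}"
    proof (rule VV.finprod_cong')
      fix j assume j: "j \<in> {..<p - 1}"
      show "T j [^] (\<Sum>i\<in>{..<p}. i ^ (p - 1 - j)) = (if 0 = j then v [^] (p - 1) else \<one>)"
      proof (cases "j = 0")
        case True
        have "T 0 = v" using VG[OF v(1)] by (simp add: T_def)
        then show ?thesis
          unfolding True diff_zero by (simp only: pow_cong[OF VG[OF v(1)] ex[OF v(1)] power_sum_last[OF p]] if_True refl)
      next
        case False
        then have "p dvd (\<Sum>i\<in>{..<p}. i ^ (p - 1 - j))" using j by (intro power_sum_dvd p) auto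
        then have "[(\<Sum>i\<in>{..<p}. i ^ (p - 1 - j)) = 0] (mod p)" by (simp add: cong_0_iff)
        then show ?thesis using pow_cong[OF VG[OF TV] ex[OF TV], of _ 0 j] False by simp
      qed
    qed (use subgroup_pow[OF V(1) v(1)] subgroup.one_closed[OF V(1)] in auto)
    also have "\<dots> = v [^] (p - 1)"
    proof -
      have one: "\<one>\<^bsub>?V\<^esub> = \<one>" by simp
      show ?thesis
        by (rule VV.finprod_singleton[of 0 "{..<p - 1}" "\<lambda>_. v [^] (p - 1)", unfolded one])
          (use p1 subgroup_pow[OF V(1) v(1)] in auto)
    qed
    finally have "v [^] (p - 1) = \<one>" using sums[of p] by simp
    moreover have "v [^] p = v [^] (p - 1) \<otimes> v" using p1 by (cases p) auto
    ultimately show False using ex[OF v(1)] v VG by simp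
  qed
  then obtain i where "e i \<noteq> \<one>" by blast
  then show ?thesis using that[OF eV _ eig] by blast
qed

subsection \<open>Minimal normal \<open>p\<close>-subgroups\<close>

lemma prime_order_pow:
  assumes p: "prime p" and L: "subgroup L G" "card L = p" and x: "x \<in> L" "x \<noteq> \<one>" and z: "z \<in> L"
  obtains n where "z = x [^] (n::nat)"
proof -
  have xG: "x \<in> carrier G" using L x subgroup.mem_carrier by fast
  have xp: "x [^] p = \<one>" using pow_card_subgroup[OF L(1) _ x(1)] L by simp
  have inj: "inj_on (\<lambda>n::nat. x [^] n) {..<p}"
  proof (rule inj_onI)
    have *: "m = n" if mn: "m \<le> n" "n < p" "x [^] m = x [^] n" for m n :: nat
    proof (rule ccontr)
      assume "m \<noteq> n"
      then have nm: "0 < n - m" "n - m < p" using mn by auto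
      have "x [^] m \<otimes> x [^] (n - m) = x [^] (m + (n - m))" by (rule nat_pow_mult[OF xG])
      then have "x [^] m \<otimes> x [^] (n - m) = x [^] m" using mn by simp
      then have "x [^] (n - m) = \<one>" using xG by (simp add: l_cancel_one')
      moreover have "\<not> p dvd n - m" using nm nat_dvd_not_less by auto
      then have "coprime (n - m) p" using prime_imp_coprime[OF p] coprime_commute by blast
      ultimately have "x \<in> {\<one>}"
        using mem_of_coprime_pow_mem[OF triv_subgroup xG, of "n - m" p] xp by simp
      then show False using x by simp
    qed
    show "m = n" if "m \<in> {..<p}" "n \<in> {..<p}" "x [^] m = x [^] n" for m n :: nat
    proof (cases "m \<le> n")
      case True then show ?thesis using *[of m n] that by blast
    next
      case False then show ?thesis using *[of n m] that by fastforce
    qed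
  qed
  have "(\<lambda>n::nat. x [^] n) ` {..<p} = L"
  proof (rule card_subset_eq)
    show "card ((\<lambda>n::nat. x [^] n) ` {..<p}) = card L" unfolding card_image[OF inj] using L by simp
    show "(\<lambda>n::nat. x [^] n) ` {..<p} \<subseteq> L" using subgroup_pow[OF L(1) x(1)] by blast
  qed (use L in simp)
  then show ?thesis using z that by blast
qed

text \<open>On a group of prime order every conjugation is a power map. Power maps commute, and by
  Fermat their \<open>(p - 1)\<close>-st iterate is trivial.\<close>

lemma normal_prime_order_action:
  fixes p :: nat
  assumes p: "prime p" and L: "L \<lhd> G" "card L = p" and g: "g \<in> carrier G" and h: "h \<in> carrier G" and z: "z \<in> L"
  shows "conjug (g \<otimes> h) z = conjug (h \<otimes> g) z" and "conjug (g [^] (p - 1)) z = z"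
proof -
  have Ls: "subgroup L G" using L(1) by (rule normal_imp_subgroup)
  have LG: "u \<in> carrier G" if "u \<in> L" for u using that Ls subgroup.mem_carrier by fast
  have "L \<noteq> {\<one>}" using L(2) prime_gt_1_nat[OF p] by auto
  then obtain x where x: "x \<in> L" "x \<noteq> \<one>" using subgroup.one_closed[OF Ls] by blast
  have act: "\<exists>i::nat. \<forall>u\<in>L. conjug g u = u [^] i" if g: "g \<in> carrier G" for g
  proof -
    obtain i where i: "conjug g x = x [^] (i::nat)"
      using prime_order_pow[OF p Ls L(2) x] normal_conjug[OF L(1) g x(1)] by blast
    have "conjug g u = u [^] i" if u: "u \<in> L" for u
    proof -
      obtain n where n: "u = x [^] (n::nat)" using prime_order_pow[OF p Ls L(2) x u] .
      have "conjug g u = (x [^] i) [^] n" using g LG[OF x(1)] by (simp add: n conjug_pow i)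
      also have "\<dots> = u [^] i" using LG[OF x(1)] by (simp add: n nat_pow_pow mult.commute)
      finally show ?thesis .
    qed
    then show ?thesis by blast
  qed
  obtain i where i: "\<forall>u\<in>L. conjug g u = u [^] (i::nat)" using act[OF g] by blast
  obtain j where j: "\<forall>u\<in>L. conjug h u = u [^] (j::nat)" using act[OF h] by blast
  have zG: "z \<in> carrier G" using z LG by simp
  have "conjug (g \<otimes> h) z = z [^] (j * i)"
    using i j z g h zG subgroup_pow[OF Ls z] by (simp add: nat_pow_pow flip: conjug_conjug)
  moreover have "conjug (h \<otimes> g) z = z [^] (i * j)"
    using i j z g h zG subgroup_pow[OF Ls z] by (simp add: nat_pow_pow flip: conjug_conjug)
  ultimately show "conjug (g \<otimes> h) z = conjug (h \<otimes> g) z" by (simp add: mult.commute)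
  have it: "conjug (g [^] n) z = z [^] (i ^ n)" for n :: nat
  proof (induction n)
    case (Suc n)
    have "conjug (g [^] Suc n) z = conjug g (conjug (g [^] n) z)"
      unfolding nat_pow_Suc2[OF g] using g zG by (simp add: conjug_conjug)
    also have "\<dots> = z [^] (i ^ n * i)" using Suc i subgroup_pow[OF Ls z] zG by (simp add: nat_pow_pow)
    finally show ?case by (simp add: mult.commute)
  qed (use zG in simp)
  have xp: "u [^] p = \<one>" if "u \<in> L" for u using pow_card_subgroup[OF Ls _ that] L Ls by simp
  have "\<not> p dvd i"
  proof
    assume "p dvd i"
    then obtain r where "i = p * r" by auto
    then have "conjug g x = (x [^] p) [^] r" using i x LG[OF x(1)] by (simp add: nat_pow_pow)
    then have "conjug g x = conjug g \<one>" using xp[OF x(1)] g by simp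
    then show False using conjug_inject[OF g LG[OF x(1)] one_closed] x by blast
  qed
  then have "[i ^ (p - 1) = 1] (mod p)" using fermat_theorem[OF p] by blast
  then show "conjug (g [^] (p - 1)) z = z"
    using it pow_cong[OF zG xp[OF z]] zG by (metis nat_pow_eone)
qed

text \<open>\<open>frat p V\<close> is normal in \<open>G\<close> and proper in \<open>V\<close>,
  hence trivial by minimality.\<close>

lemma min_normal_elementary:
  assumes V: "minimal_normal_subgroup G V" and p: "prime p" "card V = p ^ k"
  shows "a \<in> V \<Longrightarrow> b \<in> V \<Longrightarrow> a \<otimes> b = b \<otimes> a" and "a \<in> V \<Longrightarrow> a [^] p = \<one>"
proof -
  have Vn: "V \<lhd> G" "V \<noteq> {\<one>}" using V by (auto simp: minimal_normal_subgroup_def)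
  have Vs: "subgroup V G" using Vn(1) by (rule normal_imp_subgroup)
  have VG: "u \<in> carrier G" if "u \<in> V" for u using that Vs subgroup.mem_carrier by fast
  have "frat p V \<lhd> G"
    using frat_subgroup[OF Vs] frat_conjug[OF Vs] normal_conjug[OF Vn(1)] by (intro normalI_conjug) auto
  then have F: "frat p V = {\<one>}"
    using V frat_subset[OF Vs] frat_proper[OF p(1) Vs p(2) Vn(2)] unfolding minimal_normal_subgroup_def by blast
  show "a [^] p = \<one>" if "a \<in> V" using pow_in_frat[OF that, of p] F by simp
  show "a \<otimes> b = b \<otimes> a" if "a \<in> V" "b \<in> V"
  proof -
    have "conjug a b \<otimes> inv b = \<one>" using commutator_in_frat[OF that, of p] F by (simp add: conjug_def)
    then have "conjug a b = b" using VG that by (metis conjug_closed inv_closed inv_equality inv_inv)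
    then show ?thesis using conjug_eq_iff_commute VG that by simp
  qed
qed

text \<open>\<open>R\<close> acts on \<open>V\<close> as a \<open>p\<close>-group: it is the product
  of the centralizer of \<open>V\<close> in \<open>R\<close> and a Sylow \<open>p\<close>-subgroup,
  and the latter has a nontrivial fixed point. The points fixed by \<open>R\<close> form a normal
  subgroup because \<open>R\<close> is normal, so they are all of \<open>V\<close>.\<close>

lemma min_normal_fixed:
  assumes V: "minimal_normal_subgroup G V" and p: "prime p" "card V = p ^ k"
    and R: "R \<lhd> G" and act: "\<And>r. r \<in> R \<Longrightarrow> \<exists>a. \<forall>v\<in>V. conjug (r [^] (p ^ a)) v = v"
    and r: "r \<in> R" and v: "v \<in> V"
  shows "conjug r v = v"
proof -
  have Vn: "V \<lhd> G" "V \<noteq> {\<one>}" using V by (auto simp: minimal_normal_subgroup_def)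
  have Vs: "subgroup V G" using Vn(1) by (rule normal_imp_subgroup)
  have Rs: "subgroup R G" using R by (rule normal_imp_subgroup)
  have VG: "u \<in> carrier G" if "u \<in> V" for u using that Vs subgroup.mem_carrier by fast
  have RG: "u \<in> carrier G" if "u \<in> R" for u using that Rs subgroup.mem_carrier by fast
  let ?C = "{g \<in> R. \<forall>v\<in>V. conjug g v = v}"
  have C: "subgroup ?C G" using centralizer_subgroup[OF Rs] VG by blast
  have "?C \<subseteq> R" by auto
  have el: "\<exists>a. g [^] (p ^ a) \<in> ?C" if g: "g \<in> R" for g
    using act[OF g] subgroup_pow[OF Rs g] by blast
  obtain a where a: "card R = p ^ a * card ?C"
    using index_p_power[OF Rs p(1) C \<open>?C \<subseteq> R\<close> el] by blast
  obtain S where S: "sylow_in p R S" using sylow_ex[OF Rs p(1)] .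
  have S': "subgroup S G" "S \<subseteq> R" using S by (auto simp: sylow_in_def)
  obtain j where j: "card S = p ^ j" using S by (auto simp: sylow_in_def)
  have SV: "conjug s v \<in> V" if "s \<in> S" "v \<in> V" for s v
    using that S' RG normal_conjug[OF Vn(1)] by blast
  obtain w where w: "w \<in> V" "w \<noteq> \<one>" "\<forall>s\<in>S. conjug s w = w"
    using p_group_fixes[OF S'(1) j p(1) Vs p(2) Vn(2) SV] .
  let ?W = "{v \<in> V. \<forall>r\<in>R. conjug r v = v}"
  have "w \<in> ?W"
  proof -
    have "conjug r w = w" if r: "r \<in> R" for r
    proof -
      obtain c s where cs: "c \<in> ?C" "s \<in> S" "r = c \<otimes> s"
        using sylow_factor[OF Rs p(1) S C \<open>?C \<subseteq> R\<close> a r] .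
      then have "c \<in> carrier G" "s \<in> carrier G" using RG S' by auto
      then have "conjug r w = conjug c (conjug s w)" using VG[OF w(1)] by (simp add: cs(3) conjug_conjug)
      then show ?thesis using cs w by simp
    qed
    then show ?thesis using w by simp
  qed
  moreover have "?W \<lhd> G"
  proof (rule normalI_conjug)
    show "subgroup ?W G"
    proof (rule subgroupI)
      show "?W \<subseteq> carrier G" using VG by auto
      show "?W \<noteq> {}" using \<open>w \<in> ?W\<close> by blast
      show "inv a \<in> ?W" if "a \<in> ?W" for a
        using that Vs VG RG by (auto simp: subgroup.m_inv_closed conjug_inv)
      show "a \<otimes> b \<in> ?W" if "a \<in> ?W" "b \<in> ?W" for a b
        using that Vs VG RG by (auto simp: subgroup.m_closed conjug_mult)
    qed
    fix g u assume g: "g \<in> carrier G" and u: "u \<in> ?W"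
    have uG: "u \<in> carrier G" using u VG by simp
    have "conjug r (conjug g u) = conjug g u" if r: "r \<in> R" for r
    proof -
      have rr: "conjug (inv g) r \<in> R" using normal_conjug[OF R _ r] g by simp
      then have "conjug g u = conjug g (conjug (conjug (inv g) r) u)" using u by simp
      also have "\<dots> = conjug (conjug g (conjug (inv g) r)) (conjug g u)"
        using g uG RG[OF rr] by (simp add: conjug_distrib)
      also have "conjug g (conjug (inv g) r) = r" using g RG[OF r] by simp
      finally show ?thesis by simp
    qed
    then show "conjug g u \<in> ?W" using u normal_conjug[OF Vn(1) g] by simp
  qed
  ultimately have "?W = V" using V w(2) unfolding minimal_normal_subgroup_def by blast
  then show ?thesis using r v by blast
qed

text \<open>Each \<open>g\<close> has an eigenvector, and its eigenspace is normal because the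
  induced action is abelian; so \<open>g\<close> acts as a power map on all of \<open>V\<close>.
  Then the powers of any \<open>v\<close> form a normal subgroup, and \<open>V\<close> is cyclic of
  exponent \<open>p\<close>.\<close>

lemma min_normal_prime_order:
  assumes V: "minimal_normal_subgroup G V" and p: "prime p" "card V = p ^ k"
    and com: "\<And>g h v. g \<in> carrier G \<Longrightarrow> h \<in> carrier G \<Longrightarrow> v \<in> V \<Longrightarrow> conjug (g \<otimes> h) v = conjug (h \<otimes> g) v"
    and ex: "\<And>g v. g \<in> carrier G \<Longrightarrow> v \<in> V \<Longrightarrow> conjug (g [^] (p - 1)) v = v"
  shows "card V = p"
proof -
  have Vn: "V \<lhd> G" "V \<noteq> {\<one>}" using V by (auto simp: minimal_normal_subgroup_def)
  have Vs: "subgroup V G" using Vn(1) by (rule normal_imp_subgroup)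
  have VG: "u \<in> carrier G" if "u \<in> V" for u using that Vs subgroup.mem_carrier by fast
  note elem = min_normal_elementary[OF V p]
  have scal: "\<exists>i::nat. \<forall>v\<in>V. conjug g v = v [^] i" if g: "g \<in> carrier G" for g
  proof -
    obtain v i where v: "v \<in> V" "v \<noteq> \<one>" "conjug g v = v [^] (i::nat)"
      using eigenvector_exists[OF p(1) Vs Vn(2) elem g normal_conjug[OF Vn(1) g] ex[OF g]] .
    let ?W = "{v \<in> V. conjug g v = v [^] i}"
    have "?W \<lhd> G"
    proof (rule normalI_conjug)
      show "subgroup ?W G"
      proof (rule subgroupI)
        show "?W \<subseteq> carrier G" using VG by auto
        show "?W \<noteq> {}" using v by blast
        show "inv a \<in> ?W" if "a \<in> ?W" for a
          using that Vs VG g by (auto simp: subgroup.m_inv_closed conjug_inv nat_pow_inv)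
        show "a \<otimes> b \<in> ?W" if "a \<in> ?W" "b \<in> ?W" for a b
          using that Vs VG g elem(1) by (auto simp: subgroup.m_closed conjug_mult pow_mult_distrib)
      qed
      fix h u assume h: "h \<in> carrier G" and u: "u \<in> ?W"
      have uG: "u \<in> carrier G" using u VG by simp
      have "conjug g (conjug h u) = conjug (h \<otimes> g) u" using com[OF g h] u uG g h by (simp add: conjug_conjug)
      also have "\<dots> = conjug h (u [^] i)" using u uG g h by (simp flip: conjug_conjug)
      finally show "conjug h u \<in> ?W" using u uG h normal_conjug[OF Vn(1) h] by (simp add: conjug_pow)
    qed
    then have "?W = V" using V v unfolding minimal_normal_subgroup_def by blast
    then show ?thesis by blast
  qed
  obtain v where v: "v \<in> V" "v \<noteq> \<one>" using Vn(2) subgroup.one_closed[OF Vs] by blast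
  have vG: "v \<in> carrier G" using v VG by simp
  have inv_pow: "inv v = v [^] (p - 1)"
  proof -
    have "v [^] (p - 1) \<otimes> v = \<one>" using elem(2)[OF v(1)] prime_gt_1_nat[OF p(1)] by (cases p) auto
    then show ?thesis using vG by (simp add: inv_equality)
  qed
  let ?Z = "{v [^] n |n::nat. True}"
  have "?Z \<lhd> G"
  proof (rule normalI_conjug)
    show "subgroup ?Z G"
    proof (rule subgroupI)
      show "?Z \<subseteq> carrier G" using vG by auto
      show "inv a \<in> ?Z" if a: "a \<in> ?Z" for a
      proof -
        obtain n where "a = v [^] (n::nat)" using a by auto
        then have "inv a = v [^] ((p - 1) * n)" using vG by (simp add: nat_pow_inv[symmetric] inv_pow nat_pow_pow)
        then show ?thesis by blast
      qed
      show "a \<otimes> b \<in> ?Z" if ab: "a \<in> ?Z" "b \<in> ?Z" for a b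
      proof -
        obtain m n where "a = v [^] (m::nat)" "b = v [^] (n::nat)" using ab by auto
        then have "a \<otimes> b = v [^] (m + n)" using vG by (simp add: nat_pow_mult)
        then show ?thesis by blast
      qed
    qed auto
    fix g u assume g: "g \<in> carrier G" and u: "u \<in> ?Z"
    then obtain n where n: "u = v [^] (n::nat)" by auto
    obtain i where "\<forall>v\<in>V. conjug g v = v [^] (i::nat)" using scal[OF g] by blast
    then have "conjug g u = v [^] (n * i)" using n subgroup_pow[OF Vs v(1)] vG by (simp add: nat_pow_pow)
    then show "conjug g u \<in> ?Z" by blast
  qed
  moreover have "?Z \<subseteq> V" using subgroup_pow[OF Vs v(1)] by auto
  moreover have "v [^] (1::nat) \<in> ?Z" by blast
  then have "?Z \<noteq> {\<one>}" using v vG by auto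
  ultimately have ZV: "?Z = V" using V unfolding minimal_normal_subgroup_def by blast
  have "V \<subseteq> (\<lambda>n::nat. v [^] n) ` {..<p}"
  proof
    fix u assume "u \<in> V"
    then obtain n where "u = v [^] (n::nat)" using ZV by blast
    then have "u = v [^] (n mod p)" using pow_cong[OF vG elem(2)[OF v(1)], of n "n mod p"] by (simp add: cong_def)
    then show "u \<in> (\<lambda>n::nat. v [^] n) ` {..<p}" using prime_gt_1_nat[OF p(1)] by (intro image_eqI[of _ _ "n mod p"]) auto
  qed
  then have "card V \<le> card {..<p}" by (rule surj_card_le[rotated]) simp
  then have "p ^ k \<le> p ^ 1" using p by simp
  then have "k \<le> 1" using prime_gt_1_nat[OF p(1)] by (metis power_increasing_iff)
  moreover have "k \<noteq> 0"
  proof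
    assume "k = 0"
    then have "card V = 1" using p by simp
    then show False using v subgroup.one_closed[OF Vs] by (metis card_1_singletonE singletonD)
  qed
  ultimately have "k = 1" by simp
  then show ?thesis using p by simp
qed

subsection \<open>Chief factors\<close>

lemma mod_fin_group: "K \<lhd> G \<Longrightarrow> fin_group (G Mod K)"
  using fin by (intro fin_group.intro fin_group_axioms.intro normal.factorgroup_is_group)
    (simp_all add: carrier_FactGroup)

lemma mod_hom: "K \<lhd> G \<Longrightarrow> group_hom G (G Mod K) (\<lambda>x. K #> x)"
  by (intro group_hom.intro group_hom_axioms.intro is_group normal.factorgroup_is_group normal.r_coset_hom_Mod)

lemma conjug_mod:
  assumes "K \<lhd> G" "g \<in> carrier G" "x \<in> carrier G"
  shows "group.conjug (G Mod K) (K #> g) (K #> x) = K #> conjug g x"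
proof -
  interpret H: group_hom G "G Mod K" "\<lambda>x. K #> x" using assms(1) by (rule mod_hom)
  show ?thesis
    unfolding H.H.conjug_def conjug_def using assms(2,3) by (simp del: mult_FactGroup)
qed

text \<open>Triviality of an action on a coset of \<open>K\<close> is expressed by
  \<open>conjug g x \<otimes> inv x \<in> K\<close> from here on, so that later arguments compute in
  \<open>G\<close> without carrying \<open>G Mod K\<close>.\<close>

lemma mod_fixed_iff:
  assumes "K \<lhd> G" "g \<in> carrier G" "x \<in> carrier G"
  shows "group.conjug (G Mod K) (K #> g) (K #> x) = K #> x \<longleftrightarrow> conjug g x \<otimes> inv x \<in> K"
  using assms conjug_mod coset_eq_iff[OF normal_imp_subgroup[OF assms(1)]] by simp

lemma mod_pow:
  assumes "K \<lhd> G" "x \<in> carrier G"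
  shows "K #> (x [^] (n::nat)) = (K #> x) [^]\<^bsub>G Mod K\<^esub> n"
  using group_hom.hom_nat_pow[OF mod_hom[OF assms(1)] assms(2)] .

lemma mod_mult:
  assumes "K \<lhd> G" "x \<in> carrier G" "y \<in> carrier G"
  shows "K #> (x \<otimes> y) = (K #> x) \<otimes>\<^bsub>G Mod K\<^esub> (K #> y)"
  using group_hom.hom_mult[OF mod_hom[OF assms(1)] assms(2,3)] .

lemma mod_image_normal:
  assumes "K \<lhd> G" "L \<lhd> G"
  shows "(\<lambda>x. K #> x) ` L \<lhd> G Mod K"
  by (rule normal.surj_hom_normal_subgroup[OF assms(2) mod_hom[OF assms(1)]]) (simp add: carrier_FactGroup)

lemma mod_preimage_normal:
  assumes K: "K \<lhd> G" and A: "A \<lhd> G Mod K"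
  shows "{x \<in> carrier G. K #> x \<in> A} \<lhd> G"
proof (rule normalI_conjug)
  interpret H: group_hom G "G Mod K" "\<lambda>x. K #> x" using K by (rule mod_hom)
  have As: "subgroup A (G Mod K)" using A by (rule normal_imp_subgroup)
  show "subgroup {x \<in> carrier G. K #> x \<in> A} G"
  proof (rule subgroupI)
    have "K #> \<one> \<in> A" using H.hom_one subgroup.one_closed[OF As] by (simp del: one_FactGroup)
    then show "{x \<in> carrier G. K #> x \<in> A} \<noteq> {}" by blast
    show "inv a \<in> {x \<in> carrier G. K #> x \<in> A}" if "a \<in> {x \<in> carrier G. K #> x \<in> A}" for a
      using that As by (simp add: subgroup.m_inv_closed)
    show "a \<otimes> b \<in> {x \<in> carrier G. K #> x \<in> A}"
      if "a \<in> {x \<in> carrier G. K #> x \<in> A}" "b \<in> {x \<in> carrier G. K #> x \<in> A}" for a b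
      using that subgroup.m_closed[OF As] mod_mult[OF K] by (simp del: mult_FactGroup)
  qed auto
  show "conjug g x \<in> {x \<in> carrier G. K #> x \<in> A}"
    if "g \<in> carrier G" "x \<in> {x \<in> carrier G. K #> x \<in> A}" for g x
    using that H.H.normal_conjug[OF A, of "K #> g" "K #> x"] conjug_mod[OF K] by simp
qed

lemma carrier_subquotient: "carrier (subquotient G L K) = (\<lambda>x. K #> x) ` L"
  by (simp add: subquotient_def carrier_FactGroup)

lemma mod_image_mem:
  assumes "K \<lhd> G" "subgroup L G" "K \<subseteq> L" "x \<in> carrier G" "K #> x \<in> (\<lambda>x. K #> x) ` L"
  shows "x \<in> L"
proof -
  have Ks: "subgroup K G" using assms(1) by (rule normal_imp_subgroup)
  obtain a where a: "a \<in> L" "K #> x = K #> a" using assms(5) by auto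
  have aG: "a \<in> carrier G" using a assms(2) subgroup.mem_carrier by fast
  have "x \<otimes> inv a \<in> L" using coset_eq_iff[OF Ks assms(4) aG] a assms(3) by auto
  then have "(x \<otimes> inv a) \<otimes> a \<in> L" using subgroup.m_closed[OF assms(2)] a by blast
  then show ?thesis using assms(4) aG by (simp add: m_assoc)
qed

lemma chief_factor_iff:
  "chief_factor G L K \<longleftrightarrow> K \<lhd> G \<and> L \<lhd> G \<and> K \<subset> L \<and>
     (\<forall>A. A \<lhd> G \<longrightarrow> K \<subseteq> A \<longrightarrow> A \<subseteq> L \<longrightarrow> A = K \<or> A = L)"
proof (intro iffI conjI allI impI; (elim conjE)?)
  assume ch: "chief_factor G L K"
  then show K: "K \<lhd> G" and L: "L \<lhd> G" by (auto simp: chief_factor_def)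
  have KL: "K \<subseteq> L" using ch by (simp add: chief_factor_def)
  have min: "minimal_normal_subgroup (G Mod K) ((\<lambda>x. K #> x) ` L)"
    using ch by (simp add: chief_factor_def carrier_subquotient)
  have Ks: "subgroup K G" using K by (rule normal_imp_subgroup)
  have Ls: "subgroup L G" using L by (rule normal_imp_subgroup)
  have "K #> x = K" if "x \<in> K" for x using coset_join2[OF subgroup.mem_carrier[OF Ks that] Ks that] .
  then have KK: "(\<lambda>x. K #> x) ` K = {K}" using subgroup.one_closed[OF Ks] by auto
  show "K \<subset> L" using min KK KL by (auto simp: minimal_normal_subgroup_def)
  fix A assume A: "A \<lhd> G" "K \<subseteq> A" "A \<subseteq> L"
  have As: "subgroup A G" using A(1) by (rule normal_imp_subgroup)
  have "(\<lambda>x. K #> x) ` A = {K} \<or> (\<lambda>x. K #> x) ` A = (\<lambda>x. K #> x) ` L"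
    using min mod_image_normal[OF K A(1)] image_mono[OF A(3), of "\<lambda>x. K #> x"] by (simp add: minimal_normal_subgroup_def)
  then show "A = K \<or> A = L"
  proof
    assume "(\<lambda>x. K #> x) ` A = {K}"
    then have "K #> a = K" if "a \<in> A" for a using that by blast
    then have "a \<in> K" if "a \<in> A" for a
      using coset_join1[OF _ subgroup.mem_carrier[OF As that] Ks] that by blast
    then show ?thesis using A by blast
  next
    assume "(\<lambda>x. K #> x) ` A = (\<lambda>x. K #> x) ` L"
    then have "x \<in> A" if "x \<in> L" for x
      using mod_image_mem[OF K As A(2), of x] that subgroup.mem_carrier[OF Ls] by blast
    then show ?thesis using A by blast
  qed
next
  assume K: "K \<lhd> G" and L: "L \<lhd> G" and KL: "K \<subset> L"
    and m: "\<forall>A. A \<lhd> G \<longrightarrow> K \<subseteq> A \<longrightarrow> A \<subseteq> L \<longrightarrow> A = K \<or> A = L"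
  have Ks: "subgroup K G" using K by (rule normal_imp_subgroup)
  have Ls: "subgroup L G" using L by (rule normal_imp_subgroup)
  have "K #> x = K" if "x \<in> K" for x using coset_join2[OF subgroup.mem_carrier[OF Ks that] Ks that] .
  then have KK: "(\<lambda>x. K #> x) ` K = {K}" using subgroup.one_closed[OF Ks] by auto
  have "(\<lambda>x. K #> x) ` L \<noteq> {K}"
  proof
    assume "(\<lambda>x. K #> x) ` L = {K}"
    then have "K #> a = K" if "a \<in> L" for a using that by blast
    then have "a \<in> K" if "a \<in> L" for a
      using coset_join1[OF _ subgroup.mem_carrier[OF Ls that] Ks] that by blast
    then show False using KL by blast
  qed
  moreover have "A = {K} \<or> A = (\<lambda>x. K #> x) ` L"
    if A: "A \<lhd> G Mod K" "A \<subseteq> (\<lambda>x. K #> x) ` L" for A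
  proof -
    let ?B = "{x \<in> carrier G. K #> x \<in> A}"
    have "K \<in> A" using subgroup.one_closed[OF normal_imp_subgroup[OF A(1)]] by simp
    then have "K \<subseteq> ?B" using coset_join2[OF _ Ks] subgroup.mem_carrier[OF Ks] by auto
    moreover have "?B \<subseteq> L" using mod_image_mem[OF K Ls] KL A(2) by blast
    ultimately have "?B = K \<or> ?B = L" using m mod_preimage_normal[OF K A(1)] by blast
    moreover have "A = (\<lambda>x. K #> x) ` ?B"
      using subgroup.subset[OF normal_imp_subgroup[OF A(1)]] by (auto simp: carrier_FactGroup)
    ultimately show ?thesis using KK by auto
  qed
  ultimately show "chief_factor G L K"
    using K L KL mod_image_normal[OF K L]
    by (auto simp: chief_factor_def minimal_normal_subgroup_def carrier_subquotient)
qed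

lemma mod_image_p_power:
  fixes p j :: nat
  assumes K: "K \<lhd> G" and p: "prime p" and S: "subgroup S G" "card S = p ^ j"
  shows "\<exists>i. card ((\<lambda>x. K #> x) ` S) = p ^ i"
proof -
  interpret Q: fin_group "G Mod K" using K by (rule mod_fin_group)
  have Ks: "subgroup K G" using K by (rule normal_imp_subgroup)
  have Ssub: "subgroup ((\<lambda>x. K #> x) ` S) (G Mod K)"
    using group_hom.subgroup_img_is_subgroup[OF mod_hom[OF K] S(1)] .
  have el: "\<exists>a. g [^]\<^bsub>G Mod K\<^esub> (p ^ a) \<in> {\<one>\<^bsub>G Mod K\<^esub>}" if g: "g \<in> (\<lambda>x. K #> x) ` S" for g
  proof -
    obtain s where s: "s \<in> S" "g = K #> s" using g by auto
    have "s [^] (p ^ j) = \<one>" using pow_card_subgroup[OF S(1) _ s(1)] S by simp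
    then have "g [^]\<^bsub>G Mod K\<^esub> (p ^ j) = K"
      using mod_pow[OF K subgroup.mem_carrier[OF S(1) s(1)], of "p ^ j"] s Ks
      by (simp add: subgroup.subset)
    then show ?thesis by auto
  qed
  obtain i where "card ((\<lambda>x. K #> x) ` S) = p ^ i * card {\<one>\<^bsub>G Mod K\<^esub>}"
    using Q.index_p_power[OF Ssub p Q.triv_subgroup _ el] subgroup.one_closed[OF Ssub] by auto
  then show ?thesis by auto
qed

section \<open>One chief factor: facts on its quotient restated in \<open>G\<close>\<close>

context
  fixes N K assumes ch: "chief_factor G N K"
begin

lemma chief_normal: "N \<lhd> G" "K \<lhd> G" and chief_psubset: "K \<subset> N"
  and chief_between: "A \<lhd> G \<Longrightarrow> K \<subseteq> A \<Longrightarrow> A \<subseteq> N \<Longrightarrow> A = K \<or> A = N"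
  using ch by (auto simp: chief_factor_iff)

lemma chief_subgroups: "subgroup N G" "subgroup K G"
  using chief_normal normal_imp_subgroup by auto

lemma chief_carrier: "x \<in> N \<Longrightarrow> x \<in> carrier G" "x \<in> K \<Longrightarrow> x \<in> carrier G"
  using chief_subgroups subgroup.mem_carrier by fast+

lemma chief_min_normal: "minimal_normal_subgroup (G Mod K) ((\<lambda>x. K #> x) ` N)"
  using ch by (simp add: chief_factor_def carrier_subquotient)

lemma chief_card: "card ((\<lambda>x. K #> x) ` N) * card K = card N"
  using lagrange_sub[OF chief_subgroups(2,1)] chief_psubset by blast

lemma chief_card_eq: "card N = m * card K \<Longrightarrow> card ((\<lambda>x. K #> x) ` N) = m"
  using chief_card card_sub_pos[OF chief_subgroups(2)] by simp

lemma chief_prime_action: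
  fixes p :: nat
  assumes p: "prime p" "card N = p * card K"
    and g: "g \<in> carrier G" and h: "h \<in> carrier G" and z: "z \<in> N"
  shows "conjug (g \<otimes> h) z \<otimes> inv (conjug (h \<otimes> g) z) \<in> K"
    and "conjug (g [^] (p - 1)) z \<otimes> inv z \<in> K"
proof -
  interpret Q: fin_group "G Mod K" using chief_normal(2) by (rule mod_fin_group)
  have c: "card ((\<lambda>x. K #> x) ` N) = p" using chief_card_eq p(2) .
  have car: "K #> x \<in> carrier (G Mod K)" if "x \<in> carrier G" for x using that by (simp add: carrier_FactGroup)
  have zG: "z \<in> carrier G" using z chief_carrier by simp
  have zN: "K #> z \<in> (\<lambda>x. K #> x) ` N" using z by blast
  note act = Q.normal_prime_order_action[OF p(1) mod_image_normal[OF chief_normal(2,1)] c car[OF g] car[OF h] zN]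
  have "K #> conjug (g \<otimes> h) z = K #> conjug (h \<otimes> g) z"
    using act(1) g h zG conjug_mod[OF chief_normal(2)] mod_mult[OF chief_normal(2)]
    by (metis m_closed)
  then show "conjug (g \<otimes> h) z \<otimes> inv (conjug (h \<otimes> g) z) \<in> K"
    using coset_eq_iff[OF chief_subgroups(2)] g h zG by simp
  show "conjug (g [^] (p - 1)) z \<otimes> inv z \<in> K"
    using act(2) mod_fixed_iff[OF chief_normal(2) nat_pow_closed[OF g] zG] mod_pow[OF chief_normal(2) g]
    by metis
qed

lemma chief_elementary:
  fixes p k :: nat
  assumes p: "prime p" "card N = p ^ k * card K"
  shows "a \<in> N \<Longrightarrow> b \<in> N \<Longrightarrow> a \<otimes> b \<otimes> inv a \<otimes> inv b \<in> K"
    and "a \<in> N \<Longrightarrow> a [^] p \<in> K"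
proof -
  interpret Q: fin_group "G Mod K" using chief_normal(2) by (rule mod_fin_group)
  have c: "card ((\<lambda>x. K #> x) ` N) = p ^ k" using chief_card_eq p(2) .
  note elem = Q.min_normal_elementary[OF chief_min_normal p(1) c]
  show "a \<otimes> b \<otimes> inv a \<otimes> inv b \<in> K" if ab: "a \<in> N" "b \<in> N"
  proof -
    have abG: "a \<in> carrier G" "b \<in> carrier G" using ab chief_carrier by auto
    have "K #> (a \<otimes> b) = K #> (b \<otimes> a)"
      using elem(1)[of "K #> a" "K #> b"] ab abG mod_mult[OF chief_normal(2)] by auto
    then have "(a \<otimes> b) \<otimes> inv (b \<otimes> a) \<in> K" using coset_eq_iff[OF chief_subgroups(2)] abG by simp
    then show ?thesis using abG by (simp add: inv_mult_group m_assoc)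
  qed
  show "a [^] p \<in> K" if a: "a \<in> N"
  proof -
    have aG: "a \<in> carrier G" using a chief_carrier by simp
    have "K #> (a [^] p) = K" using elem(2)[of "K #> a"] a mod_pow[OF chief_normal(2) aG] by simp
    then show ?thesis using coset_join1 chief_subgroups(2) aG by blast
  qed
qed

lemma chief_fixed:
  fixes p k :: nat
  assumes p: "prime p" "card N = p ^ k * card K" and R: "R \<lhd> G"
    and act: "\<And>r. r \<in> R \<Longrightarrow> \<exists>a. \<forall>v\<in>N. conjug (r [^] (p ^ a)) v \<otimes> inv v \<in> K"
    and r: "r \<in> R" and v: "v \<in> N"
  shows "conjug r v \<otimes> inv v \<in> K"
proof -
  interpret Q: fin_group "G Mod K" using chief_normal(2) by (rule mod_fin_group)
  have c: "card ((\<lambda>x. K #> x) ` N) = p ^ k" using chief_card_eq p(2) .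
  have RG: "x \<in> carrier G" if "x \<in> R" for x using that R normal_imp_subgroup subgroup.mem_carrier by fast
  have "group.conjug (G Mod K) (K #> r) (K #> v) = K #> v"
  proof (rule Q.min_normal_fixed[OF chief_min_normal p(1) c mod_image_normal[OF chief_normal(2) R]])
    fix s assume "s \<in> (\<lambda>x. K #> x) ` R"
    then obtain t where t: "t \<in> R" "s = K #> t" by auto
    obtain a where a: "\<forall>v\<in>N. conjug (t [^] (p ^ a)) v \<otimes> inv v \<in> K" using act[OF t(1)] by blast
    have "Q.conjug (s [^]\<^bsub>G Mod K\<^esub> (p ^ a)) u = u" if u: "u \<in> (\<lambda>x. K #> x) ` N" for u
    proof -
      obtain w where w: "w \<in> N" "u = K #> w" using u by auto
      show ?thesis
        using a w mod_fixed_iff[OF chief_normal(2) nat_pow_closed[OF RG[OF t(1)]] chief_carrier(1)[OF w(1)], of "p ^ a"]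
          mod_pow[OF chief_normal(2) RG[OF t(1)], of "p ^ a"] t by simp
    qed
    then show "\<exists>a. \<forall>v\<in>(\<lambda>x. K #> x) ` N. Q.conjug (s [^]\<^bsub>G Mod K\<^esub> (p ^ a)) v = v" by blast
  qed (use r v in auto)
  then show ?thesis using mod_fixed_iff[OF chief_normal(2) RG[OF r] chief_carrier(1)[OF v]] by simp
qed

lemma chief_prime_order:
  fixes p k :: nat
  assumes p: "prime p" "card N = p ^ k * card K"
    and com: "\<And>g h v. g \<in> carrier G \<Longrightarrow> h \<in> carrier G \<Longrightarrow> v \<in> N \<Longrightarrow>
       conjug (g \<otimes> h) v \<otimes> inv (conjug (h \<otimes> g) v) \<in> K"
    and ex: "\<And>g v. g \<in> carrier G \<Longrightarrow> v \<in> N \<Longrightarrow> conjug (g [^] (p - 1)) v \<otimes> inv v \<in> K"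
  shows "card N = p * card K"
proof -
  interpret Q: fin_group "G Mod K" using chief_normal(2) by (rule mod_fin_group)
  have c: "card ((\<lambda>x. K #> x) ` N) = p ^ k" using chief_card_eq p(2) .
  have "card ((\<lambda>x. K #> x) ` N) = p"
  proof (rule Q.min_normal_prime_order[OF chief_min_normal p(1) c])
    fix g h v assume "g \<in> carrier (G Mod K)" "h \<in> carrier (G Mod K)" "v \<in> (\<lambda>x. K #> x) ` N"
    then obtain a b w where abw: "a \<in> carrier G" "b \<in> carrier G" "w \<in> N" "g = K #> a" "h = K #> b" "v = K #> w"
      by (auto simp: carrier_FactGroup)
    have wG: "w \<in> carrier G" using abw chief_carrier by simp
    have "K #> conjug (a \<otimes> b) w = K #> conjug (b \<otimes> a) w"
      using com[OF abw(1-3)] coset_eq_iff[OF chief_subgroups(2)] abw wG by simp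
    then show "Q.conjug (g \<otimes>\<^bsub>G Mod K\<^esub> h) v = Q.conjug (h \<otimes>\<^bsub>G Mod K\<^esub> g) v"
      using abw wG conjug_mod[OF chief_normal(2)] mod_mult[OF chief_normal(2)] by (metis m_closed)
  next
    fix g v assume "g \<in> carrier (G Mod K)" "v \<in> (\<lambda>x. K #> x) ` N"
    then obtain a w where aw: "a \<in> carrier G" "w \<in> N" "g = K #> a" "v = K #> w"
      by (auto simp: carrier_FactGroup)
    show "Q.conjug (g [^]\<^bsub>G Mod K\<^esub> (p - 1)) v = v"
      using ex[OF aw(1,2)] mod_fixed_iff[OF chief_normal(2) nat_pow_closed[OF aw(1)] chief_carrier(1)[OF aw(2)]]
        mod_pow[OF chief_normal(2) aw(1)] aw by metis
  qed
  then show ?thesis using chief_card by simp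
qed

lemma chief_fixed_point:
  fixes p k j :: nat
  assumes p: "prime p" "card N = p ^ k * card K" and S: "subgroup S G" "card S = p ^ j"
  obtains v where "v \<in> N" "v \<notin> K" "\<forall>s\<in>S. conjug s v \<otimes> inv v \<in> K"
proof -
  let ?X = "(\<lambda>x. K #> x) ` N"
  interpret Q: fin_group "G Mod K" using chief_normal(2) by (rule mod_fin_group)
  have SG: "x \<in> carrier G" if "x \<in> S" for x using that S subgroup.mem_carrier by fast
  have c: "card ?X = p ^ k" using chief_card_eq p(2) .
  have sub: "subgroup ?X (G Mod K)"
    using mod_image_normal[OF chief_normal(2,1)] by (rule normal_imp_subgroup)
  have ne: "?X \<noteq> {\<one>\<^bsub>G Mod K\<^esub>}" using chief_min_normal by (simp add: minimal_normal_subgroup_def)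
  have Ssub: "subgroup ((\<lambda>x. K #> x) ` S) (G Mod K)"
    using group_hom.subgroup_img_is_subgroup[OF mod_hom[OF chief_normal(2)] S(1)] .
  obtain i where i: "card ((\<lambda>x. K #> x) ` S) = p ^ i"
    using mod_image_p_power[OF chief_normal(2) p(1) S] by blast
  have inv: "Q.conjug s v \<in> ?X" if "s \<in> (\<lambda>x. K #> x) ` S" "v \<in> ?X" for s v
    using that Q.normal_conjug[OF mod_image_normal[OF chief_normal(2,1)]] SG by (auto simp: carrier_FactGroup)
  obtain v where v: "v \<in> ?X" "v \<noteq> \<one>\<^bsub>G Mod K\<^esub>" "\<forall>s\<in>(\<lambda>x. K #> x) ` S. Q.conjug s v = v"
    using Q.p_group_fixes[OF Ssub i p(1) sub c ne inv] .
  obtain w where w: "w \<in> N" "v = K #> w" using v(1) by auto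
  have "w \<notin> K" using v(2) w coset_join2[of w K] chief_subgroups(2) chief_carrier by auto
  moreover have "conjug s w \<otimes> inv w \<in> K" if s: "s \<in> S" for s
    using v(3) s w mod_fixed_iff[OF chief_normal(2) SG[OF s] chief_carrier(1)[OF w(1)]] by blast
  ultimately show ?thesis using that w by blast
qed

end

end

section \<open>Commutator subgroups and the index condition\<close>

context group
begin

text \<open>The identity \<open>g [h,k] g^-1 = [h,g]^-1 [h,gk]\<close> expresses the conjugate of a
  generator by generators, although \<open>H\<close> itself may fail to be normal.\<close>

lemma commutator_subgroup_normal:
  assumes H: "H \<subseteq> carrier G"
  shows "commutator_subgroup G H (carrier G) \<lhd> G"
proof (rule normalI_conjug)
  let ?S = "\<Union>h\<in>H. \<Union>k\<in>carrier G. {h \<otimes> k \<otimes> inv h \<otimes> inv k}"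
  have SG: "?S \<subseteq> carrier G" using H by auto
  show sub: "subgroup (commutator_subgroup G H (carrier G)) G"
    unfolding commutator_subgroup_def by (rule generate_is_subgroup[OF SG])
  fix g x assume g: "g \<in> carrier G" and x: "x \<in> commutator_subgroup G H (carrier G)"
  have "conjug g s \<in> generate G ?S" if s: "s \<in> ?S" for s
  proof -
    obtain h k where hk: "h \<in> H" "k \<in> carrier G" "s = h \<otimes> k \<otimes> inv h \<otimes> inv k" using s by auto
    have hG: "h \<in> carrier G" using hk H by auto
    have c: "h \<otimes> l \<otimes> inv h \<otimes> inv l \<in> generate G ?S" if "l \<in> carrier G" for l
      using hk(1) that by (intro generate.incl) blast
    have "inv (h \<otimes> g \<otimes> inv h \<otimes> inv g) \<otimes> (h \<otimes> (g \<otimes> k) \<otimes> inv h \<otimes> inv (g \<otimes> k)) \<in> generate G ?S"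
      by (rule generate.eng[OF generate_m_inv_closed[OF SG c[OF g]] c[OF m_closed[OF g hk(2)]]])
    moreover have "inv (h \<otimes> g \<otimes> inv h \<otimes> inv g) \<otimes> (h \<otimes> (g \<otimes> k) \<otimes> inv h \<otimes> inv (g \<otimes> k)) = conjug g s"
      using hG hk g by (simp add: conjug_def m_assoc inv_mult_group)
    ultimately show ?thesis by simp
  qed
  then show "conjug g x \<in> commutator_subgroup G H (carrier G)"
    using generate_conjug[OF g SG] x unfolding commutator_subgroup_def by blast
qed

end

context fin_group
begin

lemma set_mult_normal_subgroup:
  assumes H: "subgroup H G" and K: "K \<lhd> G"
  shows "subgroup (H <#> K) G"
proof -
  have Ks: "subgroup K G" using K by (rule normal_imp_subgroup)
  have HG: "h \<in> carrier G" if "h \<in> H" for h using that H subgroup.mem_carrier by fast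
  have KG: "k \<in> carrier G" if "k \<in> K" for k using that Ks subgroup.mem_carrier by fast
  show ?thesis
  proof (rule subgroupI)
    show "H <#> K \<subseteq> carrier G" using HG KG by (auto simp: set_mult_def)
    show "H <#> K \<noteq> {}" using subgroup.one_closed[OF H] subgroup.one_closed[OF Ks] by (auto simp: set_mult_def)
    fix a assume "a \<in> H <#> K"
    then obtain h k where hk: "h \<in> H" "k \<in> K" "a = h \<otimes> k" by (auto simp: set_mult_def)
    have "inv a = inv h \<otimes> conjug h (inv k)" using hk HG KG by (simp add: conjug_def inv_mult_group m_assoc)
    moreover have "conjug h (inv k) \<in> K" using hk HG Ks by (intro normal_conjug[OF K]) (auto simp: subgroup.m_inv_closed)
    ultimately show "inv a \<in> H <#> K" using hk H by (auto simp: set_mult_def subgroup.m_inv_closed)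
    fix b assume "b \<in> H <#> K"
    then obtain h' k' where hk': "h' \<in> H" "k' \<in> K" "b = h' \<otimes> k'" by (auto simp: set_mult_def)
    have "a \<otimes> b = (h \<otimes> h') \<otimes> (conjug (inv h') k \<otimes> k')"
      using hk hk' HG KG by (simp add: conjug_def m_assoc)
    moreover have "conjug (inv h') k \<otimes> k' \<in> K"
      using hk hk' HG Ks by (intro subgroup.m_closed[OF Ks] normal_conjug[OF K]) auto
    moreover have "h \<otimes> h' \<in> H" using hk hk' H by (simp add: subgroup.m_closed)
    ultimately show "a \<otimes> b \<in> H <#> K" unfolding set_mult_def by blast
  qed
qed

lemma set_mult_contains:
  assumes H: "subgroup H G" and K: "subgroup K G"
  shows "H \<subseteq> H <#> K" "K \<subseteq> H <#> K"
proof -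
  have "h \<otimes> \<one> \<in> H <#> K" if "h \<in> H" for h
    using that subgroup.one_closed[OF K] unfolding set_mult_def by blast
  then show "H \<subseteq> H <#> K" using subgroup.mem_carrier[OF H] by force
  have "\<one> \<otimes> k \<in> H <#> K" if "k \<in> K" for k
    using that subgroup.one_closed[OF H] unfolding set_mult_def by blast
  then show "K \<subseteq> H <#> K" using subgroup.mem_carrier[OF K] by force
qed

lemma set_mult_subset:
  assumes N: "subgroup N G" and "H \<subseteq> N" "K \<subseteq> N"
  shows "H <#> K \<subseteq> N"
  unfolding set_mult_def using assms subgroup.m_closed[OF N] by blast

text \<open>Because \<open>H\<close> lies in \<open>N\<close>, the intersection in the property is
  the image of \<open>H\<close>, a \<open>p\<close>-group, so the index is a power of
  \<open>p\<close>. The normalizer of this image is the image of the normalizer of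
  \<open>H <#> K\<close>, which contains \<open>K\<close>; Lagrange carries the index back to
  \<open>G\<close>.\<close>

lemma Pi_property_normalizer_index:
  fixes p k :: nat
  assumes ch: "chief_factor G N K" and p: "prime p" and H: "subgroup H G" "H \<subseteq> N" "card H = p ^ k"
    and Pi: "Pi_property G H"
  shows "\<exists>a. order G = p ^ a * card {g \<in> carrier G. \<forall>x\<in>H <#> K. conjug g x \<in> H <#> K}"
proof -
  note K = chief_normal(2)[OF ch] and Ks = chief_subgroups(2)[OF ch] and Ns = chief_subgroups(1)[OF ch]
  interpret Q: fin_group "G Mod K" using K by (rule mod_fin_group)
  let ?\<pi> = "\<lambda>x. K #> x"
  let ?B = "H <#> K"
  let ?T = "{g \<in> carrier G. \<forall>x\<in>?B. conjug g x \<in> ?B}"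
  have B: "subgroup ?B G" by (rule set_mult_normal_subgroup[OF H(1) K])
  have BG: "x \<in> carrier G" if "x \<in> ?B" for x using that B subgroup.mem_carrier by fast
  have KB: "K \<subseteq> ?B" and HB: "H \<subseteq> ?B" using set_mult_contains[OF H(1) Ks] by auto
  have BN: "?B \<subseteq> N" using chief_psubset[OF ch] by (intro set_mult_subset[OF Ns H(2)]) auto
  have T: "subgroup ?T G" by (rule normalizer_subgroup[OF subgroup_self B])
  have KT: "K \<subseteq> ?T"
    using subgroup.mem_carrier[OF Ks] conjug_subgroup_mem[OF B] KB by blast
  define A where "A = ?\<pi> ` ?B"
  have imgB: "A = ?\<pi> ` H"
  proof -
    have "K #> (h \<otimes> k) = K #> h" if "h \<in> H" "k \<in> K" for h k
    proof -
      have hk: "h \<in> carrier G" "k \<in> carrier G" using that H(1) Ks subgroup.mem_carrier by fast+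
      have "(h \<otimes> k) \<otimes> inv h \<in> K" using normal_conjug[OF K hk(1) that(2)] by (simp add: conjug_def)
      then show ?thesis using coset_eq_iff[OF Ks] hk by simp
    qed
    then have "A \<subseteq> ?\<pi> ` H" unfolding A_def set_mult_def by force
    then show ?thesis using HB unfolding A_def by blast
  qed
  have Asub: "A \<subseteq> carrier (G Mod K)" using BG by (auto simp: A_def carrier_FactGroup)
  obtain i where i: "card A = p ^ i" using mod_image_p_power[OF K p H(1,3)] imgB by auto
  let ?n = "subgroup_index (G Mod K) (normalizer (G Mod K) A)"
  have "A = carrier (subquotient G (H <#> K) K) \<inter> carrier (subquotient G N K)"
    using BN by (auto simp: carrier_subquotient A_def)
  then have pi: "pi_number (prime_factors (card A)) ?n"
    using Pi ch unfolding Pi_property_def Let_def by metis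
  \<comment> \<open>Only an inclusion, since \<open>A\<close> is trivial when \<open>H\<close> lies
    in \<open>K\<close>.\<close>
  have "prime_factors (card A) \<subseteq> {p}"
    unfolding i using p by (auto simp: prime_factors_dvd prime_dvd_power_iff dest: prime_dvd_power primes_dvd_imp_eq)
  then have n: "?n > 0" "prime_factors ?n \<subseteq> {p}" using pi by (auto simp: pi_number_def)
  obtain m where m: "?n = p ^ multiplicity p ?n * m" "\<not> p dvd m"
    using multiplicity_decompose'[of ?n p] n p by (metis less_irrefl not_prime_unit)
  have "m = 1"
  proof (rule ccontr)
    assume "m \<noteq> 1"
    then obtain r where r: "prime r" "r dvd m" by (metis prime_factor_nat)
    then have "r \<in> prime_factors ?n" using n(1) m(1) by (metis dvd_mult less_irrefl prime_factorsI)
    then show False using n(2) r m(2) by auto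
  qed
  then have npow: "?n = p ^ multiplicity p ?n" using m by simp
  have norm: "normalizer (G Mod K) A = ?\<pi> ` ?T"
  proof -
    have act: "g <#\<^bsub>G Mod K\<^esub> A #>\<^bsub>G Mod K\<^esub> inv\<^bsub>G Mod K\<^esub> g = Q.conjug g ` A" for g
      by (auto simp: l_coset_def r_coset_def Q.conjug_def)
    have "Q.conjug (K #> t) ` A = A \<longleftrightarrow> t \<in> ?T" if t: "t \<in> carrier G" for t
    proof -
      have im: "Q.conjug (K #> t) ` A = ?\<pi> ` conjug t ` ?B"
        unfolding A_def image_image using conjug_mod[OF K t] BG by (intro image_cong) auto
      show ?thesis
      proof
        assume "t \<in> ?T"
        then have "conjug t ` ?B = ?B" using conjug_image_eq[OF t B] by blast
        then show "Q.conjug (K #> t) ` A = A" using im by (simp add: A_def)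
      next
        assume "Q.conjug (K #> t) ` A = A"
        then have eq: "?\<pi> ` conjug t ` ?B = ?\<pi> ` ?B" unfolding im by (simp only: A_def)
        have "conjug t x \<in> ?B" if x: "x \<in> ?B" for x
        proof (rule mod_image_mem[OF K B KB])
          show "conjug t x \<in> carrier G" using t BG[OF x] by simp
          show "?\<pi> (conjug t x) \<in> ?\<pi> ` ?B" unfolding eq[symmetric] using x by (intro imageI)
        qed
        then show "t \<in> ?T" using t by simp
      qed
    qed
    then show ?thesis
      using Asub by (auto simp: normalizer_def stabilizer_def act carrier_FactGroup)
  qed
  have "subgroup (normalizer (G Mod K) A) (G Mod K)" using Q.normalizer_imp_subgroup[OF Asub] .
  then have "?n * card (?\<pi> ` ?T) = order (G Mod K)"
    using Q.lagrange norm by (simp add: subgroup_index_def)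
  then have "?n * (card (?\<pi> ` ?T) * card K) = card (?\<pi> ` carrier G) * card K"
    by (simp add: order_def carrier_FactGroup)
  moreover have "card (?\<pi> ` ?T) * card K = card ?T" using lagrange_sub[OF Ks T KT] .
  moreover have "card (?\<pi> ` carrier G) * card K = order G"
    using lagrange_sub[OF Ks subgroup_self subgroup.subset[OF Ks]] by (simp add: order_def)
  ultimately have "order G = ?n * card ?T" by (simp only:)
  moreover obtain a where "?n = p ^ a" using npow by blast
  ultimately show ?thesis by auto
qed

end

subsection \<open>The top chief factor\<close>

text \<open>\<open>IC\<close> speaks of cyclic subgroups annihilated by \<open>q\<close>, which
  treats the subgroups of order \<open>p\<close> and the cyclic ones of order 4 together;
  \<open>below\<close> is the induction hypothesis for the factors inside \<open>K\<close>.\<close>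

locale chief_step = fin_group G for G (structure) +
  fixes p q :: nat and N K P :: "'a set"
  assumes p: "prime p" and ch: "chief_factor G N K" and pdvd: "p dvd card N div card K"
    and P: "sylow_in p N P" and good: "good_exp p q P"
    and IC: "\<And>x. x \<in> P \<Longrightarrow> x \<noteq> \<one> \<Longrightarrow> x [^] q = \<one> \<Longrightarrow> IC_Pi_property G (generate G {x})"
    and maxi: "\<And>A. A \<lhd> G \<Longrightarrow> A \<subseteq> N \<Longrightarrow> A \<noteq> N \<Longrightarrow> A \<subseteq> K"
    and below: "\<And>L J. chief_factor G L J \<Longrightarrow> L \<subseteq> K \<Longrightarrow> p dvd card L div card J \<Longrightarrow> card L = p * card J"
begin

lemmas Nn = chief_normal(1)[OF ch] and Kn = chief_normal(2)[OF ch]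
  and Ns = chief_subgroups(1)[OF ch] and Ks = chief_subgroups(2)[OF ch]
  and NG = chief_carrier(1)[OF ch] and KG = chief_carrier(2)[OF ch]
  and KN = chief_psubset[OF ch]

lemma Ps: "subgroup P G" and PN: "P \<subseteq> N" and Pidx: "\<not> p dvd card N div card P"
  using P by (auto simp: sylow_in_def)

lemma Pcard: obtains k where "card P = p ^ k"
  using P by (auto simp: sylow_in_def)

lemma PG: "x \<in> P \<Longrightarrow> x \<in> carrier G"
  using PN NG by auto

lemma generate_mem: "x \<in> generate G {x}"
  by (rule generate.incl) simp

lemma generate_sub:
  assumes "x \<in> P"
  shows "subgroup (generate G {x}) G" "generate G {x} \<subseteq> P" "\<exists>j. card (generate G {x}) = p ^ j"
proof -
  show 1: "subgroup (generate G {x}) G" using assms PG by (intro generate_is_subgroup) auto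
  show 2: "generate G {x} \<subseteq> P" using assms Ps by (intro generate_subgroup_incl) auto
  obtain k where "card P = p ^ k" by (rule Pcard)
  then have "card (generate G {x}) dvd p ^ k" using card_dvd_sub[OF 1 Ps 2] by simp
  then show "\<exists>j. card (generate G {x}) = p ^ j" by (rule prime_power_dvd_obtain[OF p]) blast
qed

text \<open>The commutator subgroup \<open>?D\<close> of \<open>?H\<close> with \<open>G\<close> is
  normal and lies in \<open>N\<close>. If it is \<open>N\<close>, intersecting \<open>?H\<close>
  with it changes nothing, and \<open>IC\<close> gives the property for \<open>?H\<close> itself.
  Otherwise it lies in \<open>K\<close>, so \<open>?H\<close> is central modulo \<open>K\<close> and
  \<open>?H <#> K\<close> is normal.\<close>

lemma normalizer_p_index:
  assumes x: "x \<in> P" "x \<notin> K" "x [^] q = \<one>"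
  shows "\<exists>a. order G = p ^ a * card {g \<in> carrier G.
           \<forall>y\<in>generate G {x} <#> K. conjug g y \<in> generate G {x} <#> K}"
proof -
  let ?H = "generate G {x}"
  let ?D = "commutator_subgroup G ?H (carrier G)"
  note H = generate_sub[OF x(1)]
  obtain j where j: "card ?H = p ^ j" using H(3) by blast
  have HG: "h \<in> carrier G" if "h \<in> ?H" for h using that H PG by blast
  have HN: "?H \<subseteq> N" using H PN by blast
  have D: "?D \<lhd> G" using HG by (intro commutator_subgroup_normal) blast
  have Ds: "subgroup ?D G" using D by (rule normal_imp_subgroup)
  have comD: "h \<otimes> g \<otimes> inv h \<otimes> inv g \<in> ?D" if "h \<in> ?H" "g \<in> carrier G" for h g
    unfolding commutator_subgroup_def using that by (intro generate.incl) auto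
  have DN: "?D \<subseteq> N"
    unfolding commutator_subgroup_def
  proof (rule generate_subgroup_incl[OF _ Ns])
    show "(\<Union>h\<in>?H. \<Union>k\<in>carrier G. {h \<otimes> k \<otimes> inv h \<otimes> inv k}) \<subseteq> N"
    proof clarsimp
      fix h k assume h: "h \<in> ?H" and k: "k \<in> carrier G"
      have "h \<otimes> conjug k (inv h) \<in> N"
        using h HN k Ns by (intro subgroup.m_closed[OF Ns] normal_conjug[OF Nn]) (auto simp: subgroup.m_inv_closed)
      then show "h \<otimes> k \<otimes> inv h \<otimes> inv k \<in> N" using HG[OF h] k by (simp add: conjug_def m_assoc)
    qed
  qed
  show ?thesis
  proof (cases "?D = N")
    case True
    have "x \<noteq> \<one>" using x(2) subgroup.one_closed[OF Ks] by auto
    then have "Pi_property G (?H \<inter> ?D)" using IC[OF x(1) _ x(3)] by (simp add: IC_Pi_property_def)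
    moreover have "?H \<inter> ?D = ?H" using True HN by auto
    ultimately have "Pi_property G ?H" by simp
    then show ?thesis by (rule Pi_property_normalizer_index[OF ch p H(1) HN j])
  next
    case False
    then have DK: "?D \<subseteq> K" using maxi[OF D DN] by blast
    let ?B = "?H <#> K"
    have B: "subgroup ?B G" by (rule set_mult_normal_subgroup[OF H(1) Kn])
    have HB: "?H \<subseteq> ?B" "K \<subseteq> ?B" using set_mult_contains[OF H(1) Ks] by auto
    have "conjug g y \<in> ?B" if g: "g \<in> carrier G" and y: "y \<in> ?B" for g y
    proof -
      obtain h k where hk: "h \<in> ?H" "k \<in> K" "y = h \<otimes> k" using y by (auto simp: set_mult_def)
      have "inv (h \<otimes> g \<otimes> inv h \<otimes> inv g) \<in> ?B"
        using comD[OF hk(1) g] DK HB B by (blast intro: subgroup.m_inv_closed)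
      then have "inv (h \<otimes> g \<otimes> inv h \<otimes> inv g) \<otimes> h \<in> ?B" using hk HB B by (blast intro: subgroup.m_closed)
      moreover have "inv (h \<otimes> g \<otimes> inv h \<otimes> inv g) \<otimes> h = conjug g h"
        using g HG[OF hk(1)] by (simp add: conjug_def inv_mult_group m_assoc)
      moreover have "conjug g k \<in> ?B" using normal_conjug[OF Kn g hk(2)] HB by blast
      ultimately show ?thesis
        using g HG[OF hk(1)] KG[OF hk(2)] B by (simp add: hk(3) conjug_mult subgroup.m_closed)
    qed
    then have "{g \<in> carrier G. \<forall>y\<in>?B. conjug g y \<in> ?B} = carrier G" by blast
    then have "order G = p ^ 0 * card {g \<in> carrier G. \<forall>y\<in>?B. conjug g y \<in> ?B}" by (simp add: order_def)
    then show ?thesis by blast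
  qed
qed

text \<open>\<open>G\<close> is the product of the normalizer \<open>?T\<close> of
  \<open>?H <#> K\<close>, of \<open>p\<close>-power index, and a Sylow subgroup \<open>S\<close>
  containing \<open>?H\<close>. Hence all conjugates of \<open>x\<close> lie in
  \<open>S <#> K\<close>, and so does \<open>N\<close>, which they generate as their normal
  closure.\<close>

lemma p_factor_of_element:
  assumes x: "x \<in> P" "x \<notin> K" "x [^] q = \<one>"
  shows "\<exists>k. card N = p ^ k * card K"
proof -
  let ?H = "generate G {x}"
  let ?B = "?H <#> K"
  let ?T = "{g \<in> carrier G. \<forall>y\<in>?B. conjug g y \<in> ?B}"
  note H = generate_sub[OF x(1)]
  obtain j where j: "card ?H = p ^ j" using H(3) by blast
  have B: "subgroup ?B G" by (rule set_mult_normal_subgroup[OF H(1) Kn])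
  have HB: "?H \<subseteq> ?B" "K \<subseteq> ?B" using set_mult_contains[OF H(1) Ks] by auto
  have T: "subgroup ?T G" by (rule normalizer_subgroup[OF subgroup_self B])
  obtain a where a: "card (carrier G) = p ^ a * card ?T" using normalizer_p_index[OF x] by (auto simp: order_def)
  obtain S where S: "sylow_in p (carrier G) S" "?H \<subseteq> S"
    using p_sub_subset_sylow[OF subgroup_self p H(1) subgroup.subset[OF H(1)] j] .
  have Ss: "subgroup S G" using S by (simp add: sylow_in_def)
  obtain i where i: "card S = p ^ i" using S by (auto simp: sylow_in_def)
  have SG: "s \<in> carrier G" if "s \<in> S" for s using that Ss subgroup.mem_carrier by fast
  let ?SK = "S <#> K"
  have SK: "subgroup ?SK G" by (rule set_mult_normal_subgroup[OF Ss Kn])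
  have SSK: "S \<subseteq> ?SK" "K \<subseteq> ?SK" using set_mult_contains[OF Ss Ks] by auto
  have BSK: "?B \<subseteq> ?SK" using S(2) by (rule mono_set_mult) simp
  have TG: "?T \<subseteq> carrier G" by auto
  have xG: "x \<in> carrier G" using x PG by simp
  have conj: "conjug g x \<in> ?SK" if g: "g \<in> carrier G" for g
  proof -
    \<comment> \<open>It is \<open>inv g\<close> that is factored, so that the factor from
      \<open>?T\<close> acts on \<open>x\<close> first and the one from \<open>S\<close>
      afterwards.\<close>
    obtain t s where ts: "t \<in> ?T" "s \<in> S" "inv g = t \<otimes> s"
      using sylow_factor[OF subgroup_self p S(1) T TG a inv_closed[OF g]] .
    have tsG: "t \<in> carrier G" "s \<in> carrier G" using ts SG by auto
    have ge: "g = inv s \<otimes> inv t" using ts(3) g tsG by (metis inv_inv inv_mult_group)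
    have "inv t \<in> ?T" using T ts(1) by (rule subgroup.m_inv_closed)
    moreover have "x \<in> ?B" using generate_mem HB by blast
    ultimately have "conjug (inv t) x \<in> ?SK" using BSK by blast
    moreover have "inv s \<in> ?SK" using ts Ss SSK by (blast intro: subgroup.m_inv_closed)
    ultimately have "conjug (inv s) (conjug (inv t) x) \<in> ?SK" using conjug_subgroup_mem[OF SK] by blast
    then show ?thesis using tsG xG by (simp add: ge conjug_conjug)
  qed
  \<comment> \<open>The normal core in \<open>G\<close> of \<open>N \<inter> ?SK\<close>; it
    contains \<open>x\<close>, so by \<open>maxi\<close> it is \<open>N\<close>.\<close>
  let ?W = "{y \<in> N. \<forall>g\<in>carrier G. conjug g y \<in> ?SK}"
  have "?W \<lhd> G"
  proof (rule normalI_conjug)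
    show "subgroup ?W G"
    proof (rule subgroupI)
      show "?W \<subseteq> carrier G" using NG by auto
      have "x \<in> ?W" using conj x PN by auto
      then show "?W \<noteq> {}" by blast
      show "inv a \<in> ?W" if "a \<in> ?W" for a
        using that NG Ns subgroup.m_inv_closed[OF SK] by (auto simp: subgroup.m_inv_closed conjug_inv)
      show "a \<otimes> b \<in> ?W" if "a \<in> ?W" "b \<in> ?W" for a b
        using that NG Ns subgroup.m_closed[OF SK] by (auto simp: subgroup.m_closed conjug_mult)
    qed
    show "conjug g y \<in> ?W" if "g \<in> carrier G" "y \<in> ?W" for g y
      using that NG normal_conjug[OF Nn] by (auto simp: conjug_conjug)
  qed
  moreover have "x \<in> ?W" using conj x PN by auto
  ultimately have WN: "?W = N" using maxi[of ?W] x(2) by blast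
  have "n [^] (p ^ i) \<in> K" if n: "n \<in> N" for n
  proof -
    have "conjug \<one> n \<in> ?SK" using WN n by blast
    then obtain s k where sk: "s \<in> S" "k \<in> K" "n = s \<otimes> k" using NG[OF n] by (auto simp: set_mult_def)
    have skG: "s \<in> carrier G" "k \<in> carrier G" using sk SG KG by auto
    have "n \<otimes> inv s \<in> K" using normal_conjug[OF Kn skG(1) sk(2)] by (simp add: sk(3) conjug_def)
    then have ns: "K #> n = K #> s" using coset_eq_iff[OF Ks NG[OF n] skG(1)] by simp
    have "s [^] (p ^ i) = \<one>" using pow_card_subgroup[OF Ss _ sk(1)] Ss i by simp
    then have "K #> (n [^] (p ^ i)) = K"
      using mod_pow[OF Kn NG[OF n], of "p ^ i"] mod_pow[OF Kn skG(1), of "p ^ i"] ns subgroup.subset[OF Ks]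
      by simp
    then show ?thesis using coset_join1 Ks NG[OF n] by blast
  qed
  then show ?thesis using index_p_power[OF Ns p Ks] KN by blast
qed

text \<open>\<open>S\<close> fixes the coset of \<open>x\<close>, so it normalizes
  \<open>?H <#> K\<close>. The index of the normalizer is then both a power of \<open>p\<close> and
  prime to \<open>p\<close>, which makes \<open>?H <#> K\<close> normal and equal to
  \<open>N\<close>; so \<open>N/K\<close> is cyclic of exponent \<open>p\<close>.\<close>

lemma prime_of_fixed_element:
  assumes x: "x \<in> P" "x \<notin> K" "x [^] q = \<one>" and S: "sylow_in p (carrier G) S"
    and fixed: "\<And>s. s \<in> S \<Longrightarrow> conjug s x \<otimes> inv x \<in> K" and k: "card N = p ^ k * card K"
  shows "card N = p * card K"
proof -
  let ?H = "generate G {x}"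
  let ?B = "?H <#> K"
  let ?T = "{g \<in> carrier G. \<forall>y\<in>?B. conjug g y \<in> ?B}"
  note H = generate_sub[OF x(1)]
  have xG: "x \<in> carrier G" using x PG by simp
  have B: "subgroup ?B G" by (rule set_mult_normal_subgroup[OF H(1) Kn])
  have HB: "?H \<subseteq> ?B" "K \<subseteq> ?B" using set_mult_contains[OF H(1) Ks] by auto
  have xB: "x \<in> ?B" using generate_mem HB by blast
  have T: "subgroup ?T G" by (rule normalizer_subgroup[OF subgroup_self B])
  obtain a where a: "card (carrier G) = p ^ a * card ?T" using normalizer_p_index[OF x] by (auto simp: order_def)
  have S': "subgroup S G" "\<not> p dvd card (carrier G) div card S" using S by (auto simp: sylow_in_def)
  have SG: "s \<in> carrier G" if "s \<in> S" for s using that S' subgroup.mem_carrier by fast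
  have Hpow: "\<exists>n::nat. h = x [^] n" if "h \<in> ?H" for h
    using that generate_pow_on_finite_carrier[OF fin xG] by blast
  have "s \<in> ?T" if s: "s \<in> S" for s
  proof -
    have "(conjug s x \<otimes> inv x) \<otimes> x \<in> ?B" using fixed[OF s] HB xB B by (blast intro: subgroup.m_closed)
    then have sx: "conjug s x \<in> ?B" using SG[OF s] xG by (simp add: m_assoc)
    have "conjug s y \<in> ?B" if y: "y \<in> ?B" for y
    proof -
      obtain h k where hk: "h \<in> ?H" "k \<in> K" "y = h \<otimes> k" using y by (auto simp: set_mult_def)
      obtain n where n: "h = x [^] (n::nat)" using Hpow[OF hk(1)] by blast
      have "conjug s h \<in> ?B" using subgroup_pow[OF B sx, of n] SG[OF s] xG by (simp add: n conjug_pow)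
      moreover have "conjug s k \<in> ?B" using normal_conjug[OF Kn SG[OF s] hk(2)] HB by blast
      ultimately show ?thesis
        using SG[OF s] xG KG[OF hk(2)] B by (simp add: hk(3) n conjug_mult subgroup.m_closed)
    qed
    then show ?thesis using SG[OF s] by blast
  qed
  then have ST: "S \<subseteq> ?T" by blast
  obtain t where t: "card ?T = card S * t" using card_dvd_sub[OF S'(1) T ST] by blast
  then have "card (carrier G) div card S = p ^ a * t" using a card_sub_pos[OF S'(1)] by simp
  then have "a = 0" using S'(2) by (cases a) auto
  then have "?T = carrier G" using a by (intro card_subset_eq fin) auto
  then have "?B \<lhd> G" using B by (intro normalI_conjug) blast+
  moreover have "?B \<subseteq> N" using H PN KN by (intro set_mult_subset[OF Ns]) auto
  ultimately have BN: "?B = N" using maxi[of ?B] xB x(2) by blast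
  have xp: "x [^] p \<in> K" using chief_elementary(2)[OF ch p k] x PN by blast
  have "(\<lambda>y. K #> y) ` N \<subseteq> (\<lambda>n::nat. K #> (x [^] n)) ` {..<p}"
  proof
    fix C assume "C \<in> (\<lambda>y. K #> y) ` N"
    then obtain y where y: "y \<in> ?B" "C = K #> y" using BN by auto
    obtain h k where hk: "h \<in> ?H" "k \<in> K" "y = h \<otimes> k" using y by (auto simp: set_mult_def)
    obtain n where n: "h = x [^] (n::nat)" using Hpow[OF hk(1)] by blast
    have hG: "h \<in> carrier G" using n xG by simp
    have "y \<otimes> inv h \<in> K" using normal_conjug[OF Kn hG hk(2)] by (simp add: hk(3) conjug_def)
    then have "C = K #> h" using coset_eq_iff[OF Ks _ hG] y hk KG hG by simp
    moreover have "K #> h = K #> (x [^] (n mod p))"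
    proof -
      have "h = x [^] (p * (n div p) + n mod p)" by (simp add: n)
      also have "\<dots> = (x [^] p) [^] (n div p) \<otimes> x [^] (n mod p)"
        using xG by (simp only: nat_pow_mult nat_pow_pow nat_pow_closed)
      finally have "h \<otimes> inv (x [^] (n mod p)) = (x [^] p) [^] (n div p)" using xG by (simp add: m_assoc)
      then show ?thesis using coset_eq_iff[OF Ks hG] xG subgroup_pow[OF Ks xp] by simp
    qed
    ultimately show "C \<in> (\<lambda>n::nat. K #> (x [^] n)) ` {..<p}" using prime_gt_0_nat[OF p] by auto
  qed
  then have "card ((\<lambda>y. K #> y) ` N) \<le> p" using surj_card_le[of "{..<p}"] by simp
  then have "p ^ k \<le> p ^ 1" using chief_card_eq[OF ch k] by simp
  then have "k \<le> 1" using prime_gt_1_nat[OF p] by (metis power_increasing_iff)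
  moreover have "k \<noteq> 0" using k KN card_subset_eq[of N K] Ns by auto
  ultimately have "k = 1" by simp
  then show ?thesis using k by simp
qed

section \<open>The common centralizer of the \<open>p\<close>-chief factors below
  \<open>K\<close>\<close>

definition R where
  "R = {g \<in> carrier G. \<forall>L J. chief_factor G L J \<longrightarrow> L \<subseteq> K \<longrightarrow> p dvd card L div card J \<longrightarrow>
          (\<forall>x\<in>L. conjug g x \<otimes> inv x \<in> J)}"

lemma R_carrier: "g \<in> R \<Longrightarrow> g \<in> carrier G"
  by (simp add: R_def)

lemma R_normal: "R \<lhd> G"
proof (rule normalI_conjug)
  show "subgroup R G"
  proof (rule subgroupI)
    show "R \<subseteq> carrier G" by (auto simp: R_def)
    have "\<one> \<in> R"
      using chief_carrier(1) subgroup.one_closed[OF chief_subgroups(2)] by (auto simp: R_def)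
    then show "R \<noteq> {}" by blast
    fix a assume a: "a \<in> R"
    have aG: "a \<in> carrier G" using a R_carrier by simp
    show "inv a \<in> R"
      unfolding R_def
    proof (intro CollectI conjI allI impI ballI)
      fix L J x assume L: "chief_factor G L J" "L \<subseteq> K" "p dvd card L div card J" and x: "x \<in> L"
      have xG: "x \<in> carrier G" using chief_carrier(1)[OF L(1) x] .
      define w where "w = conjug (inv a) x"
      have w: "w \<in> L" unfolding w_def by (rule normal_conjug[OF chief_normal(1)[OF L(1)] inv_closed[OF aG] x])
      have wG: "w \<in> carrier G" using chief_carrier(1)[OF L(1) w] .
      have "conjug a w \<otimes> inv w \<in> J" using a L w unfolding R_def by blast
      then have "inv (conjug a w \<otimes> inv w) \<in> J" by (rule subgroup.m_inv_closed[OF chief_subgroups(2)[OF L(1)]])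
      moreover have "inv (conjug a w \<otimes> inv w) = w \<otimes> inv x"
        using aG wG xG by (simp add: inv_mult_group w_def)
      ultimately show "conjug (inv a) x \<otimes> inv x \<in> J" by (simp add: w_def)
    qed (use aG in simp)
    fix b assume b: "b \<in> R"
    have bG: "b \<in> carrier G" using b R_carrier by simp
    show "a \<otimes> b \<in> R"
      unfolding R_def
    proof (intro CollectI conjI allI impI ballI)
      fix L J x assume L: "chief_factor G L J" "L \<subseteq> K" "p dvd card L div card J" and x: "x \<in> L"
      have xG: "x \<in> carrier G" using chief_carrier(1)[OF L(1) x] .
      have w: "conjug b x \<in> L" by (rule normal_conjug[OF chief_normal(1)[OF L(1)] bG x])
      have "conjug a (conjug b x) \<otimes> inv (conjug b x) \<in> J" "conjug b x \<otimes> inv x \<in> J"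
        using a b L w x unfolding R_def by blast+
      then have "(conjug a (conjug b x) \<otimes> inv (conjug b x)) \<otimes> (conjug b x \<otimes> inv x) \<in> J"
        by (rule subgroup.m_closed[OF chief_subgroups(2)[OF L(1)]])
      then show "conjug (a \<otimes> b) x \<otimes> inv x \<in> J"
        using aG bG xG by (simp add: m_assoc conjug_conjug)
    qed (use aG bG in simp)
  qed
  fix g a assume g: "g \<in> carrier G" and a: "a \<in> R"
  have aG: "a \<in> carrier G" using a R_carrier by simp
  show "conjug g a \<in> R"
    unfolding R_def
  proof (intro CollectI conjI allI impI ballI)
    fix L J x assume L: "chief_factor G L J" "L \<subseteq> K" "p dvd card L div card J" and x: "x \<in> L"
    have xG: "x \<in> carrier G" using chief_carrier(1)[OF L(1) x] .
    define w where "w = conjug (inv g) x"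
    have w: "w \<in> L" unfolding w_def by (rule normal_conjug[OF chief_normal(1)[OF L(1)] inv_closed[OF g] x])
    have wG: "w \<in> carrier G" using chief_carrier(1)[OF L(1) w] .
    have xw: "x = conjug g w" using g xG by (simp add: w_def)
    have "conjug a w \<otimes> inv w \<in> J" using a L w unfolding R_def by blast
    then have "conjug g (conjug a w \<otimes> inv w) \<in> J" by (rule normal_conjug[OF chief_normal(2)[OF L(1)] g])
    moreover have "conjug g (conjug a w \<otimes> inv w) = conjug (conjug g a) x \<otimes> inv x"
      using g aG wG by (simp add: xw conjug_mult conjug_inv conjug_distrib)
    ultimately show "conjug (conjug g a) x \<otimes> inv x \<in> J" by simp
  qed (use g aG in simp)
qed

lemma R_subgroup: "subgroup R G"
  using R_normal by (rule normal_imp_subgroup)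

lemma pow_in_R:
  assumes g: "g \<in> carrier G"
  shows "g [^] (p - 1) \<in> R"
  unfolding R_def using g chief_prime_action(2)[OF _ p below g g] by simp

lemma commutator_in_R:
  assumes g: "g \<in> carrier G" and h: "h \<in> carrier G"
  shows "(g \<otimes> h) \<otimes> inv (h \<otimes> g) \<in> R"
  unfolding R_def
proof (intro CollectI conjI allI impI ballI)
  fix L J x assume L: "chief_factor G L J" "L \<subseteq> K" "p dvd card L div card J" and x: "x \<in> L"
  have xG: "x \<in> carrier G" using chief_carrier(1)[OF L(1) x] .
  define w where "w = conjug (inv (h \<otimes> g)) x"
  have w: "w \<in> L" unfolding w_def using g h x by (intro normal_conjug[OF chief_normal(1)[OF L(1)]]) auto
  have "conjug (g \<otimes> h) w \<otimes> inv (conjug (h \<otimes> g) w) \<in> J"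
    by (rule chief_prime_action(1)[OF L(1) p below[OF L] g h w])
  moreover have "conjug (h \<otimes> g) w = x" unfolding w_def using g h xG by simp
  moreover have "conjug (g \<otimes> h) w = conjug ((g \<otimes> h) \<otimes> inv (h \<otimes> g)) x"
    unfolding w_def using g h xG by (intro conjug_conjug) auto
  ultimately show "conjug ((g \<otimes> h) \<otimes> inv (h \<otimes> g)) x \<otimes> inv x \<in> J" by simp
qed (use g h in simp)

text \<open>Otherwise \<open>N \<inter> R\<close> lies in \<open>K\<close>. For \<open>x\<close> in
  \<open>P\<close> it contains \<open>x [^] (p - 1)\<close>, whose exponent is prime to the order of
  \<open>x\<close>; so \<open>P\<close> lies in \<open>K\<close>, contradicting
  \<open>pdvd\<close>.\<close>

lemma N_subset_R: "N \<subseteq> R"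
proof (rule ccontr)
  assume "\<not> N \<subseteq> R"
  then have NR: "N \<inter> R \<subseteq> K"
    using maxi[of "N \<inter> R"] normal_subgroup_intersect[OF Nn R_normal] by blast
  obtain k where k: "card P = p ^ k" by (rule Pcard)
  have "P \<subseteq> K"
  proof
    fix x assume x: "x \<in> P"
    have xN: "x \<in> N" using x PN by auto
    have "x [^] (p - 1) \<in> K" using NR pow_in_R[OF NG[OF xN]] subgroup_pow[OF Ns xN] by blast
    moreover have "x [^] (p ^ k) \<in> K"
      using pow_card_subgroup[OF Ps _ x] Ps k subgroup.one_closed[OF Ks] by simp
    moreover have "coprime (p - 1) (p ^ k)"
      using coprime_diff_one_left_nat[of p] prime_gt_0_nat[OF p] by simp
    ultimately show "x \<in> K" using mem_of_coprime_pow_mem[OF Ks NG[OF xN]] by blast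
  qed
  then obtain c where c: "card K = card P * c" using card_dvd_sub[OF Ps Ks] by blast
  obtain d where d: "card N = card K * d" using card_dvd_sub[OF Ks Ns] KN by blast
  have "card N div card K = d" using d card_sub_pos[OF Ks] by simp
  moreover have "card N div card P = c * d" using c d card_sub_pos[OF Ps] by (simp add: mult.assoc)
  ultimately show False using pdvd Pidx by simp
qed

text \<open>Induction over the normal subgroups below \<open>K\<close>. On a factor
  \<open>L/J\<close> of order divisible by \<open>p\<close> the commutator of \<open>y\<close> and
  \<open>w\<close> drops into \<open>J\<close>, where \<open>y\<close> is already trivial, and
  \<open>coprime_fix\<close> applies; on a \<open>p'\<close>-factor the \<open>p\<close>-element
  \<open>w\<close> itself drops into \<open>J\<close>. \<open>W\<close> may reach beyond
  \<open>K\<close>, as it does for \<open>P\<close> later.\<close>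

lemma regular_centralizes_below:
  assumes y: "y \<in> R" "p_reg p y" and W: "subgroup W G" "card W = p ^ k"
    and inv: "\<And>w. w \<in> W \<Longrightarrow> conjug y w \<in> W"
  shows "w \<in> W \<Longrightarrow> w \<in> K \<Longrightarrow> conjug y w = w"
proof -
  have yG: "y \<in> carrier G" using y R_carrier by simp
  have WG: "w \<in> carrier G" if "w \<in> W" for w using that W(1) subgroup.mem_carrier by fast
  obtain m where m: "y [^] (m::nat) = \<one>" "\<And>k. coprime m (p ^ k)" using p_reg_conv[OF p y(2)] by blast
  have "\<forall>w\<in>W \<inter> L. conjug y w = w" if "L \<lhd> G" "L \<subseteq> K" for L
    using that
  proof (induction "card L" arbitrary: L rule: less_induct)
    case less
    have Ls: "subgroup L G" using less.prems(1) by (rule normal_imp_subgroup)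
    show ?case
    proof (cases "L = {\<one>}")
      case False
      define A where "A = {J. J \<lhd> G \<and> J \<subset> L}"
      have "A \<subseteq> Pow L" by (auto simp: A_def)
      then have "finite A" using finite_subset[of A "Pow L"] Ls by simp
      moreover have "{\<one>} \<in> A" using one_is_normal False subgroup.one_closed[OF Ls] by (auto simp: A_def)
      ultimately obtain J where J: "J \<in> A" "\<forall>X\<in>A. J \<subseteq> X \<longrightarrow> J = X"
        using finite_has_maximal[of A] by blast
      have LJ: "chief_factor G L J"
        unfolding chief_factor_iff using J less.prems(1) by (auto simp: A_def)
      have Jn: "J \<lhd> G" "J \<subset> L" using J by (auto simp: A_def)
      have Js: "subgroup J G" using Jn(1) by (rule normal_imp_subgroup)
      have "card J < card L" using Jn(2) Ls by (simp add: psubset_card_mono)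
      then have IH: "\<forall>w\<in>W \<inter> J. conjug y w = w" using less.hyps Jn less.prems by blast
      show ?thesis
      proof
        fix w assume w: "w \<in> W \<inter> L"
        have wG: "w \<in> carrier G" using w WG by simp
        have c: "conjug y w \<otimes> inv w \<in> W" using w inv W(1) by (simp add: subgroup.m_closed subgroup.m_inv_closed)
        show "conjug y w = w"
        proof (cases "p dvd card L div card J")
          case True
          then have "conjug y w \<otimes> inv w \<in> J" using y(1) w LJ less.prems(2) unfolding R_def by blast
          then have "conjug y (conjug y w \<otimes> inv w) = conjug y w \<otimes> inv w" using IH c by blast
          moreover have "(conjug y w \<otimes> inv w) [^] (p ^ k) = \<one>"
            using pow_card_subgroup[OF W(1) _ c] W by simp
          ultimately show ?thesis using coprime_fix[OF yG m(1) wG] m(2) by blast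
        next
          case False
          interpret Q: fin_group "G Mod J" using Jn(1) by (rule mod_fin_group)
          have sub: "subgroup ((\<lambda>x. J #> x) ` L) (G Mod J)"
            using mod_image_normal[OF Jn(1) less.prems(1)] by (rule normal_imp_subgroup)
          let ?m = "card L div card J"
          have cm: "card ((\<lambda>x. J #> x) ` L) = ?m"
            using card_coset_image[OF Js Ls] Jn by blast
          have "J #> w \<in> (\<lambda>x. J #> x) ` L" using w by blast
          then have "(J #> w) [^]\<^bsub>G Mod J\<^esub> ?m = \<one>\<^bsub>G Mod J\<^esub>"
            using Q.pow_card_subgroup[OF sub Q.fin_sub[OF sub]] cm by metis
          then have "J #> (w [^] ?m) = J" using mod_pow[OF Jn(1) wG] by simp
          then have "w [^] ?m \<in> J" using coset_join1 Js wG by blast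
          moreover have "w [^] (p ^ k) \<in> J"
            using pow_card_subgroup[OF W(1), of w] W w subgroup.one_closed[OF Js] by simp
          moreover have "coprime ?m (p ^ k)"
            using prime_imp_coprime[OF p False] by (simp add: coprime_commute)
          ultimately have "w \<in> J" using mem_of_coprime_pow_mem[OF Js wG] by blast
          then show ?thesis using IH w by blast
        qed
      qed
    qed (use yG in auto)
  qed
  from this[OF Kn] show "w \<in> W \<Longrightarrow> w \<in> K \<Longrightarrow> conjug y w = w" by blast
qed

lemma p_factor: "\<exists>k. card N = p ^ k * card K"
proof (rule ccontr)
  assume no: "\<nexists>k. card N = p ^ k * card K"
  then have small: "x \<in> K" if "x \<in> P" "x [^] q = \<one>" for x
    using p_factor_of_element that by blast
  have "reg_centralizes p N"
    unfolding reg_centralizes_def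
  proof (intro allI impI)
    fix U y k
    assume U: "subgroup U G" "U \<subseteq> N" "card U = p ^ k" and y: "y \<in> N" "p_reg p y" and inv: "\<forall>u\<in>U. conjug y u \<in> U"
    have UG: "u \<in> carrier G" if "u \<in> U" for u using that U NG by blast
    obtain g where g: "g \<in> N" "\<forall>u\<in>U. conjug g u \<in> P" using p_sub_conj_sylow[OF Ns P p U] .
    have gG: "g \<in> carrier G" using g NG by simp
    have "good_exp p q U"
    proof -
      have "a \<otimes> b = b \<otimes> a" if com: "\<forall>a\<in>P. \<forall>b\<in>P. a \<otimes> b = b \<otimes> a" and ab: "a \<in> U" "b \<in> U" for a b
      proof -
        have "conjug g a \<otimes> conjug g b = conjug g b \<otimes> conjug g a" using com ab g(2) by blast
        then have "conjug g (a \<otimes> b) = conjug g (b \<otimes> a)" using gG UG ab by (simp add: conjug_mult)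
        then show ?thesis using gG UG ab by simp
      qed
      then show ?thesis using good unfolding good_exp_def by blast
    qed
    \<comment> \<open>Conjugated into \<open>P\<close> by \<open>g\<close>, such an element falls
      into \<open>K\<close>; there \<open>regular_centralizes_below\<close> applies because
      \<open>N\<close> lies in \<open>R\<close>.\<close>
    moreover have "conjug y u = u" if u: "u \<in> U" "u [^] q = \<one>" for u
    proof -
      have "conjug g u [^] q = \<one>" using u gG UG by (simp flip: conjug_pow)
      then have gu: "conjug g u \<in> K" using small g(2) u by blast
      have "conjug (inv g) (conjug g u) \<in> K" by (rule normal_conjug[OF Kn inv_closed[OF gG] gu])
      then have "u \<in> K" using gG UG[OF u(1)] by simp
      then show ?thesis
        using regular_centralizes_below[OF _ y(2) U(1,3)] inv u(1) y(1) N_subset_R by blast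
    qed
    ultimately show "\<forall>u\<in>U. conjug y u = u"
      using centralizes_of_small_exponent[OF p NG[OF y(1)] y(2) U(1,3) inv] by blast
  qed
  moreover have "P \<noteq> {\<one>}"
  proof
    assume "P = {\<one>}"
    then have "\<not> p dvd card N" using Pidx by simp
    moreover obtain d where "card N = card K * d" using card_dvd_sub[OF Ks Ns] KN by blast
    ultimately show False using pdvd card_sub_pos[OF Ks] by simp
  qed
  ultimately obtain M where M: "subgroup M G" "M \<subset> N" "\<forall>y\<in>N. p_reg p y \<longrightarrow> y \<in> M"
    using regular_elements_proper[OF p Ns _ P] by blast
  \<comment> \<open>Nothing says that \<open>M\<close> is normal in \<open>G\<close>, so it is
    replaced by the subgroup generated by the \<open>p'\<close>-elements of \<open>N\<close>, which
    is. By \<open>maxi\<close> that subgroup lies in \<open>K\<close>, and a \<open>p\<close>-power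
    of every element of \<open>N\<close> is a \<open>p'\<close>-element.\<close>
  let ?S = "{y \<in> N. p_reg p y}"
  let ?E = "generate G ?S"
  have SG: "?S \<subseteq> carrier G" using NG by auto
  have "?E \<lhd> G"
  proof (rule normalI_conjug[OF generate_is_subgroup[OF SG]])
    fix g x assume g: "g \<in> carrier G" and x: "x \<in> ?E"
    have "conjug g s \<in> ?E" if s: "s \<in> ?S" for s
    proof -
      have sG: "s \<in> carrier G" using s SG by blast
      obtain m where m: "coprime m p" "s [^] (m::nat) = \<one>" using s by (auto simp: p_reg_def)
      have "conjug g s [^] m = \<one>" using g sG m(2) by (simp flip: conjug_pow)
      then have "p_reg p (conjug g s)" using m(1) unfolding p_reg_def by blast
      then show ?thesis using s normal_conjug[OF Nn g] by (intro generate.incl) auto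
    qed
    then show "conjug g x \<in> ?E" using generate_conjug[OF g SG] x by blast
  qed
  moreover have "?E \<subseteq> M" using M by (intro generate_subgroup_incl) auto
  ultimately have EK: "?E \<subseteq> K" using maxi[of ?E] M(2) by blast
  obtain a where a: "\<forall>g\<in>carrier G. p_reg p (g [^] (p ^ a))" using p_reg_power_ex[OF p] .
  have "\<exists>a. g [^] (p ^ a) \<in> K" if g: "g \<in> N" for g
  proof -
    have "g [^] (p ^ a) \<in> ?S" using a g NG subgroup_pow[OF Ns g] by simp
    then have "g [^] (p ^ a) \<in> ?E" by (rule generate.incl)
    then show ?thesis using EK by blast
  qed
  then show False using no index_p_power[OF Ns p Ks] KN by blast
qed

text \<open>As \<open>G = K M\<close>, only conjugation by \<open>M\<close> needs checking:
  \<open>K\<close> lies in \<open>X <#> K\<close> and so normalizes it.\<close>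

lemma set_mult_K_normal:
  assumes X: "subgroup X G" and fac: "\<And>g. g \<in> carrier G \<Longrightarrow> \<exists>k\<in>K. \<exists>m\<in>M. g = k \<otimes> m"
    and M: "M \<subseteq> carrier G" and inv: "\<And>m x. m \<in> M \<Longrightarrow> x \<in> X \<Longrightarrow> conjug m x \<in> X"
  shows "X <#> K \<lhd> G"
proof (rule normalI_conjug)
  show XK: "subgroup (X <#> K) G" by (rule set_mult_normal_subgroup[OF X Kn])
  have c: "X \<subseteq> X <#> K" "K \<subseteq> X <#> K" using set_mult_contains[OF X Ks] by auto
  have XG: "x \<in> carrier G" if "x \<in> X" for x using that X subgroup.mem_carrier by fast
  fix g y assume g: "g \<in> carrier G" and y: "y \<in> X <#> K"
  obtain k m where km: "k \<in> K" "m \<in> M" "g = k \<otimes> m" using fac[OF g] by blast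
  obtain x l where xl: "x \<in> X" "l \<in> K" "y = x \<otimes> l" using y by (auto simp: set_mult_def)
  have G1: "k \<in> carrier G" "m \<in> carrier G" "x \<in> carrier G" "l \<in> carrier G"
    using km xl KG M XG by auto
  have "conjug m y = conjug m x \<otimes> conjug m l" using G1 by (simp add: xl(3) conjug_mult)
  moreover have "conjug m x \<in> X <#> K" using inv[OF km(2) xl(1)] c by blast
  moreover have "conjug m l \<in> X <#> K" using normal_conjug[OF Kn G1(2) xl(2)] c by blast
  ultimately have "conjug m y \<in> X <#> K" using XK by (simp add: subgroup.m_closed)
  then have "conjug k (conjug m y) \<in> X <#> K" using conjug_subgroup_mem[OF XK] km c by blast
  then show "conjug g y \<in> X <#> K" using G1 by (simp add: km(3) xl(3) conjug_conjug)
qed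

lemma prime_step: "card N = p * card K"
proof -
  obtain k where k: "card N = p ^ k * card K" using p_factor by blast
  obtain j where j: "card P = p ^ j" by (rule Pcard)
  have KN': "K \<subseteq> N" using KN by blast
  have kp: "\<exists>x\<in>K. \<exists>y\<in>P. n = x \<otimes> y" if n: "n \<in> N" for n
    using sylow_factor[OF Ns p P Ks KN' k n] by blast
  have modP: "\<exists>u\<in>P. K #> v = K #> u" if v: "v \<in> N" for v
  proof -
    obtain x u where xu: "x \<in> K" "u \<in> P" "v = x \<otimes> u" using kp[OF v] by blast
    have "v \<otimes> inv u = x" using xu KG PG by (simp add: m_assoc)
    then have "K #> v = K #> u" using coset_eq_iff[OF Ks NG[OF v] PG[OF xu(2)]] xu by simp
    then show ?thesis using xu by blast
  qed
  have fixed_cong: "conjug g v \<otimes> inv v \<in> K \<longleftrightarrow> conjug g u \<otimes> inv u \<in> K"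
    if "g \<in> carrier G" "u \<in> carrier G" "v \<in> carrier G" "K #> v = K #> u" for g u v
    using that mod_fixed_iff[OF Kn, of g u] mod_fixed_iff[OF Kn, of g v] by simp
  define M where "M = {g \<in> carrier G. \<forall>u\<in>P. conjug g u \<in> P}"
  have M: "subgroup M G" unfolding M_def by (rule normalizer_subgroup[OF subgroup_self Ps])
  have MG: "M \<subseteq> carrier G" by (auto simp: M_def)
  have PM: "P \<subseteq> M" using PG conjug_subgroup_mem[OF Ps] by (auto simp: M_def)
  \<comment> \<open>Frattini argument: \<open>G\<close> is \<open>N\<close> times the normalizer
    \<open>M\<close> of \<open>P\<close>, and \<open>N\<close> is \<open>K\<close> times
    \<open>P\<close>, with \<open>P\<close> inside \<open>M\<close>.\<close>
  have fac: "\<exists>x\<in>K. \<exists>m\<in>M. g = x \<otimes> m" if g: "g \<in> carrier G" for g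
  proof -
    have PGs: "P \<subseteq> carrier G" using PG by blast
    have "sylow_in p N (conjug g ` P)"
      unfolding sylow_in_def
      using subgroup_conjug_image[OF Ps g] normal_conjug[OF Nn g] PN Pidx j
        card_image[OF inj_on_conjug[OF g PGs]] by auto
    then obtain n where n: "n \<in> N" "conjug n ` conjug g ` P = P" using sylow_conj_ex[OF Ns p P] by blast
    have nG: "n \<in> carrier G" using n NG by simp
    have "conjug (n \<otimes> g) u \<in> P" if u: "u \<in> P" for u
    proof -
      have "conjug n (conjug g u) \<in> conjug n ` conjug g ` P" using u by (intro imageI)
      then show ?thesis using n(2) nG g PG[OF u] by (simp add: conjug_conjug)
    qed
    then have ng: "n \<otimes> g \<in> M" using nG g by (simp add: M_def)
    obtain x y where xy: "x \<in> K" "y \<in> P" "inv n = x \<otimes> y"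
      using kp[OF subgroup.m_inv_closed[OF Ns n(1)]] by blast
    have xyG: "x \<in> carrier G" "y \<in> carrier G" using xy KG PG by auto
    have "g = inv n \<otimes> (n \<otimes> g)" using nG g by simp
    also have "\<dots> = x \<otimes> (y \<otimes> (n \<otimes> g))" using xyG nG g by (simp add: xy(3) m_assoc)
    finally show ?thesis using xy ng PM subgroup.m_closed[OF M] by blast
  qed
  have MK: "m \<in> M \<Longrightarrow> u \<in> P \<Longrightarrow> conjug m u \<in> P" for m u by (simp add: M_def)
  show ?thesis
  proof (cases "\<forall>y\<in>M \<inter> R. p_reg p y \<longrightarrow> (\<forall>x\<in>P. conjug y x \<otimes> inv x \<in> K)")
    case True
    obtain a where a: "\<forall>g\<in>carrier G. p_reg p (g [^] (p ^ a))" using p_reg_power_ex[OF p] .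
    \<comment> \<open>Modulo \<open>K\<close> the element \<open>r\<close> equals its factor
      \<open>m\<close>, which again lies in \<open>R\<close> because \<open>K\<close> does. Thus the
      \<open>p'\<close>-elements of \<open>M \<inter> R\<close> decide the action of all of
      \<open>R\<close> on \<open>N/K\<close>.\<close>
    have act: "conjug (r [^] (p ^ a)) v \<otimes> inv v \<in> K" if r: "r \<in> R" and v: "v \<in> N" for r v
    proof -
      have rG: "r \<in> carrier G" using r R_carrier by simp
      obtain x m where xm: "x \<in> K" "m \<in> M" "r = x \<otimes> m" using fac[OF rG] by blast
      have G1: "x \<in> carrier G" "m \<in> carrier G" using xm KG MG by auto
      have "inv x \<otimes> r = m" using G1 by (simp add: xm(3))
      moreover have "inv x \<in> R" using xm(1) KN N_subset_R subgroup.m_inv_closed[OF Ks] by blast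
      ultimately have mR: "m \<in> R" using r subgroup.m_closed[OF R_subgroup] by metis
      let ?m = "m [^] (p ^ a)"
      have mm: "?m \<in> M \<inter> R" using subgroup_pow[OF M xm(2)] subgroup_pow[OF R_subgroup mR] by blast
      have "r \<otimes> inv m = x" using G1 by (simp add: xm(3) m_assoc)
      then have "K #> r = K #> m" using coset_eq_iff[OF Ks rG G1(2)] xm(1) by simp
      then have rm: "K #> (r [^] (p ^ a)) = K #> ?m"
        using mod_pow[OF Kn rG] mod_pow[OF Kn G1(2)] by simp
      obtain u where u: "u \<in> P" "K #> v = K #> u" using modP[OF v] by blast
      have "conjug ?m u \<otimes> inv u \<in> K" using True mm a G1(2) u(1) by blast
      then have "conjug ?m v \<otimes> inv v \<in> K" using fixed_cong[OF _ PG[OF u(1)] NG[OF v] u(2)] G1 by simp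
      then show ?thesis
        using mod_fixed_iff[OF Kn nat_pow_closed[OF rG] NG[OF v]] mod_fixed_iff[OF Kn nat_pow_closed[OF G1(2)] NG[OF v]] rm
        by metis
    qed
    have triv: "conjug r v \<otimes> inv v \<in> K" if "r \<in> R" "v \<in> N" for r v
      using chief_fixed[OF ch p k R_normal _ that] act by blast
    show ?thesis
    proof (rule chief_prime_order[OF ch p k])
      fix g h v assume g: "g \<in> carrier G" and h: "h \<in> carrier G" and v: "v \<in> N"
      have w: "conjug (h \<otimes> g) v \<in> N" using g h v by (intro normal_conjug[OF Nn]) auto
      have "conjug ((g \<otimes> h) \<otimes> inv (h \<otimes> g)) (conjug (h \<otimes> g) v) \<otimes> inv (conjug (h \<otimes> g) v) \<in> K"
        by (rule triv[OF commutator_in_R[OF g h] w])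
      moreover have "conjug ((g \<otimes> h) \<otimes> inv (h \<otimes> g)) (conjug (h \<otimes> g) v) = conjug (g \<otimes> h) v"
        using g h NG[OF v] by (simp add: conjug_conjug m_assoc inv_mult_group)
      ultimately show "conjug (g \<otimes> h) v \<otimes> inv (conjug (h \<otimes> g) v) \<in> K" by simp
    next
      show "conjug (g [^] (p - 1)) v \<otimes> inv v \<in> K" if "g \<in> carrier G" "v \<in> N" for g v
        using triv[OF pow_in_R] that by blast
    qed
  next
    case False
    then obtain y0 x0 where y0: "y0 \<in> M" "y0 \<in> R" "p_reg p y0" and x0: "x0 \<in> P" "conjug y0 x0 \<otimes> inv x0 \<notin> K"
      by blast
    have y0G: "y0 \<in> carrier G" using y0 MG by blast
    let ?F = "P \<inter> K"
    have FG: "?F \<subseteq> carrier G" using PG by blast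
    have Fs: "subgroup ?F G" using Ps Ks by (rule subgroups_Inter_pair)
    have y0F: "conjug y0 f = f" if "f \<in> ?F" for f
      using regular_centralizes_below[OF y0(2,3) Ps j MK[OF y0(1)]] that by blast
    have Finv: "conjug m f \<in> ?F" if "m \<in> M" "f \<in> ?F" for m f
      using that MK normal_conjug[OF Kn] MG by blast
    \<comment> \<open>\<open>y0\<close> centralizes \<open>?F\<close>, so its commutators with
      \<open>P\<close> lie in \<open>Q\<close>. Since \<open>N/K\<close> is elementary abelian,
      commutators and \<open>p\<close>-th powers of \<open>P\<close> lie in \<open>?F\<close>; so
      they are centralized by \<open>Q\<close>.\<close>
    define Q where "Q = {u \<in> P. \<forall>f\<in>?F. conjug u f = f}"
    have Q: "subgroup Q G" unfolding Q_def by (rule centralizer_subgroup[OF Ps FG])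
    have QP: "Q \<subseteq> P" by (auto simp: Q_def)
    have QG: "u \<in> carrier G" if "u \<in> Q" for u using that QP PG by blast
    have Qinv: "conjug m u \<in> Q" if m: "m \<in> M" and u: "u \<in> Q" for m u
    proof -
      have mG: "m \<in> carrier G" using m MG by blast
      have "conjug (conjug m u) f = f" if f: "f \<in> ?F" for f
      proof -
        have fG: "f \<in> carrier G" using f FG by blast
        define e where "e = conjug (inv m) f"
        have e: "e \<in> ?F" unfolding e_def by (rule Finv[OF subgroup.m_inv_closed[OF M m] f])
        have eG: "e \<in> carrier G" using e FG by blast
        have fe: "f = conjug m e" using mG fG by (simp add: e_def)
        have "conjug (conjug m u) f = conjug m (conjug u e)"
          unfolding fe using mG QG[OF u] eG by (rule conjug_distrib)
        also have "conjug u e = e" using u e by (simp add: Q_def)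
        finally show ?thesis using fe by simp
      qed
      then show ?thesis using MK[OF m] u by (simp add: Q_def)
    qed
    have comQ: "conjug y0 x \<otimes> inv x \<in> Q" if x: "x \<in> P" for x
    proof -
      have "conjug (conjug y0 x \<otimes> inv x) f = f" if f: "f \<in> ?F" for f
      proof (rule commutator_centralizes[OF y0G PG[OF x] FG y0F _ f])
        show "conjug (inv x) f \<in> ?F" if "f \<in> ?F" for f
          using that Finv PM subgroup.m_inv_closed[OF Ps x] by blast
      qed
      moreover have "conjug y0 x \<otimes> inv x \<in> P"
        using MK[OF y0(1) x] x Ps by (simp add: subgroup.m_closed subgroup.m_inv_closed)
      ultimately show ?thesis by (simp add: Q_def)
    qed
    have cen: "f \<otimes> u = u \<otimes> f" if "f \<in> ?F" "u \<in> Q" for f u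
    proof -
      have "conjug u f = f" using that by (simp add: Q_def)
      then show ?thesis using conjug_eq_iff_commute[of u f] that QG FG by auto
    qed
    have comF: "a \<otimes> b \<otimes> inv a \<otimes> inv b \<in> ?F" if "a \<in> P" "b \<in> P" for a b
      using that chief_elementary(1)[OF ch p k] PN Ps by (auto simp: subgroup.m_closed subgroup.m_inv_closed)
    have powF: "a [^] p \<in> ?F" if "a \<in> P" for a
      using that chief_elementary(2)[OF ch p k] PN subgroup_pow[OF Ps] by blast
    have qpow: "(a \<otimes> b) [^] q = a [^] q \<otimes> b [^] q" if "a \<in> Q" "b \<in> Q" for a b
    proof -
      have ab: "a \<in> P" "b \<in> P" using that QP by auto
      show ?thesis
        by (rule good_exp_pow_mult[OF good Ps ab cen[OF comF[OF ab] that(1)]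
              cen[OF comF[OF ab] that(2)] cen[OF powF[OF ab(1)] that(2)]])
    qed
    have powqF: "a [^] q \<in> ?F" if "a \<in> P" for a
    proof -
      obtain r where "q = p * r" using good_exp_dvd[OF good] by blast
      then have "a [^] q = (a [^] p) [^] r" using PG[OF that] by (simp add: nat_pow_pow)
      then show ?thesis using subgroup_pow[OF Fs powF[OF that]] by simp
    qed
    define E where "E = {u \<in> Q. u [^] q = \<one>}"
    have E: "subgroup E G"
    proof (rule subgroupI)
      show "E \<subseteq> carrier G" using QG by (auto simp: E_def)
      have "\<one> \<in> E" using subgroup.one_closed[OF Q] by (simp add: E_def)
      then show "E \<noteq> {}" by blast
      show "inv a \<in> E" if "a \<in> E" for a
        using that QG subgroup.m_inv_closed[OF Q] by (simp add: E_def nat_pow_inv)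
      show "a \<otimes> b \<in> E" if "a \<in> E" "b \<in> E" for a b
        using that qpow subgroup.m_closed[OF Q] by (simp add: E_def)
    qed
    have EP: "E \<subseteq> P" using QP by (auto simp: E_def)
    have Einv: "conjug m u \<in> E" if "m \<in> M" "u \<in> E" for m u
      using that Qinv MG QG by (auto simp: E_def simp flip: conjug_pow)
    \<comment> \<open>Irreducibility of \<open>N/K\<close>, in the form used for both
      \<open>Q\<close> and \<open>E\<close>.\<close>
    have full: "X <#> K = N"
      if X: "subgroup X G" "X \<subseteq> P" "\<And>m x. m \<in> M \<Longrightarrow> x \<in> X \<Longrightarrow> conjug m x \<in> X" "\<not> X \<subseteq> K" for X
    proof (rule ccontr)
      assume "X <#> K \<noteq> N"
      moreover have "X <#> K \<subseteq> N" using X PN KN by (intro set_mult_subset[OF Ns]) auto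
      moreover have "X <#> K \<lhd> G" by (rule set_mult_K_normal[OF X(1) fac MG X(3)])
      ultimately have "X <#> K \<subseteq> K" using maxi by blast
      then show False using X(4) set_mult_contains(1)[OF X(1) Ks] by blast
    qed
    have modX: "\<exists>u\<in>X. K #> v = K #> u" if X: "subgroup X G" "X <#> K = N" and v: "v \<in> N" for X v
    proof -
      obtain u l where ul: "u \<in> X" "l \<in> K" "v = u \<otimes> l" using v X(2) by (auto simp: set_mult_def)
      have uG: "u \<in> carrier G" using ul X(1) subgroup.mem_carrier by fast
      have "v \<otimes> inv u \<in> K" using normal_conjug[OF Kn uG ul(2)] by (simp add: ul(3) conjug_def)
      then have "K #> v = K #> u" using coset_eq_iff[OF Ks NG[OF v] uG] by simp
      then show ?thesis using ul by blast
    qed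
    show ?thesis
    proof (cases "E \<subseteq> K")
      case True
      \<comment> \<open>Represent the coset of \<open>x0\<close> by \<open>u\<close> in
        \<open>Q\<close>. The commutator of \<open>y0\<close> and \<open>u\<close> has trivial
        \<open>q\<close>-th power, as \<open>y0\<close> fixes \<open>u [^] q\<close>; so it lies in
        \<open>E\<close>, hence in \<open>K\<close>, against the choice of
        \<open>x0\<close>.\<close>
      have "\<not> Q \<subseteq> K" using comQ[OF x0(1)] x0(2) by blast
      then have "Q <#> K = N" using full[OF Q QP Qinv] by blast
      moreover have x0N: "x0 \<in> N" using x0(1) PN by blast
      ultimately obtain u where u: "u \<in> Q" "K #> x0 = K #> u" using modX[OF Q] by blast
      have uP: "u \<in> P" using u QP by blast
      have yu: "conjug y0 u \<in> Q" "inv u \<in> Q" using Qinv[OF y0(1) u(1)] subgroup.m_inv_closed[OF Q u(1)] by auto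
      have "(conjug y0 u \<otimes> inv u) [^] q = conjug y0 (u [^] q) \<otimes> inv (u [^] q)"
        using qpow[OF yu] y0G QG[OF u(1)] by (simp add: conjug_pow nat_pow_inv)
      also have "conjug y0 (u [^] q) = u [^] q" by (rule y0F[OF powqF[OF uP]])
      finally have "conjug y0 u \<otimes> inv u \<in> E"
        using comQ[OF uP] QG[OF u(1)] by (simp add: E_def)
      then have "conjug y0 u \<otimes> inv u \<in> K" using True by blast
      then have "conjug y0 x0 \<otimes> inv x0 \<in> K"
        using fixed_cong[OF y0G QG[OF u(1)] NG[OF x0N] u(2)] by blast
      then show ?thesis using x0(2) by blast
    next
      case False
      then have EN: "E <#> K = N" using full[OF E EP Einv] by blast
      obtain S where S: "sylow_in p (carrier G) S" using sylow_ex[OF subgroup_self p] .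
      have Ss: "subgroup S G" using S by (simp add: sylow_in_def)
      have SG: "s \<in> carrier G" if "s \<in> S" for s using that Ss subgroup.mem_carrier by fast
      obtain i where i: "card S = p ^ i" using S by (auto simp: sylow_in_def)
      obtain v where v: "v \<in> N" "v \<notin> K" "\<forall>s\<in>S. conjug s v \<otimes> inv v \<in> K"
        using chief_fixed_point[OF ch p k Ss i] .
      \<comment> \<open>Being fixed by \<open>S\<close> modulo \<open>K\<close> depends on the coset
        only, so \<open>v\<close> may be exchanged for a representative of exponent
        \<open>q\<close>.\<close>
      obtain e where e: "e \<in> E" "K #> v = K #> e" using modX[OF E EN v(1)] by blast
      have eP: "e \<in> P" using e EP by blast
      have "e \<notin> K"
      proof
        assume "e \<in> K"
        then have "K #> v = K" using e(2) coset_join2[OF PG[OF eP] Ks] by simp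
        then show False using v(2) coset_join1[OF _ NG[OF v(1)] Ks] by blast
      qed
      moreover have "e [^] q = \<one>" using e by (simp add: E_def)
      moreover have "conjug s e \<otimes> inv e \<in> K" if "s \<in> S" for s
        using fixed_cong[OF SG[OF that] PG[OF eP] NG[OF v(1)] e(2)] v(3) that by blast
      ultimately show ?thesis using prime_of_fixed_element[OF eP _ _ S _ k] by blast
    qed
  qed
qed

end

section \<open>Induction over normal subgroups and the theorem\<close>

context fin_group
begin

lemma card_mod_image:
  assumes K: "subgroup K G" and S: "subgroup S G"
  shows "card ((\<lambda>x. K #> x) ` S) * card (K \<inter> S) = card S"
proof -
  have I: "subgroup (K \<inter> S) G" using K S by (rule subgroups_Inter_pair)
  have SG: "x \<in> carrier G" if "x \<in> S" for x using that S subgroup.mem_carrier by fast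
  have int: "(K #> x) \<inter> S = (K \<inter> S) #> x" if x: "x \<in> S" for x
  proof (intro equalityI subsetI)
    fix z assume z: "z \<in> (K #> x) \<inter> S"
    then obtain h where h: "h \<in> K" "z = h \<otimes> x" by (auto simp: r_coset_def)
    have "h = z \<otimes> inv x" using h SG[OF x] subgroup.mem_carrier[OF K h(1)] by (simp add: m_assoc)
    then have "h \<in> S" using z x S by (simp add: subgroup.m_closed subgroup.m_inv_closed)
    then show "z \<in> (K \<inter> S) #> x" using h by (auto simp: r_coset_def)
  next
    fix z assume "z \<in> (K \<inter> S) #> x"
    then show "z \<in> (K #> x) \<inter> S" using x subgroup.m_closed[OF S] by (auto simp: r_coset_def)
  qed
  have "inj_on (\<lambda>C. C \<inter> S) ((\<lambda>x. K #> x) ` S)"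
  proof (rule inj_onI)
    fix C D assume C: "C \<in> (\<lambda>x. K #> x) ` S" and D: "D \<in> (\<lambda>x. K #> x) ` S" and eq: "C \<inter> S = D \<inter> S"
    obtain x y where xy: "x \<in> S" "y \<in> S" "C = K #> x" "D = K #> y" using C D by auto
    have "x \<in> K #> y" using rcos_self[OF SG[OF xy(1)] K] xy eq by blast
    then show "C = D" using repr_independence[OF _ SG[OF xy(2)] K] xy by blast
  qed
  then have "card ((\<lambda>x. K #> x) ` S) = card ((\<lambda>C. C \<inter> S) ` (\<lambda>x. K #> x) ` S)" by (rule card_image[symmetric])
  also have "(\<lambda>C. C \<inter> S) ` (\<lambda>x. K #> x) ` S = (\<lambda>x. (K \<inter> S) #> x) ` S"
    unfolding image_image by (rule image_cong[OF refl int])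
  finally show ?thesis using lagrange_sub[OF I S] by simp
qed

text \<open>A Sylow \<open>p\<close>-subgroup of \<open>L\<close> above \<open>P \<inter> L\<close>
  can be conjugated into \<open>P\<close>, and normality keeps it in \<open>L\<close>; so it is not
  larger than \<open>P \<inter> L\<close>.\<close>

lemma sylow_in_normal:
  assumes p: "prime p" and N: "subgroup N G" and L: "L \<lhd> G" "L \<subseteq> N" and P: "sylow_in p N P"
  shows "sylow_in p L (P \<inter> L)"
proof -
  have Ls: "subgroup L G" using L(1) by (rule normal_imp_subgroup)
  have Ps: "subgroup P G" using P by (simp add: sylow_in_def)
  obtain k where k: "card P = p ^ k" using P by (auto simp: sylow_in_def)
  have I: "subgroup (P \<inter> L) G" using Ps Ls by (rule subgroups_Inter_pair)
  have "card (P \<inter> L) dvd p ^ k" using card_dvd_sub[OF I Ps] k by simp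
  then obtain i where i: "card (P \<inter> L) = p ^ i" by (rule prime_power_dvd_obtain[OF p])
  obtain S where S: "sylow_in p L S" "P \<inter> L \<subseteq> S" using p_sub_subset_sylow[OF Ls p I Int_lower2 i] .
  have S': "subgroup S G" "S \<subseteq> L" using S by (auto simp: sylow_in_def)
  obtain j where j: "card S = p ^ j" using S by (auto simp: sylow_in_def)
  have SN: "S \<subseteq> N" using S' L by blast
  obtain g where g: "g \<in> N" "\<forall>u\<in>S. conjug g u \<in> P" using p_sub_conj_sylow[OF N P p S'(1) SN j] .
  have gG: "g \<in> carrier G" using g(1) N subgroup.mem_carrier by fast
  have "conjug g ` S \<subseteq> P \<inter> L" using g(2) S'(2) normal_conjug[OF L(1) gG] by blast
  moreover have "card (conjug g ` S) = card S"
    by (rule card_image[OF inj_on_conjug[OF gG subgroup.subset[OF S'(1)]]])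
  moreover have "finite (P \<inter> L)" using Ps by simp
  ultimately have "card S \<le> card (P \<inter> L)" using card_mono[of "P \<inter> L" "conjug g ` S"] by simp
  then have "P \<inter> L = S" using S(2) S'(1) by (intro card_seteq) auto
  then show ?thesis using S by simp
qed

text \<open>Irreducibility of \<open>N/K\<close> gives \<open>A <#> K = N\<close>, so the factor
  reappears as \<open>A/(A \<inter> K)\<close>. This passes a top factor to a smaller normal
  subgroup unless \<open>K\<close> contains every proper one, the case of
  \<open>chief_step\<close>.\<close>

lemma chief_factor_inter:
  assumes ch: "chief_factor G N K" and A: "A \<lhd> G" "A \<subseteq> N" "\<not> A \<subseteq> K"
  shows "chief_factor G A (A \<inter> K)" and "card N * card (A \<inter> K) = card A * card K"
proof -
  note Nn = chief_normal(1)[OF ch] and Kn = chief_normal(2)[OF ch]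
  have Ks: "subgroup K G" and As: "subgroup A G" using Kn A(1) normal_imp_subgroup by auto
  have full: "D <#> K = K \<or> D <#> K = N" if D: "D \<lhd> G" "D \<subseteq> A" for D
  proof -
    have Ds: "subgroup D G" using D(1) by (rule normal_imp_subgroup)
    have "D <#> K \<lhd> G"
    proof (rule normalI_conjug[OF set_mult_normal_subgroup[OF Ds Kn]])
      fix g y assume g: "g \<in> carrier G" and y: "y \<in> D <#> K"
      obtain d l where dl: "d \<in> D" "l \<in> K" "y = d \<otimes> l" using y by (auto simp: set_mult_def)
      have "conjug g y = conjug g d \<otimes> conjug g l"
        using g subgroup.mem_carrier[OF Ds dl(1)] subgroup.mem_carrier[OF Ks dl(2)] by (simp add: dl(3) conjug_mult)
      then show "conjug g y \<in> D <#> K"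
        using normal_conjug[OF D(1) g dl(1)] normal_conjug[OF Kn g dl(2)] by (auto simp: set_mult_def)
    qed
    moreover have "D <#> K \<subseteq> N"
      using D A chief_psubset[OF ch] by (intro set_mult_subset[OF chief_subgroups(1)[OF ch]]) auto
    ultimately show ?thesis using chief_between[OF ch] set_mult_contains(2)[OF Ds Ks] by blast
  qed
  have contains: "D \<subseteq> D <#> K" if "D \<lhd> G" for D
    using set_mult_contains(1)[OF normal_imp_subgroup[OF that] Ks] .
  show "chief_factor G A (A \<inter> K)"
    unfolding chief_factor_iff
  proof (intro conjI allI impI)
    show "A \<inter> K \<lhd> G" using A(1) Kn by (rule normal_subgroup_intersect)
    show "A \<lhd> G" by (rule A(1))
    show "A \<inter> K \<subset> A" using A(3) by blast
    fix D assume D: "D \<lhd> G" "A \<inter> K \<subseteq> D" "D \<subseteq> A"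
    have Ds: "subgroup D G" using D(1) by (rule normal_imp_subgroup)
    from full[OF D(1,3)] show "D = A \<inter> K \<or> D = A"
    proof
      assume "D <#> K = K"
      then show ?thesis using contains[OF D(1)] D by blast
    next
      assume DK: "D <#> K = N"
      have "a \<in> D" if a: "a \<in> A" for a
      proof -
        have "a \<in> D <#> K" using a A(2) DK by blast
        then obtain d l where dl: "d \<in> D" "l \<in> K" "a = d \<otimes> l" by (auto simp: set_mult_def)
        have "l = inv d \<otimes> a" using subgroup.mem_carrier[OF Ds dl(1)] subgroup.mem_carrier[OF Ks dl(2)] by (simp add: dl(3))
        moreover have "inv d \<otimes> a \<in> A" using dl(1) D(3) a As by (blast intro: subgroup.m_closed subgroup.m_inv_closed)
        ultimately have "l \<in> D" using dl(2) D(2) by blast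
        then show ?thesis using dl subgroup.m_closed[OF Ds] by blast
      qed
      then show ?thesis using D(3) by blast
    qed
  qed
  have AK: "A <#> K = N"
    using full[OF A(1) subset_refl] contains[OF A(1)] A(3) by blast
  have "(\<lambda>x. K #> x) ` N \<subseteq> (\<lambda>x. K #> x) ` A"
  proof
    fix C assume "C \<in> (\<lambda>x. K #> x) ` N"
    then obtain a l where al: "a \<in> A" "l \<in> K" "C = K #> (a \<otimes> l)" using AK by (auto simp: set_mult_def)
    have G1: "a \<in> carrier G" "l \<in> carrier G"
      using subgroup.mem_carrier[OF As al(1)] subgroup.mem_carrier[OF Ks al(2)] by auto
    have "(a \<otimes> l) \<otimes> inv a \<in> K" using normal_conjug[OF Kn G1(1) al(2)] by (simp add: conjug_def)
    then have "C = K #> a" using al(3) coset_eq_iff[OF Ks] G1 by simp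
    then show "C \<in> (\<lambda>x. K #> x) ` A" using al(1) by blast
  qed
  then have "(\<lambda>x. K #> x) ` A = (\<lambda>x. K #> x) ` N" using A(2) by blast
  then have "card ((\<lambda>x. K #> x) ` N) * card (K \<inter> A) = card A" using card_mod_image[OF Ks As] by simp
  then show "card N * card (A \<inter> K) = card A * card K"
    using chief_card[OF ch] by (metis inf_commute mult.commute mult.left_commute)
qed

lemma chief_factors_prime:
  assumes p: "prime p" and N: "N \<lhd> G" and P: "sylow_in p N P" and good: "good_exp p q P"
    and IC: "\<And>x. x \<in> P \<Longrightarrow> x \<noteq> \<one> \<Longrightarrow> x [^] q = \<one> \<Longrightarrow> IC_Pi_property G (generate G {x})"
    and ch: "chief_factor G L K" "L \<subseteq> N" "p dvd card L div card K"
  shows "card L = p * card K"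
  using N P good IC ch
proof (induction "card N" arbitrary: N P L K rule: less_induct)
  case less
  have Ns: "subgroup N G" using less.prems(1) by (rule normal_imp_subgroup)
  \<comment> \<open>The hypotheses concern elements of \<open>P\<close> only, so they pass to the
    Sylow subgroup \<open>P \<inter> A\<close> of \<open>A\<close>.\<close>
  have IH: "card B = p * card C"
    if A: "A \<lhd> G" "A \<subseteq> N" "A \<noteq> N" and BC: "chief_factor G B C" "B \<subseteq> A" "p dvd card B div card C" for A B C
  proof (rule less.hyps[OF _ A(1) sylow_in_normal[OF p Ns A(1,2) less.prems(2)] _ _ BC])
    show "card A < card N" using A(2,3) Ns by (simp add: psubset_card_mono psubsetI)
    show "good_exp p q (P \<inter> A)" using less.prems(3) by (auto simp: good_exp_def)
    show "IC_Pi_property G (generate G {x})" if "x \<in> P \<inter> A" "x \<noteq> \<one>" "x [^] q = \<one>" for x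
      using less.prems(4) that by blast
  qed
  show ?case
  proof (cases "L = N")
    case False
    then show ?thesis using IH[of L L K] less.prems chief_normal(1) by blast
  next
    case True
    show ?thesis
    proof (cases "\<exists>A. A \<lhd> G \<and> A \<subseteq> N \<and> A \<noteq> N \<and> \<not> A \<subseteq> K")
      case True
      then obtain A where A: "A \<lhd> G" "A \<subseteq> N" "A \<noteq> N" "\<not> A \<subseteq> K" by blast
      have chN: "chief_factor G N K" using less.prems(5) \<open>L = N\<close> by simp
      note I = chief_factor_inter[OF chN A(1,2,4)]
      have Ks: "subgroup K G" by (rule chief_subgroups(2)[OF chN])
      have As: "subgroup A G" using A(1) by (rule normal_imp_subgroup)
      have AKs: "subgroup (A \<inter> K) G" by (rule chief_subgroups(2)[OF I(1)])
      obtain d where d: "card A = card (A \<inter> K) * d" using card_dvd_sub[OF AKs As] by blast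
      have Nd: "card N = card K * d"
        using I(2) card_sub_pos[OF AKs] by (simp add: d)
      have "p dvd d" using less.prems(7) \<open>L = N\<close> Nd card_sub_pos[OF Ks] by simp
      then have "p dvd card A div card (A \<inter> K)" using d card_sub_pos[OF AKs] by simp
      then have "card A = p * card (A \<inter> K)" using IH[OF A(1-3) I(1)] by blast
      then have "d = p" using d card_sub_pos[OF AKs] by simp
      then show ?thesis using Nd \<open>L = N\<close> by simp
    next
      case False
      have chN: "chief_factor G N K" using less.prems(5) \<open>L = N\<close> by simp
      have "chief_step G p q N K P"
      proof (intro chief_step.intro fin_group_axioms chief_step_axioms.intro p chN less.prems(2,3,4))
        show "p dvd card N div card K" using less.prems(7) \<open>L = N\<close> by simp
        show "A \<subseteq> K" if "A \<lhd> G" "A \<subseteq> N" "A \<noteq> N" for A using False that by blast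
        show "card L = p * card J" if "chief_factor G L J" "L \<subseteq> K" "p dvd card L div card J" for L J
          using IH[OF chief_normal(2)[OF chN] _ _ that] chief_psubset[OF chN] by blast
      qed
      then show ?thesis using chief_step.prime_step \<open>L = N\<close> by blast
    qed
  qed
qed

lemma cyclic_subquotient:
  assumes p: "prime p" and ch: "chief_factor G L K" "card L = p * card K"
  shows "cyclic_group (subquotient G L K)"
proof -
  have KL: "K \<subseteq> L" using chief_psubset[OF ch(1)] by blast
  have KLn: "K \<lhd> G\<lparr>carrier := L\<rparr>"
    by (rule normal_restrict_supergroup[OF chief_subgroups(1)[OF ch(1)] chief_normal(2)[OF ch(1)] KL])
  interpret F: fin_group "subquotient G L K"
  proof (intro fin_group.intro fin_group_axioms.intro)
    show "group (subquotient G L K)" unfolding subquotient_def using KLn by (rule normal.factorgroup_is_group)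
    show "finite (carrier (subquotient G L K))" using chief_subgroups(1)[OF ch(1)] by (simp add: carrier_subquotient)
  qed
  have c: "card (carrier (subquotient G L K)) = p"
    using chief_card_eq[OF ch] by (simp add: carrier_subquotient)
  then have "carrier (subquotient G L K) \<noteq> {\<one>\<^bsub>subquotient G L K\<^esub>}" using prime_gt_1_nat[OF p] by auto
  then obtain x where x: "x \<in> carrier (subquotient G L K)" "x \<noteq> \<one>\<^bsub>subquotient G L K\<^esub>"
    using F.one_closed by blast
  show ?thesis
    unfolding F.cyclic_group
  proof (intro bexI[of _ x] x(1) equalityI subsetI)
    fix z assume "z \<in> carrier (subquotient G L K)"
    then obtain n where "z = x [^]\<^bsub>subquotient G L K\<^esub> (n::nat)"
      using F.prime_order_pow[OF p F.subgroup_self c x] by blast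
    then show "z \<in> range (\<lambda>n::int. x [^]\<^bsub>subquotient G L K\<^esub> n)" by (simp flip: int_pow_int)
  qed (use x in auto)
qed

end

lemma (in group) cyclic_subgroup:
  assumes H: "subgroup H G" "x \<in> H" and range: "H = range (\<lambda>n::int. x [^] n)"
  shows "cyclic_group (G\<lparr>carrier := H\<rparr>)"
proof -
  interpret H: group "G\<lparr>carrier := H\<rparr>" by (rule subgroup.subgroup_is_group[OF H(1) is_group])
  show ?thesis
    unfolding H.cyclic_group
  proof (rule bexI[of _ x])
    show "carrier (G\<lparr>carrier := H\<rparr>) = range (\<lambda>n::int. x [^]\<^bsub>G\<lparr>carrier := H\<rparr>\<^esub> n)"
      unfolding int_pow_consistent[OF H, symmetric] using range by simp
  qed (use H in simp)
qed

theorem theorem3: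
  fixes G :: "('a, 'b) monoid_scheme" and p :: nat and N P :: "'a set"
  assumes "group G" and "finite (carrier G)"
    and "prime p"
    and "N \<lhd> G"
    and "sylow_subgroup p (G\<lparr>carrier := N\<rparr>) P"
    and "\<And>H. subgroup H G \<Longrightarrow> H \<subseteq> P \<Longrightarrow> card H = p \<Longrightarrow> IC_Pi_property G H"
    and "\<And>H. p = 2 \<Longrightarrow> \<not> comm_group (G\<lparr>carrier := P\<rparr>) \<Longrightarrow>
           subgroup H G \<Longrightarrow> H \<subseteq> P \<Longrightarrow> cyclic_group (G\<lparr>carrier := H\<rparr>) \<Longrightarrow> card H = 4 \<Longrightarrow>
           IC_Pi_property G H"
  shows "N \<subseteq> pU_hypercenter p G"
proof -
  interpret fin_group G using assms(1,2) by (simp add: fin_group_def fin_group_axioms_def)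
  note p = assms(3) and Nn = assms(4)
  have Ns: "subgroup N G" using Nn by (rule normal_imp_subgroup)
  have Ps: "subgroup P G" and PN: "P \<subseteq> N" and cP: "card P = p ^ multiplicity p (card N)"
    using assms(5) incl_subgroup[OF Ns] subgroup.subset[of P "G\<lparr>carrier := N\<rparr>"]
    by (auto simp: sylow_subgroup_def order_def)
  have PG: "x \<in> carrier G" if "x \<in> P" for x using that Ps subgroup.mem_carrier by fast
  have sylow: "sylow_in p N P"
  proof -
    have "card N \<noteq> 0" using card_sub_pos[OF Ns] by simp
    then obtain m where "card N = p ^ multiplicity p (card N) * m" "\<not> p dvd m"
      using multiplicity_decompose'[of "card N" p] p by (metis not_prime_unit)
    then have "\<not> p dvd card N div card P" using card_sub_pos[OF Ps] by (metis cP nonzero_mult_div_cancel_left less_irrefl)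
    then show ?thesis using Ps PN cP by (auto simp: sylow_in_def)
  qed
  define q where "q = (if p = 2 \<and> \<not> comm_group (G\<lparr>carrier := P\<rparr>) then 4 else p)"
  have commP: "a \<otimes>\<^bsub>G\<^esub> b = b \<otimes>\<^bsub>G\<^esub> a"
    if "comm_group (G\<lparr>carrier := P\<rparr>)" "a \<in> P" "b \<in> P" for a b
    using comm_monoid.m_comm[OF comm_group.axioms(1)[OF that(1)], of a b] that by simp
  have good: "good_exp p q P"
    using commP prime_odd_nat[OF p] prime_ge_2_nat[OF p] by (auto simp: good_exp_def q_def)
  have IC: "IC_Pi_property G (generate G {x})"
    if x: "x \<in> P" "x \<noteq> \<one>\<^bsub>G\<^esub>" "x [^]\<^bsub>G\<^esub> q = \<one>\<^bsub>G\<^esub>" for x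
  proof -
    let ?H = "generate G {x}"
    have H: "subgroup ?H G" using PG[OF x(1)] by (intro generate_is_subgroup) simp
    have HP: "?H \<subseteq> P" using x(1) by (intro generate_subgroup_incl[OF _ Ps]) simp
    have cH: "card ?H = ord x" using generate_pow_card[OF PG[OF x(1)]] by simp
    have o1: "ord x \<noteq> 1" using ord_eq_1[OF PG[OF x(1)]] x(2) by blast
    have od: "ord x dvd q" using pow_eq_id[OF PG[OF x(1)]] x(3) by blast
    show ?thesis
    proof (cases "ord x = p")
      case True
      then show ?thesis using assms(6)[OF H HP] cH by simp
    next
      case False
      \<comment> \<open>An order other than \<open>1\<close> and \<open>p\<close> can divide
        \<open>q\<close> only if \<open>q = 4\<close>, and then it is 4.\<close>
      then have q4: "q = 4" "p = 2" "\<not> comm_group (G\<lparr>carrier := P\<rparr>)"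
        using od o1 p by (auto simp: q_def prime_nat_iff split: if_splits)
      then have "ord x dvd 2 ^ 2" using od by simp
      then obtain i where i: "ord x = 2 ^ i" "i \<le> 2" using divides_primepow_nat[OF two_is_prime_nat] by blast
      have "i \<noteq> 0" "i \<noteq> 1" using i o1 False q4 by auto
      then have "ord x = 4" using i by (cases "i = 2") auto
      moreover have "cyclic_group (G\<lparr>carrier := ?H\<rparr>)"
      proof (rule cyclic_subgroup[OF H])
        show "x \<in> ?H" by (rule generate.incl) simp
        show "?H = range (\<lambda>n::int. x [^]\<^bsub>G\<^esub> n)"
          by (subst generate_pow[OF PG[OF x(1)]]) auto
      qed
      ultimately show ?thesis using assms(7)[OF q4(2,3) H HP] cH by simp
    qed
  qed
  have "pU_hypercentral p G N"
    unfolding pU_hypercentral_def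
  proof (intro conjI allI impI Nn)
    fix L K assume LK: "chief_factor G L K \<and> L \<subseteq> N \<and> p dvd order (subquotient G L K)"
    then have ch: "chief_factor G L K" by blast
    have "order (subquotient G L K) = card L div card K"
      unfolding order_def carrier_subquotient
      using card_coset_image[OF chief_subgroups(2)[OF ch] chief_subgroups(1)[OF ch]] chief_psubset[OF ch]
      by blast
    then have "p dvd card L div card K" "L \<subseteq> N" using LK by simp_all
    then have "card L = p * card K" using chief_factors_prime[OF p Nn sylow good IC ch] by blast
    then show "cyclic_group (subquotient G L K)" by (rule cyclic_subquotient[OF p ch])
  qed
  then have "N \<subseteq> \<Union>{A. pU_hypercentral p G A}" by blast
  then show ?thesis unfolding pU_hypercenter_def by (blast intro: generate.incl)
qed

end
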